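(* Let $\delta>0$ and let $G$ be an entire function of exponential type $\pi$ in both half-planes $\mathbb{C}_+$ and $\mathbb{C}_-$, with simple zeros, whose zero set $\Lambda$ is contained in $\{\zeta\in\mathbb{C}:\Im\zeta>\delta\}$. Assume that $$\int_{\mathbb{R}}\frac{|G(x)|^2}{1+|x|^2}\,dx<\infty,\qquad \int_{\mathbb{R}}\frac{dx}{|G(x)|^2(1+|x|^2)}<\infty .$$ Then there exists a linear summation method with compactwise convergence, i.e. a matrix $W=\{w(\lambda,n)\}_{\lambda\in\Lambda,\,n\in\mathbb{N}}$ of complex numbers with $\lim_{n\to\infty}w(\lambda,n)=1$ for every $\lambda\in\Lambda$ and $\lim_{\lambda\in\Lambda,|\lambda|\to\infty}w(\lambda,n)=0$ for every $n$, such that for every $F\in\mathcal{P}W_\pi$ and every compact set $K\subset\mathbb{C}$, $$\lim_{n\to\infty}\sum_{\lambda\in\Lambda}w(\lambda,n)F(\lambda)\frac{G(z)}{G'(\lambda)(z-\lambda)}=F(z)\quad\text{uniformly for } z\in K .$$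
   Context: $\mathbb{C}_\pm=\{z:\pm\Im z>0\}$. "Exponential type $\pi$ in $\mathbb{C}_\pm$" means $\limsup_{|z|\to\infty,\,z\in\mathbb{C}_\pm}\frac{\log|G(z)|}{|z|}=\pi$. The Paley–Wiener space is $\mathcal{P}W_\pi=\left\{F: F(z)=\frac1{2\pi}\int_{-\pi}^{\pi}g(t)e^{itz}\,dt,\ g\in L^2(-\pi,\pi)\right\}$. Series over $\Lambda$ are summed with $\Lambda$ enumerated in order of nondecreasing modulus; convergence of the series for each $n$ is part of the assertion. *)

theory Defs
  imports "HOL-Complex_Analysis.Complex_Analysis"
begin

text \<open>The logarithm of the modulus takes the value minus infinity at zeros of \<open>G\<close>, whereas
  \<open>ln 0 = 0\<close> in the library; hence the case distinction.\<close>

definition exp_type_on :: "complex set \<Rightarrow> (complex \<Rightarrow> complex) \<Rightarrow> ereal" where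
  "exp_type_on H G =
     Limsup (inf at_infinity (principal H))
       (\<lambda>z. if G z = 0 then -\<infinity> else ereal (ln (cmod (G z)) / cmod z))"

definition paley_wiener :: "(complex \<Rightarrow> complex) set" where
  "paley_wiener =
     {F. \<exists>g :: real \<Rightarrow> complex.
           g \<in> borel_measurable (lebesgue_on {-pi<..<pi}) \<and>
           integrable (lebesgue_on {-pi<..<pi}) (\<lambda>t. (cmod (g t))\<^sup>2) \<and>
           (\<forall>z. F z = 1 / (2 * of_real pi) *
                  (LINT t|lebesgue_on {-pi<..<pi}. g t * exp (\<i> * of_real t * z)))}"

text \<open>As an entire function of \<open>z\<close>, \<open>G z / (G' l * (z - l))\<close> has a removable singularity with
  value 1 at a simple zero \<open>l\<close> of \<open>G\<close>; division by zero would give 0 there.\<close>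

definition lagrange_fun :: "(complex \<Rightarrow> complex) \<Rightarrow> complex \<Rightarrow> complex \<Rightarrow> complex" where
  "lagrange_fun G l z = (if z = l then 1 else G z / (deriv G l * (z - l)))"

text \<open>Enumerations of a finite or countably infinite set by an initial segment of the naturals,
  without repetition and in order of nondecreasing modulus.\<close>

definition enum_index :: "complex set \<Rightarrow> nat set" where
  "enum_index S = {k. finite S \<longrightarrow> k < card S}"

definition modulus_enum :: "complex set \<Rightarrow> (nat \<Rightarrow> complex) \<Rightarrow> bool" where
  "modulus_enum S e \<longleftrightarrow>
     bij_betw e (enum_index S) S \<and>
     (\<forall>j\<in>enum_index S. \<forall>k\<in>enum_index S. j \<le> k \<longrightarrow> cmod (e j) \<le> cmod (e k))"

text \<open>Points of equal modulus may be listed in any order, so an enumeration need not be unique: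
  the sum must exist and be the same for all of them. The existence of an enumeration is required
  explicitly, so that the condition is never vacuous.\<close>

definition modulus_sums :: "(complex \<Rightarrow> complex) \<Rightarrow> complex set \<Rightarrow> complex \<Rightarrow> bool" where
  "modulus_sums f S s \<longleftrightarrow>
     (\<exists>e. modulus_enum S e) \<and>
     (\<forall>e. modulus_enum S e \<longrightarrow>
        (\<lambda>k. if k \<in> enum_index S then f (e k) else 0) sums s)"

end

theory Submission
  imports Defs "HOL-Real_Asymp.Real_Asymp"
begin

text \<open>Write \<open>G\<^sup>*(z)\<close> for the conjugate of \<open>G\<close> at the conjugate point (\<open>reflect G\<close> below). Let
\<open>\<Lambda>\<^sub>n\<close> be the zeros of modulus at most \<open>n\<close>, and let \<open>p\<close> be the monic polynomial with these zeros, so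
that \<open>G = p g\<close>. The quotient \<open>W\<^sub>n = \<kappa> g / g\<^sup>*\<close>, with a constant \<open>\<kappa>\<close> of modulus one chosen such that
\<open>W\<^sub>n(0) = 1\<close>, is the tail of the Blaschke product of \<open>\<Lambda>\<close>: it has modulus one on the real line,
modulus at most one in the upper half-plane, and it vanishes exactly at the zeros of modulus larger
than \<open>n\<close>. The weights are \<open>w(\<lambda>,n) = W\<^sub>n(\<lambda>)\<close>. Hence every sum is finite, and all the work goes into
the limit.

For non-real \<open>z\<close>, Cauchy's formula on the upper half-plane for \<open>F / G\<^sup>*\<close>, combined with partial
fractions for \<open>p\<^sup>* / p\<close>, turns the \<open>n\<close>-th sum into
\<open>[Im z > 0] W\<^sub>n(z) F(z) - (G(z) / 2\<pi>i) \<integral> W\<^sub>n F / (G (x - z)) dx\<close> (\<open>sum_as_integral\<close>). The same formula with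
\<open>1\<close> in place of \<open>W\<^sub>n\<close> gives \<open>F(z)\<close> itself (\<open>F_as_integral\<close>, which is Cauchy's formula in the lower
half-plane). The difference is controlled by \<open>W\<^sub>n - 1\<close> at \<open>z\<close> and by the integral of
\<open>\<bar>W\<^sub>n - 1\<bar> \<bar>F/G\<bar> / (1 + \<bar>x\<bar>)\<close>, which tends to zero by dominated convergence, since \<open>F\<close> and
\<open>1 / (G (1 + \<bar>x\<bar>))\<close> are square integrable. The resulting error bound blows up like \<open>1 / \<bar>Im z\<bar>\<close> near
the real line. On a circle of radius \<open>r\<close> the factor \<open>z\<^sup>2 - r\<^sup>2\<close> has modulus \<open>2 r \<bar>Im z\<bar>\<close>, so the maximum
principle removes the singularity (\<open>S_uniform_limit\<close>).

Two things must be known about \<open>G\<close>. First, Cauchy's formula needs a bound for \<open>1 / G\<^sup>*\<close> in the upper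
half-plane. There \<open>G\<^sup>* exp(i\<pi>z)\<close> has no zeros and, by a Phragmen-Lindelof argument, grows at most like
a polynomial. After division by a polynomial, its logarithm therefore has a real part of constant sign.
Because the type of \<open>G\<close> in the lower half-plane is not smaller than \<open>\<pi>\<close>, Harnack's inequality forces this
real part to be \<open>o(\<bar>z\<bar>)\<close> in sectors and \<open>O(\<bar>z\<bar>\<^sup>2)\<close> throughout (\<open>reciprocal_growth\<close>), which is enough for
further Phragmen-Lindelof arguments. Second, \<open>W\<^sub>n\<close> must tend to one. On the disc of radius \<open>n\<close> one has
\<open>W\<^sub>n = exp(i h)\<close> with \<open>h\<close> symmetric under reflection and mapping the upper half-disc into the upper
half-plane; such a function is close to \<open>a\<^sub>n z\<close> with \<open>a\<^sub>n \<ge> 0\<close> (\<open>reflection_symmetric_near_linear\<close>). If \<open>a\<^sub>n\<close>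
did not tend to zero, then \<open>\<bar>G\<bar> \<le> \<bar>G\<^sup>*\<bar> exp(- c Im z)\<close> would hold with \<open>c > 0\<close>, and the type of \<open>G\<close> in the
upper half-plane would be smaller than \<open>\<pi>\<close> (\<open>W_uniform_limit\<close>).\<close>

section \<open>Enumerations in order of modulus\<close>

text \<open>Pick successively a point of least modulus among those not yet listed. Local finiteness provides the
minimum at each step, and ensures that no point is postponed forever.\<close>

lemma modulus_enum_exists:
  assumes fin: "\<And>r. finite {s \<in> S. cmod s \<le> r}"
  shows "\<exists>e. modulus_enum S e"
proof -
  define least where "least U s \<longleftrightarrow> s \<in> S - U \<and> (\<forall>t\<in>S - U. cmod s \<le> cmod t)" for U s
  have least_ex: "\<exists>s. least U s" if nonempty: "S - U \<noteq> {}" for U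
  proof -
    obtain s0 where s0: "s0 \<in> S - U" using nonempty by blast
    define V where "V = {s \<in> S - U. cmod s \<le> cmod s0}"
    have "finite V" by (rule finite_subset[OF _ fin[of "cmod s0"]]) (auto simp: V_def)
    moreover have "V \<noteq> {}" using s0 by (auto simp: V_def)
    ultimately obtain s where s: "s \<in> V" "\<And>t. t \<in> V \<Longrightarrow> cmod s \<le> cmod t"
      using ex_min_if_finite[of "cmod ` V"] by (auto simp: not_less)
    have "cmod s \<le> cmod t" if "t \<in> S - U" for t
      using s that by (cases "cmod t \<le> cmod s0") (auto simp: V_def intro: order_trans)
    then show ?thesis using s by (auto simp: least_def V_def)
  qed
  define U where "U = rec_nat {} (\<lambda>_ V. insert (SOME s. least V s) V)"
  define e where "e n = (SOME s. least (U n) s)" for n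
  have U0: "U 0 = {}" and USuc: "U (Suc n) = insert (e n) (U n)" for n
    by (simp_all add: U_def e_def)
  have U: "U n = e ` {..<n}" for n
    by (induction n) (auto simp: U0 USuc lessThan_Suc)
  have ne: "S - U n \<noteq> {}" if "n \<in> enum_index S" for n
  proof
    assume "S - U n = {}"
    then have "S \<subseteq> e ` {..<n}" by (auto simp: U)
    then have "finite S" "card S \<le> n"
      using finite_subset surj_card_le[of "{..<n}" S e] by auto
    then show False using that by (auto simp: enum_index_def)
  qed
  have e: "least (U n) (e n)" if "n \<in> enum_index S" for n
    unfolding e_def using someI_ex[OF least_ex[OF ne[OF that]]] .
  have eS: "e n \<in> S" if "n \<in> enum_index S" for n using e[OF that] by (simp add: least_def)
  have mono: "cmod (e j) \<le> cmod (e k)" if "j \<in> enum_index S" "k \<in> enum_index S" "j \<le> k" for j k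
  proof -
    have "e k \<in> S - U j" using e[OF that(2)] that(3) by (auto simp: least_def U)
    then show ?thesis using e[OF that(1)] by (auto simp: least_def)
  qed
  have neq: "e j \<noteq> e k" if "k \<in> enum_index S" "j < k" for j k
    using e[OF that(1)] that(2) unfolding least_def U
    by (metis DiffD2 imageI lessThan_iff)
  have inj: "inj_on e (enum_index S)"
    by (rule inj_onI) (metis neq linorder_neqE_nat)
  have surj: "e ` enum_index S = S"
  proof (cases "finite S")
    case True
    then have idx: "enum_index S = {..<card S}" by (auto simp: enum_index_def)
    show ?thesis
      by (rule card_subset_eq[OF True]) (use eS card_image[OF inj] in \<open>auto simp: idx\<close>)
  next
    case False
    then have idx: "enum_index S = UNIV" by (auto simp: enum_index_def)
    have "s \<in> range e" if s: "s \<in> S" for s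
    proof (rule ccontr)
      assume "s \<notin> range e"
      then have "s \<in> S - U n" for n using s by (auto simp: U)
      then have "range e \<subseteq> {t \<in> S. cmod t \<le> cmod s}"
        using e eS by (auto simp: least_def idx)
      then have "finite (range e)" using fin finite_subset by blast
      then show False using inj by (simp add: idx finite_image_iff)
    qed
    then show ?thesis using eS by (auto simp: idx)
  qed
  have "modulus_enum S e"
    unfolding modulus_enum_def bij_betw_def using inj surj mono by blast
  then show ?thesis by blast
qed

lemma modulus_sums_finite_support:
  assumes fin: "\<And>r. finite {s \<in> S. cmod s \<le> r}"
    and A: "finite A" "A \<subseteq> S" and supp: "\<And>l. l \<in> S - A \<Longrightarrow> f l = 0"
  shows "modulus_sums f S (\<Sum>l\<in>A. f l)"
  unfolding modulus_sums_def
proof (intro conjI allI impI)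
  show "\<exists>e. modulus_enum S e" by (rule modulus_enum_exists[OF fin])
  fix e assume "modulus_enum S e"
  then have bij: "bij_betw e (enum_index S) S" by (simp add: modulus_enum_def)
  define B where "B = enum_index S \<inter> e -` A"
  have eB: "bij_betw e B A"
  proof (rule bij_betw_imageI)
    show "inj_on e B" using bij by (auto simp: bij_betw_def B_def intro: inj_on_subset)
    show "e ` B = A" using bij A(2) by (force simp: bij_betw_def B_def)
  qed
  have "finite B" using bij_betw_finite[OF eB] A(1) by simp
  have "(\<lambda>k. if k \<in> enum_index S then f (e k) else 0) sums
        (\<Sum>k\<in>B. if k \<in> enum_index S then f (e k) else 0)"
  proof (rule sums_finite[OF \<open>finite B\<close>])
    fix k assume "k \<notin> B"
    then show "(if k \<in> enum_index S then f (e k) else 0) = 0"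
      using bij supp[of "e k"] by (auto simp: B_def bij_betw_def)
  qed
  also have "(\<Sum>k\<in>B. if k \<in> enum_index S then f (e k) else 0) = (\<Sum>k\<in>B. f (e k))"
    by (rule sum.cong) (auto simp: B_def)
  also have "\<dots> = (\<Sum>l\<in>A. f l)" by (rule sum.reindex_bij_betw[OF eB])
  finally show "(\<lambda>k. if k \<in> enum_index S then f (e k) else 0) sums (\<Sum>l\<in>A. f l)" .
qed

section \<open>Phragmen-Lindelof principles\<close>

text \<open>The damping factor \<open>exp(- e g)\<close> makes the maximum principle applicable on a bounded piece of \<open>A\<close>;
afterwards \<open>e\<close> tends to zero.\<close>

lemma phragmen_lindelof_gauge:
  assumes "closed A" and cf: "continuous_on A f" and hf: "f holomorphic_on interior A"
    and cg: "continuous_on A g" and hg: "g holomorphic_on interior A"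
    and bdry: "\<And>z. z \<in> frontier A \<Longrightarrow> cmod (f z) \<le> M"
    and gpos: "\<And>z. z \<in> A \<Longrightarrow> 0 \<le> Re (g z)"
    and growth: "\<And>e. e > 0 \<Longrightarrow> \<exists>R. \<forall>z\<in>A. R \<le> cmod z \<longrightarrow> cmod (f z) * exp (- e * Re (g z)) \<le> M"
    and z: "z \<in> A"
  shows "cmod (f z) \<le> M"
proof -
  have *: "cmod (f z) * exp (- e * Re (g z)) \<le> M" if e: "e > 0" for e :: real
  proof -
    obtain R where R: "\<forall>w\<in>A. R \<le> cmod w \<longrightarrow> cmod (f w) * exp (- e * Re (g w)) \<le> M"
      using growth[OF e] by blast
    define r where "r = max R (cmod z)"
    define S where "S = A \<inter> cball 0 r"
    define F where "F = (\<lambda>w. f w * exp (- of_real e * g w))"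
    have nF: "cmod (F w) = cmod (f w) * exp (- e * Re (g w))" for w
      by (simp add: F_def norm_mult)
    have "closed S" using \<open>closed A\<close> by (auto simp: S_def)
    have "interior S \<subseteq> interior A" by (auto simp: S_def)
    have "cmod (F z) \<le> M"
    proof (rule maximum_modulus_frontier[of F S])
      show "F holomorphic_on interior S"
        unfolding F_def using \<open>interior S \<subseteq> interior A\<close> hf hg
        by (intro holomorphic_intros) (auto intro: holomorphic_on_subset)
      show "continuous_on (closure S) F"
        unfolding F_def closure_closed[OF \<open>closed S\<close>] using cf cg
        by (intro continuous_intros) (auto simp: S_def intro: continuous_on_subset)
      show "bounded S" by (auto simp: S_def intro: bounded_subset[OF bounded_cball])
      show "z \<in> S" using z by (auto simp: S_def r_def)
      fix w assume w: "w \<in> frontier S"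
      then have wS: "w \<in> A" using \<open>closed S\<close> by (auto simp: frontier_def S_def)
      have "w \<in> frontier A \<or> w \<in> sphere 0 r"
        using w frontier_Int_subset[of A "cball 0 r"] by (auto simp: S_def)
      then show "cmod (F w) \<le> M"
      proof
        assume a: "w \<in> frontier A"
        have "cmod (f w) * exp (- e * Re (g w)) \<le> cmod (f w) * 1"
          using gpos[OF wS] e by (intro mult_left_mono) auto
        also have "\<dots> \<le> M" using bdry[OF a] by simp
        finally show ?thesis by (simp add: nF)
      next
        assume "w \<in> sphere 0 r"
        then show ?thesis using R wS by (simp add: nF r_def)
      qed
    qed
    then show ?thesis by (simp add: nF)
  qed
  have "((\<lambda>e. cmod (f z) * exp (- e * Re (g z))) \<longlongrightarrow> cmod (f z) * exp (- 0 * Re (g z))) (at_right 0)"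
    by (intro tendsto_intros)
  moreover have "eventually (\<lambda>e. cmod (f z) * exp (- e * Re (g z)) \<le> M) (at_right 0)"
    using * by (auto simp: eventually_at_right_field intro!: exI[of _ 1])
  ultimately show ?thesis
    by (intro tendsto_upperbound[of _ "cmod (f z)" "at_right 0"]) auto
qed

text \<open>The sector has opening \<open>\<pi>/4\<close>, so order two is subcritical. The gauge is cubic: with \<open>x = s Re z\<close> and
\<open>y = Im z\<close> in the case \<open>s = 1\<close>, the real part of \<open>(1 - 2i) z\<^sup>3\<close> is
\<open>x\<^sup>3 + 6 x\<^sup>2 y - 3 x y\<^sup>2 - 2 y\<^sup>3\<close>, which is at least \<open>x\<^sup>3\<close> when \<open>0 \<le> y \<le> x\<close>. The case \<open>s = -1\<close> is its mirror
image.\<close>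

lemma phragmen_lindelof_sector:
  fixes s :: real
  defines "A \<equiv> {z. 0 \<le> Im z \<and> Im z \<le> s * Re z}"
  assumes s: "s = 1 \<or> s = -1"
    and cf: "continuous_on A f" and hf: "f holomorphic_on interior A"
    and bdry: "\<And>z. z \<in> A \<Longrightarrow> Im z = 0 \<or> Im z = s * Re z \<Longrightarrow> cmod (f z) \<le> M"
    and growth: "\<And>z. z \<in> A \<Longrightarrow> cmod (f z) \<le> C * exp (C * (cmod z)\<^sup>2)"
    and M: "M > 0" and z: "z \<in> A"
  shows "cmod (f z) \<le> M"
proof (rule phragmen_lindelof_gauge[where A = A and g = "\<lambda>z. Complex s (-2) * z ^ 3" and f = f])
  have A_eq: "A = {z. 0 \<le> Im z} \<inter> {z. Im z \<le> s * Re z}" by (auto simp: A_def)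
  show "closed A" unfolding A_eq
    by (intro closed_Int closed_Collect_le continuous_intros)
  show "continuous_on A f" "f holomorphic_on interior A" "z \<in> A" by fact+
  show "continuous_on A (\<lambda>z. Complex s (-2) * z ^ 3)" by (intro continuous_intros)
  show "(\<lambda>z. Complex s (-2) * z ^ 3) holomorphic_on interior A" by (intro holomorphic_intros)
  have gauge: "Re (Complex s (-2) * w ^ 3) \<ge> (s * Re w) ^ 3" and sRe: "0 \<le> s * Re w"
    and Im_le: "Im w \<le> s * Re w" "0 \<le> Im w" if "w \<in> A" for w
  proof -
    define x y where "x = s * Re w" "y = Im w"
    have xy: "0 \<le> y" "y \<le> x" using that by (auto simp: A_def x_y_def)
    have ss: "s * s = 1" using s by auto
    have "Re w = s * x" using ss by (simp add: x_y_def mult.assoc[symmetric])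
    then have "Re (Complex s (-2) * w ^ 3) = x ^ 3 + 6 * x\<^sup>2 * y - 3 * x * y\<^sup>2 - 2 * y ^ 3"
      using ss s by (auto simp: power3_eq_cube power2_eq_square x_y_def(2)[symmetric] algebra_simps)
    moreover have "y\<^sup>2 * x \<le> x\<^sup>2 * y" "y ^ 3 \<le> x\<^sup>2 * y"
      using xy mult_mono[of y x "y * x" "y * x"] mult_mono[of "y*y" "x*x" y y] mult_mono[of y x y x]
      by (auto simp: power2_eq_square power3_eq_cube algebra_simps)
    moreover have "0 \<le> x\<^sup>2 * y" using xy by simp
    ultimately show "Re (Complex s (-2) * w ^ 3) \<ge> (s * Re w) ^ 3"
      unfolding x_y_def(1)[symmetric] by (simp add: mult.commute)
    show "0 \<le> s * Re w" "Im w \<le> s * Re w" "0 \<le> Im w" using xy by (auto simp: x_y_def)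
  qed
  show "0 \<le> Re (Complex s (-2) * w ^ 3)" if "w \<in> A" for w
    using gauge[OF that] sRe[OF that] by (meson order_trans zero_le_power)
  have "{w. 0 < Im w} \<inter> {w. Im w < s * Re w} \<subseteq> interior A"
    by (rule interior_maximal) (auto simp: A_def intro!: open_Int open_Collect_less continuous_intros)
  then show "cmod (f w) \<le> M" if "w \<in> frontier A" for w
    using that bdry[of w] \<open>closed A\<close> by (force simp: frontier_def A_def)
  fix e :: real assume e: "e > 0"
  define C' where "C' = \<bar>C\<bar> + 1"
  have C': "C' > 0" "C \<le> C'" by (auto simp: C'_def)
  have "((\<lambda>r. C' * exp (C' * r\<^sup>2) * exp (- e * (r/2)^3)) \<longlongrightarrow> 0) at_top"
    using e C'(1) by real_asymp
  then have "eventually (\<lambda>r. C' * exp (C' * r\<^sup>2) * exp (- e * (r/2)^3) < M) at_top"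
    using M by (simp add: order_tendsto_iff)
  then obtain R where R: "\<And>r. r \<ge> R \<Longrightarrow> C' * exp (C' * r\<^sup>2) * exp (- e * (r/2)^3) < M"
    by (auto simp: eventually_at_top_linorder)
  show "\<exists>R. \<forall>w\<in>A. R \<le> cmod w \<longrightarrow> cmod (f w) * exp (- e * Re (Complex s (-2) * w ^ 3)) \<le> M"
  proof (intro exI ballI impI)
    fix w assume w: "w \<in> A" "R \<le> cmod w"
    have "cmod w \<le> \<bar>Re w\<bar> + \<bar>Im w\<bar>" by (rule cmod_le)
    also have "\<dots> \<le> 2 * (s * Re w)" using Im_le[OF w(1)] s by auto
    finally have "(cmod w / 2) ^ 3 \<le> (s * Re w) ^ 3" by (intro power_mono) auto
    also have "\<dots> \<le> Re (Complex s (-2) * w ^ 3)" by (rule gauge[OF w(1)])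
    finally have 1: "exp (- e * Re (Complex s (-2) * w ^ 3)) \<le> exp (- e * (cmod w / 2) ^ 3)"
      using e by (simp add: mult_left_mono del: times_complex.simps)
    have "cmod (f w) \<le> C * exp (C * (cmod w)\<^sup>2)" by (rule growth[OF w(1)])
    also have "\<dots> \<le> C' * exp (C' * (cmod w)\<^sup>2)"
      using C' by (intro mult_mono) (auto intro: mult_right_mono)
    finally have 2: "cmod (f w) \<le> C' * exp (C' * (cmod w)\<^sup>2)" .
    have "cmod (f w) * exp (- e * Re (Complex s (-2) * w ^ 3))
        \<le> C' * exp (C' * (cmod w)\<^sup>2) * exp (- e * (cmod w / 2) ^ 3)"
      using 1 2 C' by (intro mult_mono) auto
    also have "\<dots> \<le> M" using R[OF w(2)] by simp
    finally show "cmod (f w) * exp (- e * Re (Complex s (-2) * w ^ 3)) \<le> M" .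
  qed
qed

text \<open>Substituting \<open>z = w\<^sup>2\<close> maps the sector of opening \<open>\<pi>/4\<close> onto the quadrant and turns growth of order one
into growth of order two.\<close>

lemma phragmen_lindelof_quadrant:
  defines "Q \<equiv> {z. 0 \<le> Re z \<and> 0 \<le> Im z}"
  assumes cf: "continuous_on Q f" and hf: "f holomorphic_on interior Q"
    and bdry: "\<And>z. z \<in> Q \<Longrightarrow> Im z = 0 \<or> Re z = 0 \<Longrightarrow> cmod (f z) \<le> M"
    and growth: "\<And>z. z \<in> Q \<Longrightarrow> cmod (f z) \<le> C * exp (C * cmod z)"
    and M: "M > 0" and z: "z \<in> Q"
  shows "cmod (f z) \<le> M"
proof -
  define A where "A = {z. 0 \<le> Im z \<and> Im z \<le> 1 * Re z}"
  have sq: "w\<^sup>2 \<in> Q" if "w \<in> A" for w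
    using that by (auto simp: A_def Q_def power2_eq_square intro: mult_mono)
  have intA: "interior A \<subseteq> {z. 0 < Im z} \<inter> {z. Im z < 1 * Re z}"
  proof -
    have "A = {z. inner (- \<i>) z \<le> 0} \<inter> {z. inner (Complex (-1) 1) z \<le> 0}"
      by (auto simp: A_def inner_complex_def)
    moreover have "interior {z. inner (- \<i>) z \<le> 0} = {z. inner (- \<i>) z < 0}"
      by (rule interior_halfspace_le) simp
    moreover have "interior {z. inner (Complex (-1) 1) z \<le> 0} = {z. inner (Complex (-1) 1) z < 0}"
      by (rule interior_halfspace_le) (simp add: complex_eq_iff)
    ultimately show ?thesis by (simp only: interior_Int) (auto simp: inner_complex_def)
  qed
  have intQ: "{z. 0 < Re z} \<inter> {z. 0 < Im z} \<subseteq> interior Q"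
    by (rule interior_maximal) (auto simp: Q_def intro!: open_Int open_Collect_less continuous_intros)
  define w where "w = csqrt z"
  have w2: "w\<^sup>2 = z" by (simp add: w_def)
  have "w \<in> A"
  proof -
    have z': "Re z \<ge> 0" "Im z \<ge> 0" using z by (auto simp: Q_def)
    have nz: "0 \<le> cmod z + Re z" using z' norm_ge_zero[of z] by linarith
    then have r: "Re w \<ge> 0" by (simp add: w_def)
    have i: "Im w \<ge> 0" using z' by (simp add: w_def complex_Re_le_cmod)
    have "Re z = (Re w)\<^sup>2 - (Im w)\<^sup>2"
      unfolding w2[symmetric] by (simp add: power2_eq_square)
    then have "(Im w)\<^sup>2 \<le> (Re w)\<^sup>2" using z' by simp
    then have "Im w \<le> Re w" using r by (rule power2_le_imp_le)
    then show ?thesis using i by (simp add: A_def)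
  qed
  have "cmod ((\<lambda>w. f (w\<^sup>2)) w) \<le> M"
  proof (rule phragmen_lindelof_sector[where s = 1 and f = "\<lambda>w. f (w\<^sup>2)", folded A_def])
    show "continuous_on A (\<lambda>w. f (w\<^sup>2))"
      using sq by (intro continuous_on_compose2[OF cf] continuous_intros) auto
    have "(f \<circ> (\<lambda>w. w\<^sup>2)) holomorphic_on interior A"
      by (rule holomorphic_on_compose_gen[OF _ hf])
         (use intA intQ in \<open>force intro!: holomorphic_intros mult_strict_mono simp: power2_eq_square\<close>)+
    then show "(\<lambda>w. f (w\<^sup>2)) holomorphic_on interior A" by (simp add: o_def)
    show "cmod (f (v\<^sup>2)) \<le> M" if "v \<in> A" "Im v = 0 \<or> Im v = 1 * Re v" for v
      using that by (intro bdry sq) (auto simp: power2_eq_square)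
    show "cmod (f (v\<^sup>2)) \<le> C * exp (C * (cmod v)\<^sup>2)" if "v \<in> A" for v
      using growth[OF sq[OF that]] by (simp add: norm_power)
    show "w \<in> A" by fact
  qed (use M in auto)
  then show ?thesis by (simp add: w2)
qed

lemma analytic_UHP_continuous:
  "f analytic_on {z. 0 \<le> Im z} \<Longrightarrow> A \<subseteq> {z. 0 \<le> Im z} \<Longrightarrow> continuous_on A f"
  by (meson analytic_imp_holomorphic continuous_on_subset holomorphic_on_imp_continuous_on)

lemma analytic_UHP_holomorphic:
  "f analytic_on {z. 0 \<le> Im z} \<Longrightarrow> A \<subseteq> {z. 0 \<le> Im z} \<Longrightarrow> f holomorphic_on A"
  by (meson analytic_imp_holomorphic holomorphic_on_subset)

lemma closed_UHP: "closed {z. 0 \<le> Im z}"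
  by (intro closed_Collect_le continuous_intros)

lemma frontier_UHP: "frontier {z. 0 \<le> Im z} = {z. Im z = 0}"
proof -
  have "{z. 0 \<le> Im z} = {z. inner (- \<i>) z \<le> 0}" by (auto simp: inner_complex_def)
  then show ?thesis using frontier_halfspace_le[of "- \<i>" 0] by (auto simp: inner_complex_def)
qed

text \<open>Division by \<open>1 - i e z\<close>, whose modulus is at least one in the half-plane, makes a bounded function small
at infinity.\<close>

lemma phragmen_lindelof_bounded:
  assumes f: "f analytic_on {z. 0 \<le> Im z}"
    and bdry: "\<And>x. cmod (f (of_real x)) \<le> M"
    and bdd: "\<And>z. 0 \<le> Im z \<Longrightarrow> cmod (f z) \<le> B"
    and M: "M > 0" and z: "0 \<le> Im z"
  shows "cmod (f z) \<le> M"
proof -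
  have ge1: "cmod (1 - \<i> * of_real e * w) \<ge> 1" if "0 \<le> Im w" "e > 0" for e w
  proof -
    have "Re (1 - \<i> * of_real e * w) \<ge> 1" using that by simp
    then show ?thesis using complex_Re_le_cmod order_trans by blast
  qed
  have *: "cmod (f z / (1 - \<i> * of_real e * z)) \<le> M" if e: "e > 0" for e :: real
  proof (rule phragmen_lindelof_gauge[where A = "{z. 0 \<le> Im z}" and g = "\<lambda>_. 0"
      and f = "\<lambda>z. f z / (1 - \<i> * of_real e * z)"])
    have nz: "1 - \<i> * of_real e * w \<noteq> 0" if "0 \<le> Im w" for w
      using ge1[OF that e] by auto
    show "closed {z. 0 \<le> Im z}" by (rule closed_UHP)
    show "continuous_on {z. 0 \<le> Im z} (\<lambda>z. f z / (1 - \<i> * of_real e * z))"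
      by (intro continuous_intros analytic_UHP_continuous[OF f]) (use nz in auto)
    show "(\<lambda>z. f z / (1 - \<i> * of_real e * z)) holomorphic_on interior {z. 0 \<le> Im z}"
      using interior_subset[of "{z. 0 \<le> Im z}"] nz
      by (intro holomorphic_intros analytic_UHP_holomorphic[OF f]) auto
    show "cmod (f w / (1 - \<i> * of_real e * w)) \<le> M" if "w \<in> frontier {z. 0 \<le> Im z}" for w
    proof -
      have w: "Im w = 0" using that by (simp add: frontier_UHP)
      then have "of_real (Re w) = w" by (simp add: complex_eq_iff)
      then have "cmod (f w) \<le> M" using bdry[of "Re w"] by simp
      also have "M \<le> M * cmod (1 - \<i> * of_real e * w)" using ge1[of w e] w e M by simp
      finally show ?thesis using ge1[of w e] w e M
        by (simp add: norm_divide divide_le_eq)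
    qed
    show "\<exists>R. \<forall>w\<in>{z. 0 \<le> Im z}. R \<le> cmod w \<longrightarrow>
       cmod (f w / (1 - \<i> * of_real e * w)) * exp (- e' * Re 0) \<le> M" for e' :: real
    proof (intro exI ballI impI)
      fix w assume w: "w \<in> {z. 0 \<le> Im z}" "(B / M + 1) / e \<le> cmod w"
      have "B / M + 1 \<le> e * cmod w" using w e by (simp add: field_simps)
      also have "\<dots> = cmod (\<i> * of_real e * w)" using e by (simp add: norm_mult)
      also have "\<dots> \<le> cmod (1 - \<i> * of_real e * w) + 1"
        by (metis norm_minus_commute norm_one norm_triangle_sub add.commute)
      finally have "B \<le> M * cmod (1 - \<i> * of_real e * w)" using M by (simp add: field_simps)
      then have "cmod (f w) \<le> M * cmod (1 - \<i> * of_real e * w)" using bdd[of w] w by auto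
      then show "cmod (f w / (1 - \<i> * of_real e * w)) * exp (- e' * Re 0) \<le> M"
        using ge1[of w e] w e M by (simp add: norm_divide divide_le_eq)
    qed
  qed (use z in auto)
  have "((\<lambda>e. cmod (f z / (1 - \<i> * of_real e * z))) \<longlongrightarrow> cmod (f z / (1 - \<i> * of_real 0 * z))) (at_right 0)"
    by (intro tendsto_intros) auto
  moreover have "eventually (\<lambda>e. cmod (f z / (1 - \<i> * of_real e * z)) \<le> M) (at_right 0)"
    using * by (auto simp: eventually_at_right_field intro!: exI[of _ 1])
  ultimately show ?thesis
    by (intro tendsto_upperbound[of _ "cmod (f z)" "at_right 0"]) auto
qed

lemma le_of_forall_exp_damped:
  assumes "\<And>e. e > 0 \<Longrightarrow> cmod (f z * exp (\<i> * of_real e * z)) \<le> M"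
  shows "cmod (f z) \<le> M"
proof -
  have "((\<lambda>e. cmod (f z * exp (\<i> * of_real e * z))) \<longlongrightarrow> cmod (f z * exp (\<i> * of_real 0 * z))) (at_right 0)"
    by (intro tendsto_intros)
  moreover have "eventually (\<lambda>e. cmod (f z * exp (\<i> * of_real e * z)) \<le> M) (at_right 0)"
    using assms by (auto simp: eventually_at_right_field intro!: exI[of _ 1])
  ultimately show ?thesis
    by (intro tendsto_upperbound[of _ "cmod (f z)" "at_right 0"]) auto
qed

lemma norm_exp_i_mult: "cmod (exp (\<i> * of_real e * z)) = exp (- e * Im z)"
  by simp

text \<open>A growth class, closed under products and primitives, for which the Phragmen-Lindelof principle of the
upper half-plane holds: order two everywhere, which is subcritical in the two sectors of opening \<open>\<pi>/4\<close>
next to the real line, and zero exponential type in the remaining sector.\<close>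

definition pl_growth :: "(complex \<Rightarrow> complex) \<Rightarrow> bool" where
  "pl_growth f \<longleftrightarrow>
     (\<exists>C. \<forall>z. 0 \<le> Im z \<longrightarrow> cmod (f z) \<le> C * exp (C * (cmod z)\<^sup>2)) \<and>
     (\<forall>e>0. \<exists>C. \<forall>z. \<bar>Re z\<bar> \<le> Im z \<longrightarrow> cmod (f z) \<le> C * exp (e * cmod z))"

text \<open>After multiplication by \<open>exp(i e z)\<close> the function is bounded in the middle sector, hence in the two
outer sectors, hence everywhere; then the bound on the real line prevails, and \<open>e\<close> tends to zero.\<close>

lemma phragmen_lindelof_half_plane:
  assumes f: "f analytic_on {z. 0 \<le> Im z}"
    and bdry: "\<And>x. cmod (f (of_real x)) \<le> M"
    and gr: "pl_growth f"
    and M: "M > 0" and z: "0 \<le> Im z"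
  shows "cmod (f z) \<le> M"
proof (rule le_of_forall_exp_damped[of f])
  fix e :: real assume e: "e > 0"
  define g where "g = (\<lambda>z. f z * exp (\<i> * of_real e * z))"
  have ng: "cmod (g z) = cmod (f z) * exp (- e * Im z)" for z
    by (simp only: g_def norm_mult norm_exp_i_mult)
  have ng_le: "cmod (g z) \<le> cmod (f z)" if "0 \<le> Im z" for z
    using that e mult_left_mono[of "exp (- e * Im z)" 1 "cmod (f z)"] by (simp add: ng)
  have ga: "g analytic_on {z. 0 \<le> Im z}"
    unfolding g_def by (intro analytic_intros f)
  obtain C1 where C1: "\<And>z. 0 \<le> Im z \<Longrightarrow> cmod (f z) \<le> C1 * exp (C1 * (cmod z)\<^sup>2)"
    using gr by (auto simp: pl_growth_def)
  have "e/2 > 0" using e by simp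
  then obtain C2 where C2: "\<And>z. \<bar>Re z\<bar> \<le> Im z \<Longrightarrow> cmod (f z) \<le> C2 * exp (e/2 * cmod z)"
    using gr unfolding pl_growth_def by blast
  define B where "B = max M C2"
  have B: "B > 0" using M by (simp add: B_def)
  have mid: "cmod (g z) \<le> B" if z: "\<bar>Re z\<bar> \<le> Im z" for z
  proof -
    have "cmod z \<le> 2 * Im z" using cmod_le[of z] z by linarith
    then have "exp (e/2 * cmod z) * exp (- e * Im z) \<le> 1"
      using e by (simp add: exp_add[symmetric])
    moreover have "C2 \<ge> 0" using C2[of 0] norm_ge_zero[of "f 0"] by (simp del: norm_ge_zero)
    ultimately have "C2 * (exp (e/2 * cmod z) * exp (- e * Im z)) \<le> C2 * 1"
      by (intro mult_left_mono)
    moreover have "cmod (g z) \<le> C2 * exp (e/2 * cmod z) * exp (- e * Im z)"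
      unfolding ng using C2[OF z] by (intro mult_right_mono) auto
    ultimately show ?thesis by (simp add: B_def mult.assoc)
  qed
  have real: "cmod (g (of_real x)) \<le> M" for x
    using ng_le[of "of_real x"] bdry[of x] by simp
  have bdd: "cmod (g z) \<le> B" if z: "0 \<le> Im z" for z
  proof (cases "\<bar>Re z\<bar> \<le> Im z")
    case False
    define s :: real where "s = (if Re z \<ge> 0 then 1 else -1)"
    show ?thesis
    proof (rule phragmen_lindelof_sector[where s = s and f = g])
      show "s = 1 \<or> s = -1" by (auto simp: s_def)
      show "continuous_on {z. 0 \<le> Im z \<and> Im z \<le> s * Re z} g"
        by (intro analytic_UHP_continuous[OF ga]) auto
      show "g holomorphic_on interior {z. 0 \<le> Im z \<and> Im z \<le> s * Re z}"
        using interior_subset by (intro analytic_UHP_holomorphic[OF ga]) blast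
      show "cmod (g w) \<le> B" if "w \<in> {z. 0 \<le> Im z \<and> Im z \<le> s * Re z}"
        "Im w = 0 \<or> Im w = s * Re w" for w
        using that(2)
      proof
        assume "Im w = 0"
        then have "w = of_real (Re w)" by (simp add: complex_eq_iff)
        then show ?thesis using real[of "Re w"] by (simp add: B_def)
      next
        assume "Im w = s * Re w"
        then show ?thesis using that(1) by (intro mid) (auto simp: s_def split: if_splits)
      qed
      show "cmod (g w) \<le> C1 * exp (C1 * (cmod w)\<^sup>2)"
        if "w \<in> {z. 0 \<le> Im z \<and> Im z \<le> s * Re z}" for w
        using ng_le[of w] C1[of w] that by auto
      show "z \<in> {z. 0 \<le> Im z \<and> Im z \<le> s * Re z}" using False z by (auto simp: s_def)
    qed (rule B)
  qed (rule mid)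
  show "cmod (f z * exp (\<i> * of_real e * z)) \<le> M"
    using phragmen_lindelof_bounded[OF ga real bdd M z] by (simp add: g_def)
qed

text \<open>The same argument with the two quadrants in place of the outer sectors; here only the imaginary axis
has to carry the information on the type.\<close>

lemma phragmen_lindelof_exp_type:
  assumes f: "f analytic_on {z. 0 \<le> Im z}"
    and bdry: "\<And>x. cmod (f (of_real x)) \<le> M"
    and growth: "\<And>z. 0 \<le> Im z \<Longrightarrow> cmod (f z) \<le> C * exp (C * cmod z)"
    and axis: "\<And>e. e > 0 \<Longrightarrow> \<exists>C. \<forall>y\<ge>0. cmod (f (\<i> * of_real y)) \<le> C * exp (e * y)"
    and M: "M > 0" and z: "0 \<le> Im z"
  shows "cmod (f z) \<le> M"
proof (rule le_of_forall_exp_damped[of f])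
  fix e :: real assume e: "e > 0"
  define g where "g = (\<lambda>z. f z * exp (\<i> * of_real e * z))"
  have ng: "cmod (g z) = cmod (f z) * exp (- e * Im z)" for z
    by (simp only: g_def norm_mult norm_exp_i_mult)
  have ng_le: "cmod (g z) \<le> cmod (f z)" if "0 \<le> Im z" for z
    using that e mult_left_mono[of "exp (- e * Im z)" 1 "cmod (f z)"] by (simp add: ng)
  have ga: "g analytic_on {z. 0 \<le> Im z}"
    unfolding g_def by (intro analytic_intros f)
  obtain C2 where C2: "\<And>y. y \<ge> 0 \<Longrightarrow> cmod (f (\<i> * of_real y)) \<le> C2 * exp (e * y)"
    using axis[OF e] by blast
  define B where "B = max M C2"
  have B: "B > 0" using M by (simp add: B_def)
  have imag: "cmod (g z) \<le> B" if "Re z = 0" "0 \<le> Im z" for z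
  proof -
    have z: "z = \<i> * of_real (Im z)" using that by (simp add: complex_eq_iff)
    have "cmod (g z) \<le> C2 * exp (e * Im z) * exp (- e * Im z)"
      unfolding ng using C2[OF that(2)] z by (intro mult_right_mono) auto
    then show ?thesis by (simp add: B_def mult.assoc exp_add[symmetric])
  qed
  have real: "cmod (g (of_real x)) \<le> M" for x
    using ng_le[of "of_real x"] bdry[of x] by simp
  have real': "cmod (g z) \<le> B" if "Im z = 0" for z
  proof -
    have "z = of_real (Re z)" using that by (simp add: complex_eq_iff)
    then show ?thesis using real[of "Re z"] by (simp add: B_def)
  qed
  have gr: "cmod (g z) \<le> C * exp (C * cmod z)" if "0 \<le> Im z" for z
    using ng_le[OF that] growth[OF that] by simp
  have bdd: "cmod (g z) \<le> B" if z: "0 \<le> Im z" for z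
  proof (cases "0 \<le> Re z")
    case True
    show ?thesis
    proof (rule phragmen_lindelof_quadrant[of g])
      show "continuous_on {z. 0 \<le> Re z \<and> 0 \<le> Im z} g"
        by (intro analytic_UHP_continuous[OF ga]) auto
      show "g holomorphic_on interior {z. 0 \<le> Re z \<and> 0 \<le> Im z}"
        using interior_subset by (intro analytic_UHP_holomorphic[OF ga]) blast
    qed (use B True z imag real' gr in auto)
  next
    case False
    have *: "(\<lambda>w. g (\<i> * w)) analytic_on {z. 0 \<le> Re z}"
      using analytic_on_compose_gen[of "\<lambda>w. \<i> * w" "{z. 0 \<le> Re z}" g, OF _ ga]
      by (auto simp: o_def intro!: analytic_intros)
    have "cmod (g (\<i> * (- \<i> * z))) \<le> B"
    proof (rule phragmen_lindelof_quadrant[of "\<lambda>w. g (\<i> * w)"])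
      show "continuous_on {z. 0 \<le> Re z \<and> 0 \<le> Im z} (\<lambda>w. g (\<i> * w))"
        by (rule continuous_on_subset[OF holomorphic_on_imp_continuous_on[OF analytic_imp_holomorphic[OF *]]])
           auto
      show "(\<lambda>w. g (\<i> * w)) holomorphic_on interior {z. 0 \<le> Re z \<and> 0 \<le> Im z}"
        using interior_subset[of "{z. 0 \<le> Re z \<and> 0 \<le> Im z}"]
        by (intro holomorphic_on_subset[OF analytic_imp_holomorphic[OF *]]) auto
      show "cmod (g (\<i> * w)) \<le> C * exp (C * cmod w)"
        if "w \<in> {z. 0 \<le> Re z \<and> 0 \<le> Im z}" for w
        using gr[of "\<i> * w"] that by (simp add: norm_mult)
    qed (use B False z imag real' in auto)
    then show ?thesis by (simp add: mult.assoc[symmetric])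
  qed
  show "cmod (f z * exp (\<i> * of_real e * z)) \<le> M"
    using phragmen_lindelof_bounded[OF ga real bdd M z] by (simp add: g_def)
qed

section \<open>Functions with non-negative real part\<close>

text \<open>The Cayley transform \<open>(q - a) / (q + cnj a)\<close> with \<open>a = q 0\<close> maps into the unit disc, and Schwarz's lemma
applies to it. Adding \<open>e > 0\<close> to \<open>q\<close> excludes a vanishing denominator.\<close>

lemma nonneg_real_part_disc_bound:
  assumes hol: "q holomorphic_on ball 0 R" and R: "R > 0"
    and pos: "\<And>z. z \<in> ball 0 R \<Longrightarrow> 0 \<le> Re (q z)" and z: "z \<in> ball 0 R"
  shows "cmod (q z - q 0) \<le> 2 * cmod z / (R - cmod z) * Re (q 0)"
proof -
  have zR: "cmod z < R" using z by simp
  have *: "cmod (q z - q 0) * (R - cmod z) \<le> 2 * cmod z * (Re (q 0) + e)" if e: "e > 0" for e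
  proof -
    define p where "p = (\<lambda>z. q z + of_real e)"
    define a where "a = p 0"
    define f where "f = (\<lambda>w. (p (of_real R * w) - a) / (p (of_real R * w) + cnj a))"
    have ppos: "Re (p z) > 0" if "z \<in> ball 0 R" for z
      using pos[OF that] e by (simp add: p_def)
    have apos: "Re a > 0" using ppos[of 0] R by (simp add: a_def)
    have dom: "of_real R * w \<in> ball 0 R" if "w \<in> ball 0 1" for w :: complex
      using that R by (simp add: norm_mult)
    have nz: "p (of_real R * w) + cnj a \<noteq> 0" if "w \<in> ball 0 1" for w :: complex
    proof
      assume "p (of_real R * w) + cnj a = 0"
      then have "Re (p (of_real R * w) + cnj a) = 0" by simp
      then show False using ppos[OF dom[OF that]] apos by simp
    qed
    have hp: "(\<lambda>w. p (of_real R * w)) holomorphic_on ball 0 1"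
    proof -
      have "(q \<circ> (\<lambda>w. of_real R * w)) holomorphic_on ball 0 1"
        by (rule holomorphic_on_compose_gen[OF _ hol]) (use dom in \<open>auto intro!: holomorphic_intros\<close>)
      then show ?thesis unfolding p_def o_def by (intro holomorphic_intros)
    qed
    have hf: "f holomorphic_on ball 0 1"
      unfolding f_def using nz by (intro holomorphic_intros hp) auto
    have f0: "f 0 = 0" by (simp add: f_def a_def)
    have lt1: "cmod (f w) < 1" if "cmod w < 1" for w
    proof -
      have w: "w \<in> ball 0 1" using that by simp
      have "0 < Re (p (of_real R * w)) * Re a" using ppos[OF dom[OF w]] apos by simp
      then have "(cmod (p (of_real R * w) - a))\<^sup>2 < (cmod (p (of_real R * w) + cnj a))\<^sup>2"
        unfolding cmod_power2 by (simp add: power2_eq_square algebra_simps)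
      then have "cmod (p (of_real R * w) - a) < cmod (p (of_real R * w) + cnj a)"
        by (rule power_less_imp_less_base) simp
      then show ?thesis using nz[OF w] by (simp add: f_def norm_divide)
    qed
    define w where "w = z / of_real R"
    have w: "cmod w < 1" "of_real R * w = z" using z R by (auto simp: w_def norm_divide)
    have "cmod (f w) \<le> cmod w" by (rule Schwarz_Lemma(1)[OF hf f0 lt1 w(1)])
    then have "cmod (p z - a) \<le> cmod w * cmod (p z + cnj a)"
      using nz[of w] w by (simp add: f_def norm_divide divide_le_eq)
    also have "cmod (p z + cnj a) \<le> cmod (p z - a) + cmod (a + cnj a)"
      using norm_triangle_ineq[of "p z - a" "a + cnj a"] by (simp add: algebra_simps)
    also have "cmod (a + cnj a) = 2 * Re a" using apos by (simp add: complex_add_cnj)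
    finally have 1: "cmod (p z - a) \<le> cmod w * (cmod (p z - a) + 2 * Re a)"
      by (simp add: mult_left_mono)
    have "R * cmod (p z - a) \<le> R * (cmod w * (cmod (p z - a) + 2 * Re a))"
      using 1 R by (intro mult_left_mono) auto
    moreover have "R * cmod w = cmod z" using R by (simp add: w_def norm_divide)
    moreover have "R * (cmod w * (cmod (p z - a) + 2 * Re a)) = (R * cmod w) * (cmod (p z - a) + 2 * Re a)"
      by simp
    ultimately have "R * cmod (p z - a) \<le> cmod z * (cmod (p z - a) + 2 * Re a)"
      by simp
    moreover have "p z - a = q z - q 0" "Re a = Re (q 0) + e" by (auto simp: p_def a_def)
    ultimately show ?thesis by (simp add: algebra_simps)
  qed
  have "cmod (q z - q 0) * (R - cmod z) \<le> 2 * cmod z * Re (q 0)"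
  proof (rule field_le_epsilon)
    fix e :: real assume e: "e > 0"
    have "2 * cmod z * (e / (2 * R)) \<le> e"
      using mult_right_mono[of "cmod z" R e] zR e R by (simp add: field_simps)
    then show "cmod (q z - q 0) * (R - cmod z) \<le> 2 * cmod z * Re (q 0) + e"
      using *[of "e / (2 * R)"] e R by (simp add: ring_distribs)
  qed
  then show ?thesis using zR by (simp add: pos_le_divide_eq)
qed

text \<open>Harnack's inequality on \<open>Im z > - d\<close>, transported from the disc by the Moebius map that sends \<open>0\<close> to
\<open>z0\<close>; the point \<open>cnj z0 - 2 i d\<close> is the mirror image of \<open>z0\<close>.\<close>

lemma harnack_half_plane:
  assumes hol: "H holomorphic_on {z. - d < Im z}"
    and pos: "\<And>z. - d < Im z \<Longrightarrow> 0 \<le> Re (H z)"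
    and z: "- d < Im z" and z0: "- d < Im z0"
  shows "Re (H z) \<le> Re (H z0) * (cmod (z - (cnj z0 - 2 * \<i> * of_real d)))\<^sup>2
            / ((Im z + d) * (Im z0 + d))"
proof -
  define Y where "Y = Im z0 + d"
  define p where "p = z0 - \<i> * of_real Y"
  define z1 where "z1 = cnj z0 - 2 * \<i> * of_real d"
  have z1: "z1 = p - \<i> * of_real Y" "z0 = p + \<i> * of_real Y"
    by (auto simp: z1_def p_def Y_def complex_eq_iff)
  have Imp: "Im p = - d" by (simp add: p_def Y_def)
  have Y: "Y > 0" using z0 by (simp add: Y_def)
  define m where "m = (\<lambda>w. p + \<i> * of_real Y * ((1 + w) / (1 - w)))"
  have m_dom: "- d < Im (m w)" if "w \<in> ball 0 1" for w
  proof -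
    have "1 - w \<noteq> 0" using that by auto
    then have cm: "(cmod (1 - w))\<^sup>2 > 0" by simp
    have "Re ((1 + w) / (1 - w)) = (1 - (cmod w)\<^sup>2) / (cmod (1 - w))\<^sup>2"
      unfolding Re_divide' cmod_power2[of w] by (simp add: power2_eq_square algebra_simps)
    moreover have "(cmod w)\<^sup>2 < 1" using that by (simp add: power_less_one_iff)
    ultimately have "Re ((1 + w) / (1 - w)) > 0" using cm by simp
    then have "Y * Re ((1 + w) / (1 - w)) > 0" using Y by simp
    moreover have "Im (m w) = - d + Y * Re ((1 + w) / (1 - w))"
      by (simp add: m_def Imp del: times_divide_eq_right)
    ultimately show ?thesis by simp
  qed
  have hq: "(H \<circ> m) holomorphic_on ball 0 1"
  proof (rule holomorphic_on_compose_gen[OF _ hol])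
    have "1 - w \<noteq> 0" if "w \<in> ball 0 1" for w :: complex using that by auto
    then show "m holomorphic_on ball 0 1"
      unfolding m_def by (intro holomorphic_intros) auto
    show "m ` ball 0 1 \<subseteq> {z. - d < Im z}" using m_dom by auto
  qed
  define w where "w = (z - z0) / (z - z1)"
  have diff: "(cmod (z - z1))\<^sup>2 - (cmod (z - z0))\<^sup>2 = 4 * (Im z + d) * Y"
    unfolding cmod_power2 by (simp add: z1_def Y_def power2_eq_square algebra_simps)
  have yY: "(Im z + d) * Y > 0" using z Y by simp
  then have lt: "(cmod (z - z0))\<^sup>2 < (cmod (z - z1))\<^sup>2" using diff by linarith
  then have z_ne: "z - z1 \<noteq> 0" by auto
  have lt': "cmod (z - z0) < cmod (z - z1)" using lt by (rule power_less_imp_less_base) simp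
  then have w1: "cmod w < 1" using z_ne by (simp add: w_def norm_divide)
  have mw: "m w = z"
  proof -
    have w_eq: "1 + w = 2 * (z - p) / (z - z1)" "1 - w = 2 * (\<i> * of_real Y) / (z - z1)"
      using z_ne by (simp_all add: w_def z1 field_simps)
    have "\<i> * of_real Y * ((1 + w) / (1 - w)) = z - p"
      unfolding w_eq using z_ne Y by (simp add: field_simps)
    then show ?thesis by (simp add: m_def)
  qed
  define r where "r = cmod w"
  have "cmod ((H \<circ> m) w - (H \<circ> m) 0) \<le> 2 * cmod w / (1 - cmod w) * Re ((H \<circ> m) 0)"
    by (rule nonneg_real_part_disc_bound[OF hq]) (use w1 pos m_dom in auto)
  moreover have "m 0 = z0" by (simp add: m_def z1(2))
  ultimately have "cmod (H z - H z0) \<le> 2 * r / (1 - r) * Re (H z0)"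
    by (simp add: mw r_def)
  then have "Re (H z) - Re (H z0) \<le> 2 * r / (1 - r) * Re (H z0)"
    using complex_Re_le_cmod[of "H z - H z0"] by simp
  moreover have r: "0 \<le> r" "r < 1" using w1 by (auto simp: r_def)
  ultimately have 1: "Re (H z) \<le> (1 + r) / (1 - r) * Re (H z0)"
    by (simp add: field_simps)
  have 2: "(1 + r) / (1 - r) \<le> 4 / (1 - r\<^sup>2)"
  proof -
    have "(1 + r) * (1 + r) \<le> 2 * 2" using r by (intro mult_mono) auto
    moreover have "1 - r\<^sup>2 = (1 - r) * (1 + r)" by (simp add: power2_eq_square algebra_simps)
    ultimately show ?thesis using r by (simp add: divide_simps)
  qed
  have r2: "r\<^sup>2 = (cmod (z - z0))\<^sup>2 / (cmod (z - z1))\<^sup>2"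
    by (simp add: r_def w_def norm_divide power_divide)
  have 3: "1 - r\<^sup>2 = 4 * (Im z + d) * Y / (cmod (z - z1))\<^sup>2"
    unfolding r2 diff[symmetric] using z_ne by (simp add: diff_divide_distrib)
  from 2 have "(1 + r) / (1 - r) \<le> (cmod (z - z1))\<^sup>2 / ((Im z + d) * Y)"
    unfolding 3 by (simp only: mult.assoc divide_divide_eq_right mult_divide_mult_cancel_left_if) simp
  from mult_right_mono[OF this pos[OF z0]] 1 show ?thesis
    by (simp add: z1_def Y_def mult.commute)
qed

text \<open>On \<open>\<bar>z\<bar> = R\<close> the factor \<open>R/z - z/R\<close> equals \<open>- 2 i Im z / R\<close>, so there \<open>h(z) (R/z - z/R)\<close> has the real part
\<open>2 Im z Im h / R \<ge> 0\<close>. This function is holomorphic in the disc because \<open>h 0 = 0\<close>, so its real part is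
non-negative throughout, and it differs little from its value \<open>R h'(0)\<close> at the origin.\<close>

lemma reflection_symmetric_near_linear:
  assumes hol: "h holomorphic_on ball 0 N" and R: "0 < R" "R < N" and h0: "h 0 = 0"
    and sign: "\<And>z. z \<in> ball 0 N \<Longrightarrow> 0 \<le> Im z * Im (h z)"
    and real: "\<And>x. \<bar>x\<bar> < N \<Longrightarrow> Im (h (of_real x)) = 0"
  obtains a where "a \<ge> 0" "\<And>z. cmod z \<le> R / 2 \<Longrightarrow> cmod (h z - of_real a * z) \<le> 6 * a * (cmod z)\<^sup>2 / R"
proof -
  \<comment> \<open>Here \<open>q\<close> is \<open>h(z) (R/z - z/R)\<close> with its singularity at the origin removed.\<close>
  define k where "k = (\<lambda>z. if z = 0 then deriv h 0 else h z / z)"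
  have N: "N > 0" using R by simp
  have hk: "k holomorphic_on ball 0 N"
    by (rule pole_theorem_open_0[OF hol open_ball, of 0]) (auto simp: k_def h0)
  have hkz: "h z = k z * z" for z by (simp add: k_def h0)
  define q where "q = (\<lambda>z. k z * (of_real R - z\<^sup>2 / of_real R))"
  have hq: "q holomorphic_on ball 0 N" unfolding q_def by (intro holomorphic_intros hk) (use R in auto)
  have Req_bd: "0 \<le> Re (q z)" if z: "cmod z = R" for z
  proof -
    have nz: "z \<noteq> 0" using z R by auto
    have "of_real R - z\<^sup>2 / of_real R = z * (cnj z - z) / of_real R"
    proof -
      have "z * cnj z = of_real (R\<^sup>2)" using z by (simp add: complex_norm_square[symmetric])
      then show ?thesis using R by (simp add: field_simps power2_eq_square)
    qed
    also have "cnj z - z = - 2 * \<i> * of_real (Im z)" by (simp add: complex_eq_iff)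
    finally have "q z = h z * (- 2 * \<i> * of_real (Im z) / of_real R)"
      by (simp add: q_def hkz)
    also have "\<dots> = of_real (2 * Im z / R) * (- \<i> * h z)" by simp
    finally have "Re (q z) = (Im z * Im (h z)) * (2 / R)" by simp
    moreover have "0 \<le> Im z * Im (h z)" using z R by (intro sign) simp
    ultimately show ?thesis using R by simp
  qed
  have Req: "0 \<le> Re (q z)" if "z \<in> ball 0 R" for z
  proof -
    have "cmod ((\<lambda>z. exp (- q z)) z) \<le> 1"
    proof (rule maximum_modulus_frontier[of "\<lambda>z. exp (- q z)" "cball 0 R"])
      have sub: "cball 0 R \<subseteq> (ball 0 N :: complex set)" using R by auto
      show "(\<lambda>z. exp (- q z)) holomorphic_on interior (cball 0 R)"
        using sub R by (intro holomorphic_intros holomorphic_on_subset[OF hq]) auto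
      show "continuous_on (closure (cball 0 R)) (\<lambda>z. exp (- q z))"
        using sub by (intro continuous_intros continuous_on_subset[OF holomorphic_on_imp_continuous_on[OF hq]]) auto
      show "cmod (exp (- q z)) \<le> 1" if "z \<in> frontier (cball 0 R)" for z
        using Req_bd[of z] that R by simp
    qed (use that in auto)
    then show ?thesis by simp
  qed
  define a where "a = Re (deriv h 0)"
  have q0: "q 0 = of_real R * deriv h 0" by (simp add: q_def k_def)
  have a0: "a \<ge> 0" using Req[of 0] R by (simp add: q0 a_def zero_le_mult_iff)
  \<comment> \<open>The difference quotients of \<open>h\<close> along the real axis are real.\<close>
  have "Im (deriv h 0) = 0"
  proof -
    have "(h has_field_derivative deriv h 0) (at 0)"
      using holomorphic_derivI[OF hol] N by simp
    then have "((\<lambda>y. h y / y) \<longlongrightarrow> deriv h 0) (at 0)"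
      by (simp add: has_field_derivative_iff h0)
    moreover have "filterlim (\<lambda>n. of_real (N / real (n + 2))) (at (0::complex)) sequentially"
    proof -
      have "(\<lambda>n. N / real (n + 2)) \<longlonglongrightarrow> 0" by real_asymp
      then have "(\<lambda>n. of_real (N / real (n + 2))) \<longlonglongrightarrow> (of_real 0 :: complex)" by (rule tendsto_of_real)
      then show ?thesis using N by (simp add: filterlim_at del: of_real_divide)
    qed
    ultimately have "(\<lambda>n. h (of_real (N / real (n + 2))) / of_real (N / real (n + 2))) \<longlonglongrightarrow> deriv h 0"
      by (rule filterlim_compose)
    then have "(\<lambda>n. Im (h (of_real (N / real (n + 2))) / of_real (N / real (n + 2)))) \<longlonglongrightarrow> Im (deriv h 0)"
      by (rule tendsto_Im)
    moreover have "Im (h (of_real (N / real (n + 2))) / of_real (N / real (n + 2))) = 0" for n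
    proof -
      have "N + N * real n > 0" using N by (intro add_pos_nonneg) auto
      then have "\<bar>N / real (n + 2)\<bar> < N" using N by (simp add: field_simps)
      then show ?thesis using real[of "N / real (n + 2)"] by (simp add: Im_divide_of_real del: of_real_divide)
    qed
    ultimately have "(\<lambda>n::nat. 0) \<longlonglongrightarrow> Im (deriv h 0)" by (simp only:)
    then show ?thesis by (simp add: LIMSEQ_const_iff)
  qed
  then have d0: "deriv h 0 = of_real a" by (simp add: a_def complex_eq_iff)
  show thesis
  proof
    show "a \<ge> 0" by fact
    fix z assume z: "cmod z \<le> R / 2"
    have zR: "z \<in> ball 0 R" using z R by simp
    have hq': "q holomorphic_on ball 0 R" using R by (intro holomorphic_on_subset[OF hq]) auto
    have "cmod (q z - q 0) \<le> 2 * cmod z / (R - cmod z) * (R * a)"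
      using nonneg_real_part_disc_bound[OF hq' R(1) Req zR] by (simp add: q0 d0)
    also have "\<dots> \<le> 2 * cmod z / (R / 2) * (R * a)"
      using z R a0 by (intro mult_right_mono divide_left_mono) auto
    also have "\<dots> = 4 * a * cmod z" using R by simp
    finally have 1: "cmod (q z - of_real (R * a)) \<le> 4 * a * cmod z" by (simp add: q0 d0)
    define t where "t = of_real R - z\<^sup>2 / of_real R"
    have z2: "cmod (z\<^sup>2 / of_real R) = (cmod z)\<^sup>2 / R" using R by (simp add: norm_divide norm_power)
    have z3: "(cmod z)\<^sup>2 / R \<le> R / 4"
      using power_mono[OF z, of 2] R by (simp add: power_divide field_simps power2_eq_square)
    have t: "cmod t \<ge> 3 * R / 4"
      using norm_triangle_ineq2[of "of_real R" "z\<^sup>2 / of_real R"] z3 R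
      unfolding t_def z2 norm_of_real by linarith
    have "cmod (k z) * cmod t = cmod (q z)" by (simp add: q_def t_def norm_mult)
    also have "\<dots> \<le> R * a + 4 * a * cmod z"
      using norm_triangle_sub[of "q z" "of_real (R * a)"] 1 mult_nonneg_nonneg[of R a] R a0 by (simp del: of_real_mult)
    also have "\<dots> \<le> 3 * R * a" using mult_left_mono[OF z, of "4 * a"] a0 by simp
    finally have "cmod (k z) * cmod t \<le> 3 * R * a" .
    from order_trans[OF mult_left_mono[OF t norm_ge_zero] this]
    have "cmod (k z) * (3 * R / 4) \<le> 3 * R * a" .
    then have k4: "cmod (k z) \<le> 4 * a" using R by (simp add: field_simps)
    have "of_real R * (k z - of_real a) = (q z - of_real (R * a)) + k z * (z\<^sup>2 / of_real R)"
      by (simp add: q_def algebra_simps)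
    then have "R * cmod (k z - of_real a) \<le> cmod (q z - of_real (R * a)) + cmod (k z) * ((cmod z)\<^sup>2 / R)"
      using norm_triangle_ineq[of "q z - of_real (R * a)" "k z * (z\<^sup>2 / of_real R)"] R z2
      by (metis norm_mult norm_of_real abs_of_pos)
    also have "\<dots> \<le> 4 * a * cmod z + 4 * a * (cmod z / 2)"
    proof (intro add_mono mult_mono 1 k4)
      show "(cmod z)\<^sup>2 / R \<le> cmod z / 2"
        using mult_left_mono[OF z, of "cmod z"] R by (simp add: field_simps power2_eq_square)
    qed (use a0 R in auto)
    finally have "R * cmod (k z - of_real a) \<le> 6 * a * cmod z" by simp
    then have "cmod (k z - of_real a) \<le> 6 * a * cmod z / R" using R by (simp add: field_simps)
    from mult_right_mono[OF this, of "cmod z"]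
    have "cmod ((k z - of_real a) * z) \<le> 6 * a * (cmod z)\<^sup>2 / R"
      by (simp add: norm_mult power2_eq_square)
    then show "cmod (h z - of_real a * z) \<le> 6 * a * (cmod z)\<^sup>2 / R"
      by (simp add: hkz algebra_simps)
  qed
qed

section \<open>Paley-Wiener functions\<close>

lemma AE_pi: "(\<And>t. \<bar>t\<bar> \<le> pi \<Longrightarrow> P t) \<Longrightarrow> AE t in lebesgue_on {-pi<..<pi}. P t"
  by (rule AE_I2) auto

lemma measurable_continuous_pi:
  fixes h :: "real \<Rightarrow> 'b::{second_countable_topology, real_normed_vector}"
  shows "continuous_on UNIV h \<Longrightarrow> h \<in> borel_measurable (lebesgue_on {-pi<..<pi})"
  by (intro measurable_restrict_space1 measurable_completion) (simp add: borel_measurable_continuous_onI)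

lemma integrable_continuous_pi:
  fixes h :: "real \<Rightarrow> 'b::{second_countable_topology, banach}"
  assumes h: "continuous_on UNIV h"
  shows "integrable (lebesgue_on {-pi<..<pi}) h"
proof -
  have "finite_measure (lebesgue_on {-pi<..<pi})"
    by (rule finite_measureI) (simp add: emeasure_restrict_space)
  moreover have "compact (h ` {-pi..pi})"
    by (intro compact_continuous_image continuous_on_subset[OF h]) auto
  then obtain B where B: "\<And>t. t \<in> {-pi..pi} \<Longrightarrow> norm (h t) \<le> B"
    using compact_imp_bounded by (force simp: bounded_iff)
  ultimately show ?thesis
    by (intro finite_measure.integrable_const_bound[where B = B] AE_pi measurable_continuous_pi h)
       (auto intro!: B simp: abs_le_iff)
qed

lemma integral_exp_int:
  fixes m :: int
  shows "(LINT t|lebesgue_on {-pi<..<pi}. exp (\<i> * of_int m * of_real t))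
     = (if m = 0 then 2 * of_real pi else 0)"
proof -
  have "integrable (lebesgue_on {-pi<..<pi}) (\<lambda>t. exp (\<i> * of_int m * complex_of_real t))"
    by (intro integrable_continuous_pi continuous_intros)
  then have "(LINT t|lebesgue_on {-pi<..<pi}. exp (\<i> * of_int m * of_real t))
      = integral {-pi<..<pi} (\<lambda>t. exp (\<i> * of_int m * of_real t))"
    by (intro lebesgue_integral_eq_integral) auto
  also have "\<dots> = integral {-pi..pi} (\<lambda>t. exp (\<i> * of_int m * of_real t))"
    by (rule integral_open_interval_real[symmetric])
  also have "\<dots> = (if m = 0 then 2 * of_real pi else 0)"
  proof (cases "m = 0")
    case True
    then show ?thesis by (simp add: content_real scaleR_conv_of_real)
  next
    case False
    have "((\<lambda>t. exp (\<i> * of_int m * complex_of_real t)) has_integral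
       (exp (\<i> * of_int m * of_real pi) / (\<i> * of_int m) - exp (\<i> * of_int m * of_real (- pi)) / (\<i> * of_int m))) {-pi..pi}"
    proof (rule fundamental_theorem_of_calculus)
      show "((\<lambda>t. exp (\<i> * of_int m * complex_of_real t) / (\<i> * of_int m)) has_vector_derivative
           exp (\<i> * of_int m * complex_of_real t)) (at t within {-pi..pi})" for t
        using False by (auto intro!: derivative_eq_intros has_vector_derivative_real_field)
    qed simp
    moreover have "exp (\<i> * of_int m * of_real pi) = exp (\<i> * of_int m * of_real (- pi))"
    proof -
      have "exp (\<i> * of_int m * of_real pi)
          = exp ((2 * of_int m * of_real pi) * \<i>) * exp (\<i> * of_int m * of_real (- pi))"
        unfolding exp_add[symmetric] by (simp add: algebra_simps)
      also have "exp ((2 * of_int m * of_real pi) * \<i>) = (1 :: complex)"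
        using exp_integer_2pi[of "of_int m"] by (simp add: ac_simps)
      finally show ?thesis by simp
    qed
    ultimately show ?thesis using False by (simp add: integral_unique)
  qed
  finally show ?thesis .
qed

locale paley_wiener_repr =
  fixes F :: "complex \<Rightarrow> complex" and g :: "real \<Rightarrow> complex"
  assumes g_meas: "g \<in> borel_measurable (lebesgue_on {-pi<..<pi})"
    and g_sq: "integrable (lebesgue_on {-pi<..<pi}) (\<lambda>t. (cmod (g t))\<^sup>2)"
    and F_eq: "\<And>z. F z = 1 / (2 * of_real pi) *
                  (LINT t|lebesgue_on {-pi<..<pi}. g t * exp (\<i> * of_real t * z))"
begin

abbreviation "I \<equiv> lebesgue_on {-pi<..<pi}"

lemma g_int: "integrable I g"
proof (rule Bochner_Integration.integrable_bound)
  show "integrable I (\<lambda>t. 1 + (cmod (g t))\<^sup>2)"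
    by (intro Bochner_Integration.integrable_add g_sq integrable_continuous_pi continuous_intros)
  have "x \<le> 1 + x\<^sup>2" for x :: real
    using sum_power2_ge_zero[of "x - 1/2" 0] by (simp add: power2_eq_square algebra_simps)
  then show "AE t in I. norm (g t) \<le> norm (1 + (cmod (g t))\<^sup>2)" by (simp add: abs_of_nonneg)
qed (rule g_meas)

lemma g_mult_int:
  assumes h: "continuous_on UNIV h" and b: "\<And>t. \<bar>t\<bar> \<le> pi \<Longrightarrow> cmod (h t) \<le> B"
  shows "integrable I (\<lambda>t. g t * h t)"
    and "(LINT t|I. cmod (g t * h t)) \<le> (LINT t|I. cmod (g t)) * B"
proof -
  have bd: "AE t in I. norm (g t * h t) \<le> cmod (g t) * B"
    by (rule AE_pi) (use b in \<open>auto simp: norm_mult intro!: mult_left_mono\<close>)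
  have i: "integrable I (\<lambda>t. cmod (g t) * B)" by (intro integrable_mult_left integrable_norm g_int)
  have "0 \<le> B" using b[of 0] norm_ge_zero[of "h 0"] by (simp del: norm_ge_zero)
  show gi: "integrable I (\<lambda>t. g t * h t)"
    by (rule Bochner_Integration.integrable_bound[OF i])
       (use bd \<open>0 \<le> B\<close> in \<open>auto intro: borel_measurable_times[OF g_meas measurable_continuous_pi[OF h]]\<close>)
  have "(LINT t|I. cmod (g t * h t)) \<le> (LINT t|I. cmod (g t) * B)"
    by (rule integral_mono_AE[OF integrable_norm[OF gi] i]) (use bd in simp)
  then show "(LINT t|I. cmod (g t * h t)) \<le> (LINT t|I. cmod (g t)) * B" by simp
qed

lemma norm_bound: "cmod (F z) \<le> (LINT t|I. cmod (g t)) * exp (pi * \<bar>Im z\<bar>)"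
proof -
  have b: "cmod (exp (\<i> * of_real t * z)) \<le> exp (pi * \<bar>Im z\<bar>)" if "\<bar>t\<bar> \<le> pi" for t
  proof -
    have "- (t * Im z) \<le> \<bar>t\<bar> * \<bar>Im z\<bar>" by (metis abs_ge_minus_self abs_mult)
    also have "\<dots> \<le> pi * \<bar>Im z\<bar>" using that by (intro mult_right_mono) auto
    finally show ?thesis by simp
  qed
  have c: "continuous_on UNIV (\<lambda>t. exp (\<i> * complex_of_real t * z))" by (intro continuous_intros)
  have "cmod (LINT t|I. g t * exp (\<i> * of_real t * z)) \<le> (LINT t|I. cmod (g t * exp (\<i> * of_real t * z)))"
    by (rule integral_norm_bound)
  also have "\<dots> \<le> (LINT t|I. cmod (g t)) * exp (pi * \<bar>Im z\<bar>)"
    by (rule g_mult_int(2)[OF c b])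
  finally have "cmod (LINT t|I. g t * exp (\<i> * of_real t * z)) \<le> (LINT t|I. cmod (g t)) * exp (pi * \<bar>Im z\<bar>)" .
  then have "cmod (F z) \<le> 1 / (2 * pi) * ((LINT t|I. cmod (g t)) * exp (pi * \<bar>Im z\<bar>))"
    unfolding F_eq by (simp add: norm_mult norm_divide divide_right_mono)
  also have "\<dots> \<le> 1 * ((LINT t|I. cmod (g t)) * exp (pi * \<bar>Im z\<bar>))"
    using pi_ge_two by (intro mult_right_mono) (auto simp: field_simps)
  finally show ?thesis by simp
qed

text \<open>The exponential series may be integrated term by term, since \<open>g\<close> is integrable on a bounded interval.
This yields a power series that converges everywhere.\<close>

lemma entire: "F holomorphic_on UNIV"
proof -
  define a where "a n = 1 / (2 * of_real pi) * (LINT t|I. g t * ((\<i> * of_real t) ^ n / fact n))" for n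
  have "(\<lambda>n. a n * (z - 0) ^ n) sums F z" for z
  proof -
    define f where "f n t = g t * ((\<i> * of_real t) ^ n / fact n * z ^ n)" for n t
    have b: "cmod ((\<i> * of_real t) ^ n / fact n * z ^ n) \<le> (pi * cmod z) ^ n / fact n" if "\<bar>t\<bar> \<le> pi" for t n
    proof -
      have "\<bar>t\<bar> ^ n * cmod z ^ n \<le> pi ^ n * cmod z ^ n"
        using that by (intro mult_right_mono power_mono) auto
      then show ?thesis
        by (simp add: norm_mult norm_divide norm_power power_mult_distrib divide_right_mono)
    qed
    have c: "continuous_on UNIV (\<lambda>t. (\<i> * complex_of_real t) ^ n / fact n * z ^ n)" for n
      by (intro continuous_intros) auto
    have fi: "integrable I (f n)" for n
      unfolding f_def by (rule g_mult_int(1)[OF c b])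
    have se: "(\<lambda>n. f n t) sums (g t * exp (\<i> * of_real t * z))" for t
    proof -
      have "(\<lambda>n. (\<i> * of_real t * z) ^ n /\<^sub>R fact n) sums exp (\<i> * of_real t * z)"
        by (rule exp_converges)
      then have "(\<lambda>n. g t * ((\<i> * of_real t * z) ^ n /\<^sub>R fact n)) sums (g t * exp (\<i> * of_real t * z))"
        by (rule sums_mult)
      then show ?thesis
        by (simp add: f_def power_mult_distrib scaleR_conv_of_real field_simps)
    qed
    have sn: "summable (\<lambda>n. cmod (f n t))" for t
    proof -
      have "summable (\<lambda>n. cmod (g t) * norm ((\<i> * of_real t * z) ^ n /\<^sub>R fact n))"
        by (intro summable_mult summable_norm_exp)
      then show ?thesis
        by (simp add: f_def norm_mult norm_divide norm_power power_mult_distrib field_simps)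
    qed
    have "summable (\<lambda>n. (LINT t|I. cmod (f n t)))"
    proof (rule summable_comparison_test')
      show "summable (\<lambda>n. (LINT t|I. cmod (g t)) * ((pi * cmod z) ^ n / fact n))"
        using summable_exp[of "pi * cmod z"] by (intro summable_mult) (simp add: field_simps)
      show "norm (LINT t|I. cmod (f n t)) \<le> (LINT t|I. cmod (g t)) * ((pi * cmod z) ^ n / fact n)" for n
        using g_mult_int(2)[OF c b] by (simp add: f_def)
    qed
    then have "(\<lambda>n. integral\<^sup>L I (f n)) sums (LINT t|I. (\<Sum>n. f n t))"
      by (intro sums_integral fi) (use sn in auto)
    moreover have "(\<Sum>n. f n t) = g t * exp (\<i> * of_real t * z)" for t
      using se[of t] by (rule sums_unique[symmetric])
    ultimately have "(\<lambda>n. 1 / (2 * of_real pi) * integral\<^sup>L I (f n)) sums F z"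
      unfolding F_eq by (intro sums_mult) simp
    moreover have "1 / (2 * of_real pi) * integral\<^sup>L I (f n) = a n * (z - 0) ^ n" for n
    proof -
      have "integral\<^sup>L I (f n) = (LINT t|I. (g t * ((\<i> * of_real t) ^ n / fact n)) * z ^ n)"
        by (rule Bochner_Integration.integral_cong) (auto simp: f_def)
      also have "\<dots> = (LINT t|I. g t * ((\<i> * of_real t) ^ n / fact n)) * z ^ n"
        by (rule integral_mult_left_zero)
      finally show ?thesis by (simp add: a_def)
    qed
    ultimately show ?thesis by simp
  qed
  then have "F holomorphic_on ball 0 r" for r
    by (rule power_series_holomorphic)
  then have "F field_differentiable (at z)" for z
    by (meson holomorphic_on_imp_differentiable_at open_ball mem_ball_0 gt_ex)
  then show ?thesis
    by (simp add: holomorphic_on_def field_differentiable_at_within)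
qed

text \<open>Bessel's inequality: up to the sign of the index, the numbers \<open>F(n + s)\<close> are the Fourier coefficients of
\<open>g(t) exp(i s t)\<close>. The proof is by duality: testing against \<open>h = \<Sum> cnj (c n) exp(i n t)\<close> and using
\<open>2 \<bar>g h\<bar> \<le> \<bar>g\<bar>\<^sup>2 + \<bar>h\<bar>\<^sup>2\<close> bounds the sum by a multiple of \<open>\<integral> \<bar>g\<bar>\<^sup>2\<close> plus half of itself.\<close>

lemma bessel:
  fixes J :: "int set" and s :: real
  assumes J: "finite J"
  shows "(\<Sum>n\<in>J. (cmod (F (of_real (of_int n + s))))\<^sup>2) \<le> 1 / (2 * pi) * (LINT t|I. (cmod (g t))\<^sup>2)"
proof -
  define c where "c n = F (of_real (of_int n + s))" for n :: int
  define S where "S = (\<Sum>n\<in>J. (cmod (c n))\<^sup>2)"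
  define e where "e n t = exp (\<i> * of_int n * complex_of_real t)" for n :: int and t
  define h where "h t = (\<Sum>n\<in>J. cnj (c n) * e n t)" for t
  define G where "G t = g t * exp (\<i> * of_real t * of_real s)" for t
  have ec: "continuous_on UNIV (e n)" for n unfolding e_def by (intro continuous_intros)
  have hc: "continuous_on UNIV h" unfolding h_def by (intro continuous_intros ec)
  have nG: "cmod (G t) = cmod (g t)" for t
    by (simp add: G_def norm_mult)
  have ne: "cmod (e n t) = 1" for n t by (simp add: e_def)
  have Gei: "integrable I (\<lambda>t. G t * e n t)" for n
  proof -
    have "integrable I (\<lambda>t. g t * (exp (\<i> * of_real t * of_real s) * e n t))"
      by (rule g_mult_int[where B = 1]) (auto intro!: continuous_intros ec simp: norm_mult ne)
    then show ?thesis by (simp add: G_def mult.assoc)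
  qed
  have c_eq: "2 * of_real pi * c n = (LINT t|I. G t * e n t)" for n
    unfolding c_def F_eq G_def e_def by (simp add: algebra_simps exp_add[symmetric])
  have "2 * of_real pi * complex_of_real S = (\<Sum>n\<in>J. cnj (c n) * (2 * of_real pi * c n))"
    unfolding S_def of_real_sum complex_norm_square sum_distrib_left
    by (rule sum.cong) (simp_all add: algebra_simps)
  also have "\<dots> = (\<Sum>n\<in>J. (LINT t|I. cnj (c n) * (G t * e n t)))" by (simp add: c_eq)
  also have "\<dots> = (LINT t|I. (\<Sum>n\<in>J. cnj (c n) * (G t * e n t)))"
    by (rule Bochner_Integration.integral_sum[symmetric]) (intro integrable_mult_right Gei)
  also have "\<dots> = (LINT t|I. G t * h t)"
    by (simp add: h_def sum_distrib_left algebra_simps)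
  finally have 1: "2 * of_real pi * complex_of_real S = (LINT t|I. G t * h t)" .
  have h2: "complex_of_real ((cmod (h t))\<^sup>2) = (\<Sum>n\<in>J. \<Sum>m\<in>J. cnj (c n) * c m * exp (\<i> * of_int (n - m) * of_real t))" for t
  proof -
    have "complex_of_real ((cmod (h t))\<^sup>2) = h t * cnj (h t)" by (rule complex_norm_square)
    also have "cnj (h t) = (\<Sum>m\<in>J. c m * exp (- (\<i> * of_int m * of_real t)))"
      by (simp add: h_def e_def exp_cnj)
    also have "h t * \<dots> = (\<Sum>n\<in>J. \<Sum>m\<in>J. (cnj (c n) * e n t) * (c m * exp (- (\<i> * of_int m * of_real t))))"
      unfolding h_def by (rule sum_product)
    finally show ?thesis
      by (simp add: e_def algebra_simps exp_add[symmetric] exp_diff exp_minus field_simps)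
  qed
  have hi: "integrable I (\<lambda>t. (cmod (h t))\<^sup>2)"
    by (intro integrable_continuous_pi continuous_intros hc)
  have ei: "integrable I (\<lambda>t. exp (\<i> * of_int m * complex_of_real t))" for m
    by (intro integrable_continuous_pi continuous_intros)
  have "complex_of_real (LINT t|I. (cmod (h t))\<^sup>2) = (LINT t|I. complex_of_real ((cmod (h t))\<^sup>2))"
    by (rule integral_complex_of_real[symmetric])
  also have "\<dots> = (\<Sum>n\<in>J. \<Sum>m\<in>J. cnj (c n) * c m * (LINT t|I. exp (\<i> * of_int (n - m) * of_real t)))"
    unfolding h2
    by (simp only: Bochner_Integration.integral_sum integrable_mult_right ei
          Bochner_Integration.integrable_sum integral_mult_right_zero)
  also have "\<dots> = (\<Sum>n\<in>J. cnj (c n) * c n * (2 * of_real pi))"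
    unfolding integral_exp_int by (rule sum.cong) (auto simp: if_distrib J cong: if_cong)
  also have "\<dots> = complex_of_real (2 * pi * S)"
    unfolding S_def of_real_mult of_real_sum complex_norm_square sum_distrib_left
    by (rule sum.cong) (simp_all add: algebra_simps)
  finally have 2: "(LINT t|I. (cmod (h t))\<^sup>2) = 2 * pi * S" by (simp only: of_real_eq_iff)
  have S0: "S \<ge> 0" by (simp add: S_def sum_nonneg)
  have Ghi: "integrable I (\<lambda>t. G t * h t)"
  proof -
    have "integrable I (\<lambda>t. \<Sum>n\<in>J. cnj (c n) * (G t * e n t))"
      by (intro Bochner_Integration.integrable_sum integrable_mult_right Gei)
    then show ?thesis by (simp add: h_def sum_distrib_left algebra_simps)
  qed
  have "2 * pi * S = cmod (2 * of_real pi * complex_of_real S)"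
    using S0 by (simp add: norm_mult)
  also have "\<dots> \<le> (LINT t|I. cmod (G t * h t))" unfolding 1 by (rule integral_norm_bound)
  also have "\<dots> \<le> (LINT t|I. ((cmod (g t))\<^sup>2 + (cmod (h t))\<^sup>2) / 2)"
  proof (rule integral_mono)
    show "integrable I (\<lambda>t. cmod (G t * h t))" by (rule integrable_norm[OF Ghi])
    show "integrable I (\<lambda>t. ((cmod (g t))\<^sup>2 + (cmod (h t))\<^sup>2) / 2)" using g_sq hi by simp
    show "cmod (G t * h t) \<le> ((cmod (g t))\<^sup>2 + (cmod (h t))\<^sup>2) / 2" for t
      using sum_squares_bound[of "cmod (g t)" "cmod (h t)"] by (simp add: norm_mult nG)
  qed
  also have "\<dots> = ((LINT t|I. (cmod (g t))\<^sup>2) + 2 * pi * S) / 2"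
    using g_sq hi 2 by simp
  finally have le: "2 * pi * S \<le> ((LINT t|I. (cmod (g t))\<^sup>2) + 2 * pi * S) / 2" .
  have "x \<le> y" if "x \<le> (y + x) / 2" for x y :: real using that by simp
  from this[OF le] have "2 * pi * S \<le> (LINT t|I. (cmod (g t))\<^sup>2)" .
  then show ?thesis by (simp add: S_def c_def field_simps)
qed

text \<open>The integral over \<open>[-N, N)\<close> equals the integral over \<open>s \<in> [0, 1)\<close> of the sum of \<open>\<bar>F(n + s)\<bar>\<^sup>2\<close> over the
integers \<open>n\<close> in \<open>[-N, N)\<close>, which Bessel's inequality bounds independently of \<open>N\<close>.\<close>

lemma square_integrable: "integrable lborel (\<lambda>x. (cmod (F (of_real x)))\<^sup>2)"
proof -
  define B where "B = 1 / (2 * pi) * (LINT t|I. (cmod (g t))\<^sup>2)"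
  define p where "p x = ennreal ((cmod (F (of_real x)))\<^sup>2)" for x :: real
  have Fc: "continuous_on UNIV (\<lambda>x::real. F (of_real x))"
    using holomorphic_on_imp_continuous_on[OF entire]
    by (rule continuous_on_compose2) (auto intro!: continuous_intros)
  have pm [measurable]: "p \<in> borel_measurable borel"
    unfolding p_def
    by (intro measurable_compose[OF _ measurable_ennreal] borel_measurable_continuous_onI continuous_intros Fc)
  define \<mu> where "\<mu> = density lborel p"
  have em: "emeasure \<mu> A = (\<integral>\<^sup>+x. p x * indicator A x \<partial>lborel)" if "A \<in> sets borel" for A
    using that unfolding \<mu>_def by (subst emeasure_density) auto
  have le: "emeasure \<mu> {- real N..<real N} \<le> ennreal B" for N
  proof -
    define J where "J = {- int N..<int N}"
    have ind: "indicator {- real N..<real N} x = (\<Sum>n\<in>J. indicator {of_int n..<of_int n + 1} x :: ennreal)" for x :: real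
    proof -
      have "(\<Sum>n\<in>J. indicator {of_int n..<of_int n + 1} x :: ennreal) = (\<Sum>n\<in>J. if n = \<lfloor>x\<rfloor> then 1 else 0)"
        by (rule sum.cong) (auto simp: indicator_def floor_eq_iff, linarith+)
      also have "\<dots> = (if \<lfloor>x\<rfloor> \<in> J then 1 else 0)" by (simp add: J_def)
      also have "\<lfloor>x\<rfloor> \<in> J \<longleftrightarrow> x \<in> {- real N..<real N}"
        by (simp add: J_def le_floor_iff floor_less_iff)
      finally show ?thesis by (simp add: indicator_def)
    qed
    have "emeasure \<mu> {- real N..<real N} = (\<integral>\<^sup>+x. (\<Sum>n\<in>J. p x * indicator {of_int n..<of_int n + 1} x) \<partial>lborel)"
      by (subst em) (auto simp: ind sum_distrib_left)
    also have "\<dots> = (\<Sum>n\<in>J. (\<integral>\<^sup>+x. p x * indicator {of_int n..<of_int n + 1} x \<partial>lborel))"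
      by (rule nn_integral_sum) auto
    also have "\<dots> = (\<Sum>n\<in>J. (\<integral>\<^sup>+s. p (of_int n + s) * indicator {0..<1} s \<partial>lborel))"
    proof (rule sum.cong[OF refl])
      fix n :: int
      have "(\<integral>\<^sup>+x. p x * indicator {of_int n..<of_int n + 1} x \<partial>lborel)
        = (\<integral>\<^sup>+x. p x * indicator {of_int n..<of_int n + 1} x \<partial>distr lborel borel ((+) (of_int n)))"
        by (simp add: lborel_distr_plus)
      also have "\<dots> = (\<integral>\<^sup>+s. p (of_int n + s) * indicator {of_int n..<of_int n + 1} (of_int n + s) \<partial>lborel)"
        by (subst nn_integral_distr) auto
      finally show "(\<integral>\<^sup>+x. p x * indicator {of_int n..<of_int n + 1} x \<partial>lborel)
         = (\<integral>\<^sup>+s. p (of_int n + s) * indicator {0..<1} s \<partial>lborel)"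
        by (simp add: indicator_def)
    qed
    also have "\<dots> = (\<integral>\<^sup>+s. (\<Sum>n\<in>J. p (of_int n + s) * indicator {0..<1} s) \<partial>lborel)"
      by (rule nn_integral_sum[symmetric]) auto
    also have "\<dots> \<le> (\<integral>\<^sup>+s. ennreal B * indicator {0..<1::real} s \<partial>lborel)"
    proof (rule nn_integral_mono)
      fix s :: real
      have "(\<Sum>n\<in>J. p (of_int n + s)) = ennreal (\<Sum>n\<in>J. (cmod (F (of_real (of_int n + s))))\<^sup>2)"
        unfolding p_def by (rule sum_ennreal) simp
      also have "\<dots> \<le> ennreal B"
        unfolding B_def by (intro ennreal_leI bessel) (simp add: J_def)
      finally show "(\<Sum>n\<in>J. p (of_int n + s) * indicator {0..<1} s) \<le> ennreal B * indicator {0..<1} s"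
        unfolding sum_distrib_right[symmetric] by (rule mult_right_mono) simp
    qed
    also have "\<dots> = ennreal B" by (subst nn_integral_cmult_indicator) auto
    finally show ?thesis .
  qed
  have "(SUP N. emeasure \<mu> {- real N..<real N}) = emeasure \<mu> (\<Union>N. {- real N..<real N})"
    by (rule SUP_emeasure_incseq) (auto simp: \<mu>_def incseq_def)
  moreover have "(\<Union>N. {- real N..<real N}) = UNIV"
  proof -
    have "\<exists>N. x \<in> {- real N..<real N}" for x
      using reals_Archimedean2[of "\<bar>x\<bar>"] by (force simp: abs_less_iff)
    then show ?thesis by auto
  qed
  moreover have "(SUP N. emeasure \<mu> {- real N..<real N}) \<le> ennreal B"
    by (rule SUP_least) (rule le)
  ultimately have "emeasure \<mu> UNIV \<le> ennreal B" by simp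
  then have "(\<integral>\<^sup>+x. p x \<partial>lborel) \<le> ennreal B" using em[of UNIV] by simp
  then have "(\<integral>\<^sup>+x. p x \<partial>lborel) < \<infinity>" by (simp add: le_less_trans)
  then have "(\<integral>\<^sup>+x. ennreal (norm ((cmod (F (complex_of_real x)))\<^sup>2)) \<partial>lborel) < \<infinity>"
    by (simp add: p_def)
  moreover have "(\<lambda>x. (cmod (F (of_real x)))\<^sup>2) \<in> borel_measurable lborel"
    by (auto intro!: borel_measurable_continuous_onI continuous_intros Fc)
  ultimately show ?thesis by (intro integrableI_bounded)
qed

end

section \<open>Exponential type, and primitives on the real line\<close>

lemma exp_type_upper_bound:
  assumes cont: "continuous_on UNIV G" and type: "exp_type_on H G = ereal a"
    and a: "a \<ge> 0" and e: "e > 0"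
  obtains C where "\<And>z. z \<in> H \<Longrightarrow> cmod (G z) \<le> C * exp ((a + e) * cmod z)"
proof -
  have "Limsup (inf at_infinity (principal H))
       (\<lambda>z. if G z = 0 then -\<infinity> else ereal (ln (cmod (G z)) / cmod z)) < ereal (a + e)"
    using type e by (simp add: exp_type_on_def)
  from Limsup_lessD[OF this] obtain b
    where b: "\<And>z. b \<le> cmod z \<Longrightarrow> z \<in> H \<Longrightarrow> (if G z = 0 then -\<infinity> else ereal (ln (cmod (G z)) / cmod z)) < ereal (a + e)"
    by (auto simp: eventually_inf_principal eventually_at_infinity)
  have "compact (G ` cball 0 (max b 1))"
    by (intro compact_continuous_image continuous_on_subset[OF cont]) auto
  then obtain B where B: "\<And>z. cmod z \<le> max b 1 \<Longrightarrow> cmod (G z) \<le> B"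
    using compact_imp_bounded by (force simp: bounded_iff)
  show thesis
  proof (rule that[of "\<bar>B\<bar> + 1"])
    fix z assume z: "z \<in> H"
    have ge1: "exp ((a + e) * cmod z) \<ge> 1" using a e by simp
    consider "G z = 0" | "cmod z \<le> max b 1" | "G z \<noteq> 0" "cmod z > max b 1" by linarith
    then show "cmod (G z) \<le> (\<bar>B\<bar> + 1) * exp ((a + e) * cmod z)"
    proof cases
      case 2
      have "cmod (G z) \<le> (\<bar>B\<bar> + 1) * 1" using B[OF 2] by simp
      also have "\<dots> \<le> (\<bar>B\<bar> + 1) * exp ((a + e) * cmod z)"
        using ge1 by (intro mult_left_mono) auto
      finally show ?thesis .
    next
      case 3
      then have "ln (cmod (G z)) / cmod z < a + e" using b[of z] z by simp
      moreover have "cmod z > 0" using 3(2) max.cobounded2[of 1 b] by linarith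
      ultimately have "ln (cmod (G z)) < (a + e) * cmod z" by (simp only: pos_divide_less_eq)
      then have "cmod (G z) < exp ((a + e) * cmod z)" using 3
        by (metis exp_less_mono exp_ln zero_less_norm_iff)
      also have "\<dots> \<le> (\<bar>B\<bar> + 1) * exp ((a + e) * cmod z)" by simp
      finally show ?thesis by simp
    qed auto
  qed
qed

lemma exp_type_le:
  assumes bound: "\<And>z. z \<in> H \<Longrightarrow> cmod (G z) \<le> C * (1 + cmod z) ^ 3 * exp (a * \<bar>Im z\<bar>)" and a: "a \<ge> 0"
  shows "exp_type_on H G \<le> ereal a"
proof (rule ereal_le_epsilon2)
  fix e :: real assume e: "e > 0"
  show "exp_type_on H G \<le> ereal a + ereal e"
  proof -
    define C' where "C' = \<bar>C\<bar> + 1"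
    have C': "C' > 0" "C \<le> C'" by (auto simp: C'_def)
    have "((\<lambda>r. C' * (1 + r) ^ 3 * exp (- e * r)) \<longlongrightarrow> 0) at_top"
      using e C'(1) by real_asymp
    then have "eventually (\<lambda>r. C' * (1 + r) ^ 3 * exp (- e * r) < 1) at_top"
      by (simp add: order_tendsto_iff)
    then obtain R where R: "\<And>r. r \<ge> R \<Longrightarrow> C' * (1 + r) ^ 3 * exp (- e * r) < 1"
      by (auto simp: eventually_at_top_linorder)
    have "(if G z = 0 then -\<infinity> else ereal (ln (cmod (G z)) / cmod z)) \<le> ereal (a + e)"
      if z: "z \<in> H" "max R 1 \<le> cmod z" for z
    proof (cases "G z = 0")
      case False
      have "C' * (1 + cmod z) ^ 3 = C' * (1 + cmod z) ^ 3 * exp (- e * cmod z) * exp (e * cmod z)"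
        by (simp add: exp_minus field_simps)
      also have "\<dots> \<le> 1 * exp (e * cmod z)"
        using R[of "cmod z"] z by (intro mult_right_mono) auto
      finally have 1: "C' * (1 + cmod z) ^ 3 \<le> exp (e * cmod z)" by simp
      have "cmod (G z) \<le> C * (1 + cmod z) ^ 3 * exp (a * \<bar>Im z\<bar>)" by (rule bound[OF z(1)])
      also have "\<dots> \<le> C' * (1 + cmod z) ^ 3 * exp (a * cmod z)"
        using C' a abs_Im_le_cmod[of z] by (intro mult_mono) (auto intro: mult_left_mono)
      also have "\<dots> \<le> exp (e * cmod z) * exp (a * cmod z)"
        using 1 by (intro mult_right_mono) auto
      also have "\<dots> = exp ((a + e) * cmod z)" by (simp add: exp_add[symmetric] algebra_simps)
      finally have "ln (cmod (G z)) \<le> (a + e) * cmod z"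
        using False by (metis exp_le_cancel_iff exp_ln zero_less_norm_iff)
      moreover have "cmod z > 0" using z(2) max.cobounded2[of 1 R] by linarith
      ultimately have "ln (cmod (G z)) / cmod z \<le> a + e" by (simp only: pos_divide_le_eq)
      then show ?thesis using False by simp
    qed simp
    then have "eventually (\<lambda>z. (if G z = 0 then -\<infinity> else ereal (ln (cmod (G z)) / cmod z)) \<le> ereal (a + e))
       (inf at_infinity (principal H))"
      unfolding eventually_inf_principal eventually_at_infinity by blast
    then have "exp_type_on H G \<le> ereal (a + e)"
      unfolding exp_type_on_def by (rule Limsup_bounded)
    then show "exp_type_on H G \<le> ereal a + ereal e" by simp
  qed
qed

lemma integral_interval_le_lborel:
  fixes u :: "real \<Rightarrow> real"
  assumes u: "integrable lborel u" and pos: "\<And>x. 0 \<le> u x"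
  shows "u integrable_on {a..b}" and "integral {a..b} u \<le> (LINT x|lborel. u x)"
proof -
  have hi: "(u has_integral (LINT x|lborel. u x)) UNIV"
    using has_integral_integral_lborel[OF u] by simp
  show 1: "u integrable_on {a..b}"
    using hi integrable_on_subinterval[of u UNIV a b] by (auto simp: has_integral_integrable)
  have "integral {a..b} u \<le> integral UNIV u"
    by (rule integral_subset_le) (use 1 hi pos in \<open>auto simp: has_integral_integrable\<close>)
  then show "integral {a..b} u \<le> (LINT x|lborel. u x)" using hi by (simp add: integral_unique)
qed

lemma primitive_diff_le:
  fixes h P :: "complex \<Rightarrow> complex"
  assumes P: "\<And>x. (P has_field_derivative h (of_real x)) (at (of_real x))"
    and hc: "continuous_on UNIV (\<lambda>x::real. h (of_real x))"
    and u: "integrable lborel u" and u0: "\<And>x. 0 \<le> u x"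
    and le: "\<And>x. a \<le> x \<Longrightarrow> x \<le> b \<Longrightarrow> cmod (h (of_real x)) \<le> c * u x + d"
    and c: "c \<ge> 0" and ab: "a \<le> b"
  shows "cmod (P (of_real b) - P (of_real a)) \<le> c * integral {a..b} u + d * (b - a)"
proof -
  have cu: "(\<lambda>x. c * u x) integrable_on {a..b}"
    using integrable_cmul[OF integral_interval_le_lborel(1)[OF u u0, of a b], of c]
    by (simp only: real_scaleR_def)
  have "((\<lambda>x. h (of_real x)) has_integral (P (of_real b) - P (of_real a))) {a..b}"
    using ab
  proof (rule fundamental_theorem_of_calculus)
    fix x
    show "((\<lambda>x. P (of_real x)) has_vector_derivative h (of_real x)) (at x within {a..b})"
      using has_vector_derivative_real_field[OF P] by simp
  qed
  then have "P (of_real b) - P (of_real a) = integral {a..b} (\<lambda>x. h (of_real x))"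
    by (rule integral_unique[symmetric])
  also have "cmod \<dots> \<le> integral {a..b} (\<lambda>x. c * u x + d)"
  proof (rule integral_norm_bound_integral)
    show "(\<lambda>x. h (of_real x)) integrable_on {a..b}"
      by (intro integrable_continuous_real continuous_on_subset[OF hc]) auto
    show "(\<lambda>x. c * u x + d) integrable_on {a..b}"
      by (intro integrable_add cu integrable_const_ivl)
  qed (use le in auto)
  also have "\<dots> = c * integral {a..b} u + d * (b - a)"
    using integral_add[OF cu integrable_const_ivl[of d]] ab by simp
  finally show ?thesis .
qed

text \<open>Primitives convert integral information on the real line into the pointwise bounds required by the
Phragmen-Lindelof principle. Here \<open>\<bar>h\<bar> \<le> \<bar>h\<bar>\<^sup>2 / (1 + x\<^sup>2) + (1 + x\<^sup>2)\<close>, and integrating the second summand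
produces the exponent three.\<close>

lemma primitive_cubic_bound:
  fixes h P :: "complex \<Rightarrow> complex"
  assumes P: "\<And>x. (P has_field_derivative h (of_real x)) (at (of_real x))"
    and hc: "continuous_on UNIV (\<lambda>x::real. h (of_real x))"
    and hi: "integrable lborel (\<lambda>x. (cmod (h (of_real x)))\<^sup>2 / (1 + \<bar>x\<bar>\<^sup>2))"
  obtains C where "C > 0" "\<And>x. cmod (P (of_real x)) \<le> C * (1 + \<bar>x\<bar>) ^ 3"
proof -
  define u where "u x = (cmod (h (of_real x)))\<^sup>2 / (1 + \<bar>x\<bar>\<^sup>2)" for x :: real
  define M where "M = (LINT x|lborel. u x)"
  have u: "integrable lborel u" "\<And>x. 0 \<le> u x" using hi by (auto simp: u_def[abs_def])
  have M0: "M \<ge> 0" unfolding M_def using u by (intro integral_nonneg_AE) auto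
  have hle: "cmod (h (of_real x)) \<le> 1 * u x + (1 + \<bar>x\<bar>\<^sup>2)" for x :: real
  proof -
    have pos: "1 + \<bar>x\<bar>\<^sup>2 > 0" by (simp add: add_pos_nonneg)
    have "(cmod (h (of_real x)))\<^sup>2 = u x * (1 + \<bar>x\<bar>\<^sup>2)" using pos by (simp add: u_def)
    also have "\<dots> \<le> (u x + (1 + \<bar>x\<bar>\<^sup>2))\<^sup>2"
    proof -
      have "v * q \<le> (v + q)\<^sup>2" if "0 \<le> v" "0 \<le> q" for v q :: real
        using that by (simp add: power2_eq_square algebra_simps)
      then show ?thesis using u(2)[of x] pos by (simp del: power2_abs)
    qed
    finally have "cmod (h (of_real x)) \<le> u x + (1 + \<bar>x\<bar>\<^sup>2)"
      by (rule power2_le_imp_le) (use u(2)[of x] pos in auto)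
    then show ?thesis by simp
  qed
  have diff: "cmod (P (of_real b) - P (of_real a)) \<le> M + (1 + \<bar>r\<bar>\<^sup>2) * (b - a)"
    if ab: "a \<le> b" "\<And>x. a \<le> x \<Longrightarrow> x \<le> b \<Longrightarrow> \<bar>x\<bar> \<le> \<bar>r\<bar>" for a b r :: real
  proof -
    have "cmod (P (of_real b) - P (of_real a)) \<le> 1 * integral {a..b} u + (1 + \<bar>r\<bar>\<^sup>2) * (b - a)"
    proof (rule primitive_diff_le[OF P hc u])
      fix x assume "a \<le> x" "x \<le> b"
      then have "\<bar>x\<bar>\<^sup>2 \<le> \<bar>r\<bar>\<^sup>2" by (intro power_mono ab(2)) auto
      then show "cmod (h (of_real x)) \<le> 1 * u x + (1 + \<bar>r\<bar>\<^sup>2)" using hle[of x] by linarith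
    qed (use ab in auto)
    also have "integral {a..b} u \<le> M" unfolding M_def by (rule integral_interval_le_lborel(2)[OF u])
    finally show ?thesis by simp
  qed
  have P0: "cmod (P (of_real x)) \<le> (cmod (P 0) + M + 1) * (1 + \<bar>x\<bar>) ^ 3" for x :: real
  proof -
    have "cmod (P (of_real x) - P 0) \<le> M + (1 + \<bar>x\<bar>\<^sup>2) * \<bar>x\<bar>"
      using diff[of 0 x x] diff[of x 0 x] by (cases "x \<ge> 0") (auto simp: norm_minus_commute)
    then have "cmod (P (of_real x)) \<le> (cmod (P 0) + M) * 1 + 1 * ((1 + \<bar>x\<bar>\<^sup>2) * \<bar>x\<bar>)"
      using norm_triangle_sub[of "P (of_real x)" "P 0"] by simp
    also have "\<dots> \<le> (cmod (P 0) + M) * (1 + \<bar>x\<bar>) ^ 3 + 1 * (1 + \<bar>x\<bar>) ^ 3"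
    proof (intro add_mono mult_left_mono)
      show "(1 + \<bar>x\<bar>\<^sup>2) * \<bar>x\<bar> \<le> (1 + \<bar>x\<bar>) ^ 3"
        by (simp add: power3_eq_cube power2_eq_square algebra_simps)
    qed (use M0 in \<open>auto intro: one_le_power\<close>)
    finally show ?thesis by (simp add: algebra_simps)
  qed
  show thesis by (rule that[OF _ P0]) (use M0 in \<open>simp add: add_nonneg_pos\<close>)
qed

text \<open>Beyond a large \<open>B\<close> the integral of \<open>\<bar>h\<bar> / (1 + \<bar>x\<bar>)\<close> is small, and multiplication by \<open>1 + \<bar>x\<bar>\<close> costs only a
linear factor; the part up to \<open>B\<close> is a constant.\<close>

lemma primitive_little_o:
  fixes h P :: "complex \<Rightarrow> complex"
  assumes P: "\<And>x. (P has_field_derivative h (of_real x)) (at (of_real x))"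
    and hc: "continuous_on UNIV (\<lambda>x::real. h (of_real x))"
    and hi: "integrable lborel (\<lambda>x. cmod (h (of_real x)) / (1 + \<bar>x\<bar>))"
    and e: "e > 0"
  obtains X where "\<And>x. \<bar>x\<bar> \<ge> X \<Longrightarrow> cmod (P (of_real x)) \<le> e * (1 + \<bar>x\<bar>)"
proof -
  define u where "u x = cmod (h (of_real x)) / (1 + \<bar>x\<bar>)" for x :: real
  define M where "M = (LINT x|lborel. u x)"
  have u: "integrable lborel u" "\<And>x. 0 \<le> u x" using hi by (auto simp: u_def[abs_def])
  have ui: "u integrable_on {a..b}" for a b by (rule integral_interval_le_lborel(1)[OF u])
  have hi: "(u has_integral M) UNIV"
    using has_integral_integral_lborel[OF u(1)] by (simp add: M_def)
  have "e / 2 > 0" using e by simp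
  then obtain B where B: "B > 0"
    "\<And>a b. ball 0 B \<subseteq> cbox a b \<Longrightarrow> norm (integral (cbox a b) (\<lambda>x. if x \<in> UNIV then u x else 0) - M) < e / 2"
    using hi unfolding has_integral_alt' by meson
  have "ball 0 B \<subseteq> cbox (- B) B" by (auto simp: abs_less_iff)
  then have "norm (integral {- B..B} u - M) < e / 2" using B(2)[of "- B" B] by simp
  then have B2: "M - integral {- B..B} u < e / 2" unfolding real_norm_def by linarith
  have tail: "integral {B..x} u \<le> e / 2" "integral {-x..-B} u \<le> e / 2" if "x \<ge> B" for x
  proof -
    have "integral {- B..B} u + integral {B..x} u = integral {- B..x} u"
      by (rule Henstock_Kurzweil_Integration.integral_combine) (use that B(1) ui in auto)
    moreover have "integral {-x..-B} u + integral {- B..B} u = integral {-x..B} u"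
      by (rule Henstock_Kurzweil_Integration.integral_combine) (use that B(1) ui in auto)
    ultimately show "integral {B..x} u \<le> e / 2" "integral {-x..-B} u \<le> e / 2"
      using integral_interval_le_lborel(2)[OF u, of "- B" x] integral_interval_le_lborel(2)[OF u, of "-x" B] B2
      unfolding M_def by linarith+
  qed
  have diff: "cmod (P (of_real b) - P (of_real a)) \<le> (1 + r) * integral {a..b} u"
    if ab: "a \<le> b" "r \<ge> 0" "\<And>x. a \<le> x \<Longrightarrow> x \<le> b \<Longrightarrow> \<bar>x\<bar> \<le> r" for a b r :: real
  proof -
    have "cmod (P (of_real b) - P (of_real a)) \<le> (1 + r) * integral {a..b} u + 0 * (b - a)"
    proof (rule primitive_diff_le[OF P hc u])
      fix x assume x: "a \<le> x" "x \<le> b"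
      have "cmod (h (of_real x)) = (1 + \<bar>x\<bar>) * u x" by (simp add: u_def)
      also have "\<dots> \<le> (1 + r) * u x" using ab(3)[OF x] u(2)[of x] by (intro mult_right_mono) auto
      finally show "cmod (h (of_real x)) \<le> (1 + r) * u x + 0" by simp
    qed (use ab in auto)
    then show ?thesis by simp
  qed
  define N where "N = max (cmod (P (of_real B))) (cmod (P (of_real (- B))))"
  show thesis
  proof (rule that[of "max B (2 * N / e)"])
    fix x :: real assume x: "\<bar>x\<bar> \<ge> max B (2 * N / e)"
    have "N \<le> e / 2 * \<bar>x\<bar>" using x e by (simp add: field_simps)
    moreover have "cmod (P (of_real x)) \<le> N + (1 + \<bar>x\<bar>) * (e / 2)"
    proof (cases "x \<ge> 0")
      case True
      have "cmod (P (of_real x) - P (of_real B)) \<le> (1 + \<bar>x\<bar>) * integral {B..x} u"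
        by (rule diff) (use x True B in auto)
      also have "\<dots> \<le> (1 + \<bar>x\<bar>) * (e / 2)" using tail(1)[of x] x True by (intro mult_left_mono) auto
      finally show ?thesis
        using norm_triangle_sub[of "P (of_real x)" "P (of_real B)"] by (simp add: N_def)
    next
      case False
      have "cmod (P (of_real (- B)) - P (of_real x)) \<le> (1 + \<bar>x\<bar>) * integral {x..- B} u"
        by (rule diff) (use x False B in auto)
      also have "\<dots> \<le> (1 + \<bar>x\<bar>) * (e / 2)" using tail(2)[of "- x"] x False by (intro mult_left_mono) auto
      finally show ?thesis
        using norm_triangle_sub[of "P (of_real x)" "P (of_real (- B))"]
        by (simp add: N_def norm_minus_commute)
    qed
    moreover have "e / 2 * \<bar>x\<bar> + (1 + \<bar>x\<bar>) * (e / 2) \<le> e * (1 + \<bar>x\<bar>)"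
      using e by (simp add: field_simps)
    ultimately show "cmod (P (of_real x)) \<le> e * (1 + \<bar>x\<bar>)" by linarith
  qed
qed

section \<open>Reflection and the growth class\<close>

definition reflect :: "(complex \<Rightarrow> complex) \<Rightarrow> complex \<Rightarrow> complex" where
  "reflect f z = cnj (f (cnj z))"

lemma reflect_o: "reflect f = cnj \<circ> f \<circ> cnj"
  by (auto simp: reflect_def)

lemma norm_reflect_of_real [simp]: "cmod (reflect f (of_real x)) = cmod (f (of_real x))"
  by (simp add: reflect_def)

lemma norm_reflect: "cmod (reflect f z) = cmod (f (cnj z))"
  by (simp add: reflect_def)

lemma reflect_holomorphic: "f holomorphic_on UNIV \<Longrightarrow> reflect f holomorphic_on UNIV"
  unfolding reflect_o by (rule holomorphic_on_compose_cnj_cnj) (auto intro: holomorphic_on_subset)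

lemma reflect_has_field_derivative:
  assumes "\<And>z. (P has_field_derivative f z) (at z)"
  shows "(reflect P has_field_derivative reflect f z) (at z)"
  using has_field_derivative_cnj_cnj[OF assms, of z] by (simp add: reflect_o)

lemma pl_growthI:
  assumes "\<exists>A B. \<forall>z. 0 \<le> Im z \<longrightarrow> cmod (f z) \<le> A * exp (B * (cmod z)\<^sup>2)"
    and "\<And>e. e > 0 \<Longrightarrow> \<exists>C. \<forall>z. \<bar>Re z\<bar> \<le> Im z \<longrightarrow> cmod (f z) \<le> C * exp (e * cmod z)"
  shows "pl_growth f"
proof -
  obtain A B where AB: "\<And>z. 0 \<le> Im z \<Longrightarrow> cmod (f z) \<le> A * exp (B * (cmod z)\<^sup>2)"
    using assms(1) by blast
  define C where "C = max \<bar>A\<bar> \<bar>B\<bar>"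
  have "cmod (f z) \<le> C * exp (C * (cmod z)\<^sup>2)" if "0 \<le> Im z" for z
  proof -
    have "A * exp (B * (cmod z)\<^sup>2) \<le> C * exp (C * (cmod z)\<^sup>2)"
      unfolding C_def by (intro mult_mono) (auto intro!: mult_right_mono)
    then show ?thesis using AB[OF that] by linarith
  qed
  then show ?thesis using assms(2) by (auto simp: pl_growth_def)
qed

lemma pl_growth_mult:
  assumes f: "pl_growth f" and g: "pl_growth g"
  shows "pl_growth (\<lambda>z. f z * g z)"
proof (rule pl_growthI)
  obtain C D where C: "\<And>z. 0 \<le> Im z \<Longrightarrow> cmod (f z) \<le> C * exp (C * (cmod z)\<^sup>2)"
    and D: "\<And>z. 0 \<le> Im z \<Longrightarrow> cmod (g z) \<le> D * exp (D * (cmod z)\<^sup>2)"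
    using f g unfolding pl_growth_def by blast
  show "\<exists>A B. \<forall>z. 0 \<le> Im z \<longrightarrow> cmod (f z * g z) \<le> A * exp (B * (cmod z)\<^sup>2)"
  proof (intro exI allI impI)
    fix z :: complex assume z: "0 \<le> Im z"
    have "cmod (f z * g z) \<le> (C * exp (C * (cmod z)\<^sup>2)) * (D * exp (D * (cmod z)\<^sup>2))"
      unfolding norm_mult using order_trans[OF norm_ge_zero C[OF z]]
      by (intro mult_mono C D z) auto
    also have "\<dots> = (C * D) * exp ((C + D) * (cmod z)\<^sup>2)" by (simp add: exp_add ring_distribs)
    finally show "cmod (f z * g z) \<le> (C * D) * exp ((C + D) * (cmod z)\<^sup>2)" .
  qed
next
  fix e :: real assume "e > 0"
  then have "e / 2 > 0" by simp
  then obtain C D where C: "\<And>z. \<bar>Re z\<bar> \<le> Im z \<Longrightarrow> cmod (f z) \<le> C * exp (e/2 * cmod z)"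
    and D: "\<And>z. \<bar>Re z\<bar> \<le> Im z \<Longrightarrow> cmod (g z) \<le> D * exp (e/2 * cmod z)"
    using f g unfolding pl_growth_def by meson
  show "\<exists>C. \<forall>z. \<bar>Re z\<bar> \<le> Im z \<longrightarrow> cmod (f z * g z) \<le> C * exp (e * cmod z)"
  proof (intro exI allI impI)
    fix z :: complex assume z: "\<bar>Re z\<bar> \<le> Im z"
    have "cmod (f z * g z) \<le> (C * exp (e/2 * cmod z)) * (D * exp (e/2 * cmod z))"
      unfolding norm_mult using order_trans[OF norm_ge_zero C[OF z]]
      by (intro mult_mono C D z) auto
    also have "\<dots> = (C * D) * exp (e * cmod z)" by (simp add: exp_add[symmetric])
    finally show "cmod (f z * g z) \<le> (C * D) * exp (e * cmod z)" .
  qed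
qed

lemma le_exp_mult: "e > 0 \<Longrightarrow> r \<le> exp (e * r) / e" for r e :: real
proof -
  have "e * r \<le> exp (e * r)" using exp_ge_add_one_self[of "e * r"] by linarith
  then show "e > 0 \<Longrightarrow> ?thesis" by (simp add: pos_le_divide_eq mult.commute)
qed

lemma le_exp_square: "r \<le> exp (r\<^sup>2)" for r :: real
proof -
  have "r \<le> 1 + r\<^sup>2" using zero_le_power2[of "r - 1/2"] by (simp add: power2_eq_square algebra_simps)
  also have "\<dots> \<le> exp (r\<^sup>2)" by (rule exp_ge_add_one_self)
  finally show ?thesis .
qed

lemma pl_growth_mono:
  assumes g: "pl_growth g" and le: "\<And>z. 0 \<le> Im z \<Longrightarrow> cmod (f z) \<le> cmod (g z)"
  shows "pl_growth f"
  using g le unfolding pl_growth_def by (meson abs_ge_zero order_trans)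

lemma pl_growth_poly:
  assumes f: "\<And>z. 0 \<le> Im z \<Longrightarrow> cmod (f z) \<le> C * (1 + cmod z) ^ k"
  shows "pl_growth f"
proof -
  have const: "pl_growth (\<lambda>_. c)" for c
    unfolding pl_growth_def
    by (auto intro!: exI[of _ "cmod c"] simp: mult_le_cancel_left1)
  have lin: "pl_growth (\<lambda>z. of_real (1 + cmod z))"
  proof (rule pl_growthI)
    have "cmod (of_real (1 + cmod z)) \<le> 2 * exp (1 * (cmod z)\<^sup>2)" for z :: complex
      using le_exp_square[of "cmod z"] one_le_exp_iff[of "(cmod z)\<^sup>2"]
      by (simp del: of_real_add one_le_exp_iff)
    then show "\<exists>A B. \<forall>z::complex. 0 \<le> Im z \<longrightarrow> cmod (of_real (1 + cmod z)) \<le> A * exp (B * (cmod z)\<^sup>2)"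
      by blast
    fix e :: real assume e: "e > 0"
    have "cmod (of_real (1 + cmod z)) \<le> (1 + 1 / e) * exp (e * cmod z)" for z :: complex
    proof -
      have "1 \<le> exp (e * cmod z)" using e by simp
      then show ?thesis using le_exp_mult[OF e, of "cmod z"]
        by (simp add: ring_distribs del: of_real_add one_le_exp_iff)
    qed
    then show "\<exists>C. \<forall>z. \<bar>Re z\<bar> \<le> Im z \<longrightarrow> cmod (of_real (1 + cmod z) :: complex) \<le> C * exp (e * cmod z)"
      by blast
  qed
  have pow: "pl_growth (\<lambda>z. of_real (1 + cmod z) ^ k)"
    by (induction k) (simp_all add: const pl_growth_mult[OF lin] del: of_real_add)
  show ?thesis
  proof (rule pl_growth_mono[OF pl_growth_mult[OF const[of "of_real C"] pow]])
    fix z :: complex assume "0 \<le> Im z"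
    have "C * (1 + cmod z) ^ k \<le> \<bar>C\<bar> * (1 + cmod z) ^ k" by (intro mult_right_mono) auto
    moreover have "cmod (of_real (1 + cmod z)) = 1 + cmod z"
      unfolding norm_of_real by simp
    ultimately show "cmod (f z) \<le> cmod (of_real C * of_real (1 + cmod z) ^ k)"
      using f[OF \<open>0 \<le> Im z\<close>] by (simp add: norm_mult norm_power del: of_real_add)
  qed
qed

lemma norm_primitive_le:
  assumes P: "\<And>w. w \<in> closed_segment 0 z \<Longrightarrow> (P has_field_derivative f w) (at w)"
    and B: "\<And>w. w \<in> closed_segment 0 z \<Longrightarrow> cmod (f w) \<le> B"
  shows "cmod (P z) \<le> cmod (P 0) + cmod z * B"
proof -
  have "cmod (P z - P 0) \<le> B * cmod (z - 0)"
    by (rule field_differentiable_bound[where S = "closed_segment 0 z" and f' = f])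
       (auto intro: has_field_derivative_at_within P B)
  then show ?thesis
    using norm_triangle_sub[of "P z" "P 0"] by (simp add: mult.commute)
qed

lemma segment_from_0:
  assumes "w \<in> closed_segment 0 z"
  obtains t where "0 \<le> t" "t \<le> 1" "w = of_real t * z" "cmod w \<le> cmod z"
proof -
  obtain t where t: "0 \<le> t" "t \<le> 1" "w = of_real t * z"
    using assms by (auto simp: in_segment scaleR_conv_of_real)
  moreover have "cmod w \<le> 1 * cmod z"
    using t mult_right_mono[of t 1 "cmod z"] by (simp add: norm_mult)
  ultimately show thesis using that by simp
qed

lemma pl_growth_primitive:
  assumes P: "\<And>z. 0 \<le> Im z \<Longrightarrow> (P has_field_derivative f z) (at z)" and f: "pl_growth f"
  shows "pl_growth P"
proof (rule pl_growthI)
  obtain C where C: "\<And>z. 0 \<le> Im z \<Longrightarrow> cmod (f z) \<le> C * exp (C * (cmod z)\<^sup>2)"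
    using f unfolding pl_growth_def by blast
  have C0: "C \<ge> 0" using C[of 0] norm_ge_zero[of "f 0"] by (simp del: norm_ge_zero)
  show "\<exists>A B. \<forall>z. 0 \<le> Im z \<longrightarrow> cmod (P z) \<le> A * exp (B * (cmod z)\<^sup>2)"
  proof (intro exI allI impI)
    fix z :: complex assume z: "0 \<le> Im z"
    have "cmod (P z) \<le> cmod (P 0) + cmod z * (C * exp (C * (cmod z)\<^sup>2))"
    proof (rule norm_primitive_le)
      fix w assume "w \<in> closed_segment 0 z"
      then obtain t where t: "0 \<le> t" "t \<le> 1" "w = of_real t * z" "cmod w \<le> cmod z"
        by (rule segment_from_0)
      then have w: "0 \<le> Im w" using z by simp
      then show "(P has_field_derivative f w) (at w)" by (rule P)
      have "(cmod w)\<^sup>2 \<le> (cmod z)\<^sup>2" using t(4) by (intro power_mono) auto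
      then have "C * exp (C * (cmod w)\<^sup>2) \<le> C * exp (C * (cmod z)\<^sup>2)"
        using C0 by (intro mult_left_mono) (auto intro: mult_left_mono)
      then show "cmod (f w) \<le> C * exp (C * (cmod z)\<^sup>2)" using C[OF w] by linarith
    qed
    also have "\<dots> \<le> cmod (P 0) * exp ((C + 1) * (cmod z)\<^sup>2) + exp ((cmod z)\<^sup>2) * (C * exp (C * (cmod z)\<^sup>2))"
    proof (intro add_mono mult_right_mono)
      show "cmod z \<le> exp ((cmod z)\<^sup>2)" by (rule le_exp_square)
    qed (use C0 in \<open>auto simp: mult_le_cancel_left1\<close>)
    also have "\<dots> = (cmod (P 0) + C) * exp ((C + 1) * (cmod z)\<^sup>2)"
      by (simp add: exp_add ring_distribs)
    finally show "cmod (P z) \<le> (cmod (P 0) + C) * exp ((C + 1) * (cmod z)\<^sup>2)" .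
  qed
next
  fix e :: real assume e: "e > 0"
  then have "e / 2 > 0" by simp
  then obtain C where C: "\<And>z. \<bar>Re z\<bar> \<le> Im z \<Longrightarrow> cmod (f z) \<le> C * exp (e/2 * cmod z)"
    using f unfolding pl_growth_def by meson
  have C0: "C \<ge> 0" using C[of 0] norm_ge_zero[of "f 0"] by (simp del: norm_ge_zero)
  show "\<exists>C. \<forall>z. \<bar>Re z\<bar> \<le> Im z \<longrightarrow> cmod (P z) \<le> C * exp (e * cmod z)"
  proof (intro exI allI impI)
    fix z :: complex assume z: "\<bar>Re z\<bar> \<le> Im z"
    have "cmod (P z) \<le> cmod (P 0) + cmod z * (C * exp (e/2 * cmod z))"
    proof (rule norm_primitive_le)
      fix w assume "w \<in> closed_segment 0 z"
      then obtain t where t: "0 \<le> t" "t \<le> 1" "w = of_real t * z" "cmod w \<le> cmod z"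
        by (rule segment_from_0)
      then have w: "\<bar>Re w\<bar> \<le> Im w" using z by (auto simp: abs_mult intro: mult_left_mono)
      then show "(P has_field_derivative f w) (at w)" by (intro P) linarith
      have "C * exp (e/2 * cmod w) \<le> C * exp (e/2 * cmod z)"
        using C0 e t(4) by (intro mult_left_mono) auto
      then show "cmod (f w) \<le> C * exp (e/2 * cmod z)" using C[OF w] by linarith
    qed
    also have "\<dots> \<le> cmod (P 0) * exp (e * cmod z) + (exp (e/2 * cmod z) / (e/2)) * (C * exp (e/2 * cmod z))"
      using C0 e by (intro add_mono mult_right_mono le_exp_mult) (auto simp: mult_le_cancel_left1)
    also have "\<dots> = (cmod (P 0) + 2 * C / e) * exp (e * cmod z)"
      by (simp add: exp_add[symmetric] ring_distribs)
    finally show "cmod (P z) \<le> (cmod (P 0) + 2 * C / e) * exp (e * cmod z)" .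
  qed
qed

lemma UHP_closure_le:
  fixes f g :: "complex \<Rightarrow> real"
  assumes "continuous_on UNIV f" "continuous_on UNIV g"
    and le: "\<And>z. 0 < Im z \<Longrightarrow> f z \<le> g z" and z: "0 \<le> Im z"
  shows "f z \<le> g z"
proof (rule LIMSEQ_le)
  have l: "(\<lambda>n. z + \<i> * of_real (1 / real (Suc n))) \<longlonglongrightarrow> z + \<i> * of_real 0"
    by (intro tendsto_intros LIMSEQ_Suc[OF lim_1_over_n])
  have "isCont f z" "isCont g z"
    using assms(1,2) by (auto simp: continuous_on_eq_continuous_at)
  then show "(\<lambda>n. f (z + \<i> * of_real (1 / real (Suc n)))) \<longlonglongrightarrow> f z"
    "(\<lambda>n. g (z + \<i> * of_real (1 / real (Suc n)))) \<longlonglongrightarrow> g z"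
    using l by (auto intro: isCont_tendsto_compose)
  show "\<exists>N. \<forall>n\<ge>N. f (z + \<i> * of_real (1 / real (Suc n))) \<le> g (z + \<i> * of_real (1 / real (Suc n)))"
    using z by (intro exI allI impI le) (simp add: add_nonneg_pos)
qed

lemma UHP_norm_ge:
  assumes "0 \<le> Im z" "c \<ge> 0"
  shows "cmod z \<le> cmod (z + \<i> * of_real c)" "c \<le> cmod (z + \<i> * of_real c)"
proof -
  have "(Re z)\<^sup>2 + (Im z)\<^sup>2 \<le> (Re z)\<^sup>2 + (Im z + c)\<^sup>2" using assms by (simp add: power_mono)
  then show "cmod z \<le> cmod (z + \<i> * of_real c)" unfolding cmod_def by (intro real_sqrt_le_mono) simp
  have "c \<le> Im (z + \<i> * of_real c)" using assms by simp
  also have "\<dots> \<le> cmod (z + \<i> * of_real c)" using abs_Im_le_cmod[of "z + \<i> * of_real c"] by linarith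
  finally show "c \<le> cmod (z + \<i> * of_real c)" .
qed

section \<open>Polynomial growth up to the exponential factor\<close>

text \<open>The Phragmen-Lindelof principle for functions of exponential type is applied to
\<open>P(z) exp(i\<pi>z) / (z + i)\<^sup>3\<close>.\<close>

lemma primitive_growth_UHP:
  assumes f: "f holomorphic_on UNIV" and P: "\<And>z. (P has_field_derivative f z) (at z)"
    and Preal: "\<And>x. cmod (P (of_real x)) \<le> C * (1 + \<bar>x\<bar>) ^ 3" and C: "C > 0"
    and growth: "\<And>e. e > 0 \<Longrightarrow> \<exists>C. \<forall>z. 0 < Im z \<longrightarrow> cmod (f z) \<le> C * exp ((pi + e) * cmod z)"
    and z: "0 \<le> Im z"
  shows "cmod (P z) \<le> 8 * C * (1 + cmod z) ^ 3 * exp (pi * Im z)"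
proof -
  have Ph: "P holomorphic_on UNIV" using P by (auto simp: holomorphic_on_def field_differentiable_def intro: has_field_derivative_at_within)
  have nz: "w + \<i> \<noteq> 0" if "0 \<le> Im w" for w
    using that by (auto simp: complex_eq_iff)
  have ge1: "1 \<le> cmod (w + \<i>)" "cmod w \<le> cmod (w + \<i>)" if "0 \<le> Im w" for w
    using UHP_norm_ge[OF that, of 1] by auto
  define k where "k = (\<lambda>w. P w * exp (\<i> * of_real pi * w) / (w + \<i>) ^ 3)"
  have nk: "cmod (k w) = cmod (P w) * exp (- pi * Im w) / cmod (w + \<i>) ^ 3" for w
    by (simp add: k_def norm_mult norm_divide norm_power)
  have nk_le: "cmod (k w) \<le> cmod (P w) * exp (- pi * Im w)" if "0 \<le> Im w" for w
  proof -
    have "cmod (P w) * exp (- pi * Im w) / cmod (w + \<i>) ^ 3 \<le> cmod (P w) * exp (- pi * Im w) / 1"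
      using one_le_power[OF ge1(1)[OF that], of 3] by (intro divide_left_mono) auto
    then show ?thesis by (simp add: nk)
  qed
  have Pgr: "\<exists>D\<ge>0. \<forall>w. 0 \<le> Im w \<longrightarrow> cmod (P w) \<le> cmod (P 0) + cmod w * (D * exp ((pi + e) * cmod w))"
    if e: "e > 0" for e
  proof -
    obtain D where D: "\<And>z. 0 < Im z \<Longrightarrow> cmod (f z) \<le> D * exp ((pi + e) * cmod z)"
      using growth[OF e] by blast
    have D': "cmod (f z) \<le> D * exp ((pi + e) * cmod z)" if "0 \<le> Im z" for z
      by (rule UHP_closure_le[OF _ _ D that])
         (auto intro!: continuous_intros holomorphic_on_imp_continuous_on[OF f])
    have D0: "D \<ge> 0" using D'[of 0] norm_ge_zero[of "f 0"] by (simp del: norm_ge_zero)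
    have "cmod (P w) \<le> cmod (P 0) + cmod w * (D * exp ((pi + e) * cmod w))" if w: "0 \<le> Im w" for w
    proof (rule norm_primitive_le[OF P])
      fix v assume "v \<in> closed_segment 0 w"
      then obtain t where t: "0 \<le> t" "t \<le> 1" "v = of_real t * w" "cmod v \<le> cmod w"
        by (rule segment_from_0)
      then have v: "0 \<le> Im v" using w by simp
      have "D * exp ((pi + e) * cmod v) \<le> D * exp ((pi + e) * cmod w)"
        using D0 e t(4) by (intro mult_left_mono) (auto intro: mult_left_mono)
      then show "cmod (f v) \<le> D * exp ((pi + e) * cmod w)" using D'[OF v] by linarith
    qed
    then show ?thesis using D0 by blast
  qed
  obtain D1 where D1: "D1 \<ge> 0" "\<And>w. 0 \<le> Im w \<Longrightarrow> cmod (P w) \<le> cmod (P 0) + cmod w * (D1 * exp ((pi + 1) * cmod w))"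
    using Pgr[of 1] by auto
  define A where "A = max (cmod (P 0) + D1) (pi + 2)"
  have A0: "A \<ge> 0" unfolding A_def using pi_gt_zero by (simp add: le_max_iff_disj)
  have "cmod (k z) \<le> 8 * C"
  proof (rule phragmen_lindelof_exp_type[where f = k])
    show "k analytic_on {z. 0 \<le> Im z}"
      unfolding k_def using nz Ph
      by (intro analytic_intros) (auto simp: analytic_on_open[symmetric] intro: analytic_on_subset)
    show "cmod (k (of_real x)) \<le> 8 * C" for x
    proof -
      have "1 + \<bar>x\<bar> \<le> 2 * cmod (of_real x + \<i>)" using ge1[of "of_real x"] by simp
      then have "(1 + \<bar>x\<bar>) ^ 3 \<le> (2 * cmod (of_real x + \<i>)) ^ 3" by (intro power_mono) auto
      then have "C * (1 + \<bar>x\<bar>) ^ 3 \<le> C * (2 * cmod (of_real x + \<i>)) ^ 3"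
        using C by (intro mult_left_mono) auto
      then have "cmod (P (of_real x)) \<le> 8 * C * cmod (of_real x + \<i>) ^ 3"
        using Preal[of x] by (simp add: power_mult_distrib)
      moreover have "cmod (of_real x + \<i>) ^ 3 > 0" using nz[of "of_real x"] by simp
      ultimately show ?thesis unfolding nk by (simp add: pos_divide_le_eq)
    qed
    show "8 * C > 0" using C by simp
    show "0 \<le> Im z" by fact
  next
    fix e :: real assume e: "e > 0"
    then have e2: "e / 2 > 0" by simp
    obtain D where D: "D \<ge> 0" "\<And>w. 0 \<le> Im w \<Longrightarrow> cmod (P w) \<le> cmod (P 0) + cmod w * (D * exp ((pi + e/2) * cmod w))"
      using Pgr[OF e2] by blast
    show "\<exists>C. \<forall>y\<ge>0. cmod (k (\<i> * of_real y)) \<le> C * exp (e * y)"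
    proof (intro exI allI impI)
      fix y :: real assume y: "y \<ge> 0"
      have "cmod (k (\<i> * of_real y)) \<le> cmod (P (\<i> * of_real y)) * exp (- pi * y)"
        using nk_le[of "\<i> * of_real y"] y by simp
      also have "\<dots> \<le> (cmod (P 0) + y * (D * exp ((pi + e/2) * y))) * exp (- pi * y)"
        using D(2)[of "\<i> * of_real y"] y by (intro mult_right_mono) (auto simp: norm_mult)
      also have "\<dots> = cmod (P 0) * exp (- pi * y) + y * (D * exp (e/2 * y))"
      proof -
        have "exp ((pi + e/2) * y) * exp (- pi * y) = exp (e/2 * y)"
          by (simp add: exp_add[symmetric] algebra_simps)
        then show ?thesis by (simp add: distrib_right mult.assoc)
      qed
      also have "\<dots> \<le> cmod (P 0) * exp (e * y) + (exp (e/2 * y) / (e/2)) * (D * exp (e/2 * y))"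
      proof -
        have "- pi \<le> e" using e pi_gt_zero by linarith
        then have "- pi * y \<le> e * y" using y by (rule mult_right_mono)
        then show ?thesis using D(1) e y by (intro add_mono mult_mono mult_left_mono le_exp_mult) auto
      qed
      also have "\<dots> = (cmod (P 0) + 2 * D / e) * exp (e * y)"
        by (simp add: exp_add[symmetric] ring_distribs)
      finally show "cmod (k (\<i> * of_real y)) \<le> (cmod (P 0) + 2 * D / e) * exp (e * y)" .
    qed
  next
    fix w :: complex assume w: "0 \<le> Im w"
    have "cmod (k w) \<le> cmod (P w) * exp (- pi * Im w)" by (rule nk_le[OF w])
    also have "\<dots> \<le> cmod (P w) * 1" using w by (intro mult_left_mono) auto
    also have "\<dots> \<le> cmod (P 0) + cmod w * (D1 * exp ((pi + 1) * cmod w))" using D1(2)[OF w] by simp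
    also have "\<dots> \<le> cmod (P 0) * exp ((pi + 2) * cmod w) + (exp (1 * cmod w) / 1) * (D1 * exp ((pi + 1) * cmod w))"
      using D1(1) by (intro add_mono mult_right_mono le_exp_mult) (auto simp: mult_le_cancel_left1)
    also have "\<dots> = (cmod (P 0) + D1) * exp ((pi + 2) * cmod w)"
      by (simp add: exp_add[symmetric] ring_distribs)
    also have "\<dots> \<le> A * exp (A * cmod w)"
      using D1(1) A0 by (intro mult_mono) (auto simp: A_def intro!: mult_right_mono)
    finally show "cmod (k w) \<le> A * exp (A * cmod w)" .
  qed
  then have "cmod (P z) * exp (- pi * Im z) \<le> 8 * C * cmod (z + \<i>) ^ 3"
    unfolding nk using nz[OF z] by (simp add: divide_le_eq)
  also have "\<dots> \<le> 8 * C * (1 + cmod z) ^ 3"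
    using C norm_triangle_ineq[of z "\<i>"] by (intro mult_left_mono power_mono) auto
  finally have "cmod (P z) * exp (- pi * Im z) * exp (pi * Im z) \<le> 8 * C * (1 + cmod z) ^ 3 * exp (pi * Im z)"
    by (intro mult_right_mono) auto
  then show ?thesis by (simp add: mult.assoc exp_add[symmetric])
qed

text \<open>The primitive \<open>P\<close> satisfies the bound in both half-planes, and Cauchy's inequality on discs of radius one
transfers it to \<open>f = P'\<close>.\<close>

lemma entire_growth:
  assumes f: "f holomorphic_on UNIV"
    and int: "integrable lborel (\<lambda>x. (cmod (f (of_real x)))\<^sup>2 / (1 + \<bar>x\<bar>\<^sup>2))"
    and upper: "\<And>e. e > 0 \<Longrightarrow> \<exists>C. \<forall>z. 0 < Im z \<longrightarrow> cmod (f z) \<le> C * exp ((pi + e) * cmod z)"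
    and lower: "\<And>e. e > 0 \<Longrightarrow> \<exists>C. \<forall>z. Im z < 0 \<longrightarrow> cmod (f z) \<le> C * exp ((pi + e) * cmod z)"
  obtains C where "C > 0" "\<And>z. cmod (f z) \<le> C * (1 + cmod z) ^ 3 * exp (pi * \<bar>Im z\<bar>)"
proof -
  obtain P where P: "\<And>z. (P has_field_derivative f z) (at z)"
    using holomorphic_convex_primitive'[OF convex_UNIV open_UNIV f] by auto
  have cont: "continuous_on UNIV (\<lambda>x::real. f (of_real x))"
    using holomorphic_on_imp_continuous_on[OF f]
    by (rule continuous_on_compose2) (auto intro!: continuous_intros)
  obtain C where C: "C > 0" "\<And>x. cmod (P (of_real x)) \<le> C * (1 + \<bar>x\<bar>) ^ 3"
    using primitive_cubic_bound[OF P cont int] by metis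
  have up: "cmod (P z) \<le> 8 * C * (1 + cmod z) ^ 3 * exp (pi * Im z)" if "0 \<le> Im z" for z
    by (rule primitive_growth_UHP[OF f P C(2,1) upper that])
  have low: "cmod (reflect P z) \<le> 8 * C * (1 + cmod z) ^ 3 * exp (pi * Im z)" if "0 \<le> Im z" for z
  proof (rule primitive_growth_UHP[OF reflect_holomorphic[OF f] reflect_has_field_derivative[OF P] _ C(1) _ that])
    show "cmod (reflect P (of_real x)) \<le> C * (1 + \<bar>x\<bar>) ^ 3" for x using C(2) by simp
    fix e :: real assume "e > 0"
    then obtain D where D: "\<And>z. Im z < 0 \<Longrightarrow> cmod (f z) \<le> D * exp ((pi + e) * cmod z)"
      using lower by blast
    have "cmod (reflect f z) \<le> D * exp ((pi + e) * cmod z)" if "0 < Im z" for z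
      using D[of "cnj z"] that by (simp add: norm_reflect)
    then show "\<exists>C. \<forall>z. 0 < Im z \<longrightarrow> cmod (reflect f z) \<le> C * exp ((pi + e) * cmod z)"
      by blast
  qed
  have Pb: "cmod (P z) \<le> 8 * C * (1 + cmod z) ^ 3 * exp (pi * \<bar>Im z\<bar>)" for z
    using up[of z] low[of "cnj z"] by (cases "0 \<le> Im z") (auto simp: reflect_def)
  have Ph: "P holomorphic_on A" for A
    using P by (auto simp: holomorphic_on_def field_differentiable_def intro: has_field_derivative_at_within)
  have "cmod (f z) \<le> (64 * C * exp pi) * (1 + cmod z) ^ 3 * exp (pi * \<bar>Im z\<bar>)" for z
  proof -
    have "cmod ((deriv ^^ 1) P z) \<le> fact 1 * (8 * C * (2 * (1 + cmod z)) ^ 3 * exp (pi * (\<bar>Im z\<bar> + 1))) / 1 ^ 1"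
    proof (rule Cauchy_inequality)
      show "P holomorphic_on ball z 1" "continuous_on (cball z 1) P"
        by (auto intro: Ph holomorphic_on_imp_continuous_on)
      fix w assume w: "cmod (z - w) = 1"
      have "cmod w \<le> cmod z + 1" using norm_triangle_sub[of w z] w by (simp add: norm_minus_commute)
      moreover have "\<bar>Im w\<bar> \<le> \<bar>Im z\<bar> + 1" using abs_Im_le_cmod[of "z - w"] w by auto
      ultimately have "8 * C * (1 + cmod w) ^ 3 * exp (pi * \<bar>Im w\<bar>)
         \<le> 8 * C * (2 * (1 + cmod z)) ^ 3 * exp (pi * (\<bar>Im z\<bar> + 1))"
        using C(1) norm_ge_zero[of z] norm_ge_zero[of w]
        by (intro mult_mono power_mono) (auto simp del: norm_ge_zero)
      then show "cmod (P w) \<le> 8 * C * (2 * (1 + cmod z)) ^ 3 * exp (pi * (\<bar>Im z\<bar> + 1))"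
        using Pb[of w] by linarith
    qed simp
    then have "cmod (f z) \<le> 8 * C * (2 * (1 + cmod z)) ^ 3 * exp (pi * (\<bar>Im z\<bar> + 1))"
      using DERIV_imp_deriv[OF P] by simp
    also have "8 * C * (2 * (1 + cmod z)) ^ 3 * exp (pi * (\<bar>Im z\<bar> + 1))
        = (64 * C * exp pi) * (1 + cmod z) ^ 3 * exp (pi * \<bar>Im z\<bar>)"
    proof -
      have "(2 * s) ^ 3 = 8 * s ^ 3" for s :: real by (simp add: power_mult_distrib)
      note cube = this[of "1 + cmod z"]
      have "exp (pi * (\<bar>Im z\<bar> + 1)) = exp pi * exp (pi * \<bar>Im z\<bar>)"
        by (simp add: exp_add[symmetric] algebra_simps)
      then show ?thesis unfolding cube by simp
    qed
    finally show ?thesis .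
  qed
  then show thesis using C(1) by (intro that[of "64 * C * exp pi"]) auto
qed

section \<open>Growth of the reciprocal\<close>

text \<open>On \<open>Im z > - d\<close> the function \<open>T = g exp(i\<pi>z) / (K (z + i m)\<^sup>3)\<close> has no zeros and modulus less than one,
so \<open>T = exp(- H)\<close> with \<open>Re H \<ge> 0\<close>. If \<open>Re H \<ge> e Im z\<close> held throughout the upper half-plane, then \<open>g\<close> would
have a type at most \<open>\<pi> - e\<close> there. Hence for each \<open>e > 0\<close> there is a point \<open>z0\<close> with
\<open>Re H(z0) < e Im z0\<close>, and Harnack's inequality spreads this to \<open>Re H(z) \<le> e (\<bar>z\<bar> + k)\<^sup>2 / (Im z + d)\<close>. The
half-plane being larger than \<open>Im z \<ge> 0\<close> keeps this finite up to the real line.\<close>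

lemma reciprocal_growth:
  assumes g: "g holomorphic_on UNIV" and d: "d > 0"
    and nz: "\<And>z. - d < Im z \<Longrightarrow> g z \<noteq> 0"
    and C: "C > 0" and gb: "\<And>z. cmod (g z) \<le> C * (1 + cmod z) ^ 3 * exp (pi * \<bar>Im z\<bar>)"
    and sharp: "\<And>a C. a \<ge> 0 \<Longrightarrow> a < pi \<Longrightarrow>
       \<exists>z. 0 < Im z \<and> C * (1 + cmod z) ^ 3 * exp (a * Im z) < cmod (g z)"
  shows "pl_growth (\<lambda>z. 1 / (g z * exp (\<i> * of_real pi * z)))"
proof -
  \<comment> \<open>With this shift, \<open>z + i m\<close> has modulus at least one on the half-plane \<open>U\<close>.\<close>
  define m where "m = d + 1"
  define K where "K = exp 1 * (C * (2 + m) ^ 3 * exp (2 * pi * d))"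
  have K: "K > 0" using C d by (simp add: K_def m_def)
  define U where "U = {z. - d < Im z}"
  define q where "q z = z + \<i> * of_real m" for z :: complex
  define E where "E z = g z * exp (\<i> * of_real pi * z)" for z
  define T where "T z = E z / (of_real K * q z ^ 3)" for z
  have q1: "1 \<le> cmod (q z)" "1 + cmod z \<le> (2 + m) * cmod (q z)" if "z \<in> U" for z
  proof -
    have "1 \<le> Im (q z)" using that by (simp add: U_def q_def m_def)
    also have "\<dots> \<le> cmod (q z)" using abs_Im_le_cmod[of "q z"] by linarith
    finally show 1: "1 \<le> cmod (q z)" .
    have "cmod z \<le> cmod (q z) + cmod (\<i> * of_real m)"
      using norm_triangle_ineq4[of "q z" "\<i> * of_real m"] by (simp add: q_def)
    moreover have "cmod (\<i> * of_real m) = m" using d by (simp add: norm_mult m_def)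
    moreover have "m * 1 \<le> m * cmod (q z)" using 1 d by (intro mult_left_mono) (auto simp: m_def)
    ultimately have "1 + cmod z \<le> cmod (q z) + cmod (q z) + m * cmod (q z)"
      using 1 by linarith
    then show "1 + cmod z \<le> (2 + m) * cmod (q z)" by (simp add: algebra_simps)
  qed
  have nE: "cmod (E z) = cmod (g z) * exp (- pi * Im z)" for z
    by (simp add: E_def norm_mult)
  have nT: "cmod (T z) = cmod (E z) / (K * cmod (q z) ^ 3)" for z
    using K by (simp add: T_def norm_divide norm_mult norm_power)
  have Tnz: "T z \<noteq> 0" if "z \<in> U" for z
    using nz[of z] that K q1(1)[OF that] by (auto simp: T_def E_def U_def)
  have qpos: "cmod (q z) ^ 3 > 0" if "z \<in> U" for z using q1(1)[OF that] by (intro zero_less_power) linarith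
  have Eb: "cmod (E z) \<le> K / exp 1 * cmod (q z) ^ 3" if z: "z \<in> U" for z
  proof -
    have "cmod (E z) \<le> C * (1 + cmod z) ^ 3 * exp (pi * \<bar>Im z\<bar>) * exp (- pi * Im z)"
      unfolding nE by (intro mult_right_mono gb) auto
    also have "\<dots> = C * (1 + cmod z) ^ 3 * exp (pi * (\<bar>Im z\<bar> - Im z))"
      by (simp add: exp_add[symmetric] algebra_simps)
    also have "\<dots> \<le> C * ((2 + m) * cmod (q z)) ^ 3 * exp (pi * (2 * d))"
      using C q1(2)[OF z] z d by (intro mult_mono power_mono) (auto simp: U_def m_def)
    also have "\<dots> = K / exp 1 * cmod (q z) ^ 3"
      by (simp add: K_def power_mult_distrib mult_ac)
    finally show ?thesis .
  qed
  have Tb: "cmod (T z) \<le> exp (- 1)" if z: "z \<in> U" for z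
    unfolding nT using Eb[OF z] K qpos[OF z] by (simp add: exp_minus field_simps)
  have "q z \<noteq> 0" if "z \<in> U" for z using q1(1)[OF that] by auto
  then have Th: "T holomorphic_on U"
    unfolding T_def E_def q_def using K
    by (intro holomorphic_intros holomorphic_on_subset[OF g]) (auto simp: q_def)
  have "convex U" unfolding U_def by (rule convex_halfspace_Im_gt)
  then obtain L where L: "L holomorphic_on U" "\<And>z. z \<in> U \<Longrightarrow> T z = exp (L z)"
    using contractible_imp_holomorphic_log[OF Th convex_imp_contractible Tnz] by auto
  define H where "H = (\<lambda>z. - L z)"
  have Hh: "H holomorphic_on U" unfolding H_def by (intro holomorphic_intros L)
  have TH: "cmod (T z) = exp (- Re (H z))" if "z \<in> U" for z using L(2)[OF that] by (simp add: H_def)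
  have H1: "0 \<le> Re (H z)" if "z \<in> U" for z
    using Tb[OF that] unfolding TH[OF that] by simp
  have small: "\<exists>z0. 0 < Im z0 \<and> Re (H z0) < e * Im z0" if e: "0 < e" "e \<le> 1" for e
  proof (rule ccontr)
    assume "\<not> ?thesis"
    then have neg: "\<And>z. 0 < Im z \<Longrightarrow> e * Im z \<le> Re (H z)" by (meson not_less)
    have "cmod (g z) \<le> (K * (1 + m) ^ 3) * (1 + cmod z) ^ 3 * exp ((pi - e) * Im z)" if z: "0 < Im z" for z
    proof -
      have zU: "z \<in> U" using z d by (simp add: U_def)
      have "cmod (E z) = cmod (T z) * (K * cmod (q z) ^ 3)" using nT[of z] K qpos[OF zU] by simp
      also have "\<dots> \<le> exp (- e * Im z) * (K * ((1 + m) * (1 + cmod z)) ^ 3)"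
      proof (intro mult_mono power_mono)
        show "cmod (T z) \<le> exp (- e * Im z)" using TH[OF zU] neg[OF z] by simp
        have "cmod (q z) \<le> cmod z + m" using norm_triangle_ineq[of z "\<i> * of_real m"] d
          by (simp add: q_def norm_mult m_def)
        also have "\<dots> \<le> (1 + m) * (1 + cmod z)" using d by (simp add: m_def algebra_simps)
        finally show "cmod (q z) \<le> (1 + m) * (1 + cmod z)" .
      qed (use K in auto)
      finally have Ele: "cmod (E z) \<le> exp (- e * Im z) * (K * ((1 + m) * (1 + cmod z)) ^ 3)" .
      have "cmod (g z) = cmod (E z) * exp (pi * Im z)"
        unfolding nE by (simp add: mult.assoc exp_add[symmetric])
      also have "\<dots> \<le> exp (- e * Im z) * (K * ((1 + m) * (1 + cmod z)) ^ 3) * exp (pi * Im z)"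
        by (intro mult_right_mono Ele) auto
      also have "\<dots> = (K * (1 + m) ^ 3) * (1 + cmod z) ^ 3 * (exp (- e * Im z) * exp (pi * Im z))"
        by (simp only: power_mult_distrib mult_ac)
      also have "exp (- e * Im z) * exp (pi * Im z) = exp ((pi - e) * Im z)"
        by (simp add: exp_add[symmetric] algebra_simps)
      finally show ?thesis .
    qed
    moreover have "0 \<le> pi - e" "pi - e < pi" using e pi_ge_two by auto
    ultimately show False using sharp[of "pi - e" "K * (1 + m) ^ 3"] by (meson not_less)
  qed
  have harnack: "\<exists>k\<ge>0. \<forall>z\<in>U. Re (H z) \<le> e * (cmod z + k)\<^sup>2 / (Im z + d)" if e: "0 < e" "e \<le> 1" for e
  proof -
    obtain z0 where z0: "0 < Im z0" "Re (H z0) < e * Im z0" using small[OF e] by blast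
    define z1 where "z1 = cnj z0 - 2 * \<i> * of_real d"
    have "Re (H z) \<le> e * (cmod z + cmod z1)\<^sup>2 / (Im z + d)" if z: "z \<in> U" for z
    proof -
      have pos: "0 < Im z + d" "0 < Im z0 + d" using z z0 d by (auto simp: U_def)
      have "Re (H z) \<le> Re (H z0) * (cmod (z - z1))\<^sup>2 / ((Im z + d) * (Im z0 + d))"
        unfolding z1_def
        by (rule harnack_half_plane) (use Hh H1 z z0 d in \<open>auto simp: U_def\<close>)
      also have "\<dots> \<le> (e * (Im z0 + d)) * (cmod z + cmod z1)\<^sup>2 / ((Im z + d) * (Im z0 + d))"
      proof (intro divide_right_mono mult_mono power_mono)
        show "Re (H z0) \<le> e * (Im z0 + d)" using z0 e d by (simp add: distrib_left add_increasing2 less_imp_le)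
        show "cmod (z - z1) \<le> cmod z + cmod z1" by (rule norm_triangle_ineq4)
      qed (use e pos in auto)
      also have "\<dots> = e * (cmod z + cmod z1)\<^sup>2 / (Im z + d)" using pos by simp
      finally show ?thesis .
    qed
    then show ?thesis by (intro exI[of _ "cmod z1"]) auto
  qed
  have recip: "cmod (1 / E z) \<le> (1 / K) * exp (Re (H z))" if z: "z \<in> U" for z
  proof -
    have "cmod (1 / E z) = (1 / K) * exp (Re (H z)) / cmod (q z) ^ 3"
      using nT[of z] TH[OF z] K qpos[OF z]
      by (simp add: norm_divide exp_minus field_simps)
    also have "\<dots> \<le> (1 / K) * exp (Re (H z)) / 1"
      using K one_le_power[OF q1(1)[OF z], of 3] by (intro divide_left_mono) auto
    finally show ?thesis by simp
  qed
  have square: "(r + k)\<^sup>2 \<le> 2 * r\<^sup>2 + 2 * k\<^sup>2" for r k :: real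
    using zero_le_power2[of "r - k"] by (simp add: power2_eq_square algebra_simps)
  have "pl_growth (\<lambda>z. 1 / E z)"
  proof (rule pl_growthI)
    obtain k where k: "k \<ge> 0" "\<And>z. z \<in> U \<Longrightarrow> Re (H z) \<le> 1 * (cmod z + k)\<^sup>2 / (Im z + d)"
      using harnack[of 1] by auto
    have "cmod (1 / E z) \<le> (1 / K * exp (2 * k\<^sup>2 / d)) * exp ((2 / d) * (cmod z)\<^sup>2)" if z: "0 \<le> Im z" for z
    proof -
      have zU: "z \<in> U" using z d by (simp add: U_def)
      have "Re (H z) \<le> 1 * (cmod z + k)\<^sup>2 / (Im z + d)" by (rule k(2)[OF zU])
      also have "\<dots> \<le> (2 * (cmod z)\<^sup>2 + 2 * k\<^sup>2) / d"
        using square[of "cmod z" k] z d by (intro frac_le) auto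
      finally have "Re (H z) \<le> 2 * k\<^sup>2 / d + (2 / d) * (cmod z)\<^sup>2" by (simp add: add_divide_distrib)
      then have "(1 / K) * exp (Re (H z)) \<le> (1 / K) * exp (2 * k\<^sup>2 / d + (2 / d) * (cmod z)\<^sup>2)"
        using K by (intro mult_left_mono) auto
      then show ?thesis using recip[OF zU] by (simp add: exp_add)
    qed
    then show "\<exists>A B. \<forall>z. 0 \<le> Im z \<longrightarrow> cmod (1 / E z) \<le> A * exp (B * (cmod z)\<^sup>2)" by blast
  next
    fix e :: real assume e: "e > 0"
    define e' where "e' = min 1 (e / 4)"
    have e': "0 < e'" "e' \<le> 1" "4 * e' \<le> e" using e by (auto simp: e'_def)
    obtain k where k: "k \<ge> 0" "\<And>z. z \<in> U \<Longrightarrow> Re (H z) \<le> e' * (cmod z + k)\<^sup>2 / (Im z + d)"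
      using harnack[OF e'(1,2)] by auto
    have "cmod (1 / E z) \<le> (1 / K * exp (2 * k\<^sup>2 / d)) * exp (e * cmod z)" if z: "\<bar>Re z\<bar> \<le> Im z" for z
    proof -
      have zU: "z \<in> U" and z0: "0 \<le> Im z" using z d by (auto simp: U_def)
      have "\<bar>Im z\<bar> = Im z" using z0 by simp
      then have "cmod z \<le> 2 * Im z" using cmod_le[of z] z by linarith
      then have le: "cmod z \<le> 2 * (Im z + d)" using d by simp
      have pos: "Im z + d > 0" using z0 d by linarith
      have "Re (H z) \<le> e' * (cmod z + k)\<^sup>2 / (Im z + d)" by (rule k(2)[OF zU])
      also have "\<dots> \<le> e' * (2 * (cmod z)\<^sup>2 + 2 * k\<^sup>2) / (Im z + d)"
        using square[of "cmod z" k] pos e' by (intro divide_right_mono mult_left_mono) auto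
      also have "\<dots> = e' * (2 * (cmod z)\<^sup>2 / (Im z + d)) + e' * (2 * k\<^sup>2 / (Im z + d))"
        by (simp add: add_divide_distrib ring_distribs)
      also have "\<dots> \<le> e' * (4 * cmod z) + 1 * (2 * k\<^sup>2 / d)"
      proof (intro add_mono mult_mono mult_left_mono)
        have "2 * (cmod z)\<^sup>2 \<le> 4 * cmod z * (Im z + d)"
          using mult_left_mono[OF le, of "2 * cmod z"] by (simp add: power2_eq_square mult_ac)
        then show "2 * (cmod z)\<^sup>2 / (Im z + d) \<le> 4 * cmod z" using pos by (simp add: pos_divide_le_eq)
        show "2 * k\<^sup>2 / (Im z + d) \<le> 2 * k\<^sup>2 / d" using z0 d by (intro frac_le) auto
      qed (use e' pos in auto)
      also have "e' * (4 * cmod z) \<le> e * cmod z"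
        using mult_right_mono[OF e'(3), of "cmod z"] by (simp add: mult_ac)
      finally have "Re (H z) \<le> 2 * k\<^sup>2 / d + e * cmod z" by simp
      then have "(1 / K) * exp (Re (H z)) \<le> (1 / K) * exp (2 * k\<^sup>2 / d + e * cmod z)"
        using K by (intro mult_left_mono) auto
      then show ?thesis using recip[OF zU] by (simp add: exp_add)
    qed
    then show "\<exists>C. \<forall>z. \<bar>Re z\<bar> \<le> Im z \<longrightarrow> cmod (1 / E z) \<le> C * exp (e * cmod z)" by blast
  qed
  then show ?thesis by (simp add: E_def)
qed

section \<open>Cauchy's formula in the upper half-plane\<close>

lemma inverse_distance_bound:
  assumes "Im z \<noteq> 0" "cmod z \<le> r"
  shows "1 / cmod (of_real x - z) \<le> (1 + 2 * r) / \<bar>Im z\<bar> / (1 + \<bar>x\<bar>)"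
proof -
  define D where "D = cmod (of_real x - z)"
  have r: "r \<ge> 0" using assms(2) norm_ge_zero[of z] by linarith
  have yD: "\<bar>Im z\<bar> \<le> D" using abs_Im_le_cmod[of "of_real x - z"] by (simp add: D_def)
  have y: "\<bar>Im z\<bar> > 0" using assms by simp
  have yr: "\<bar>Im z\<bar> \<le> r" using abs_Im_le_cmod[of z] assms by linarith
  have "\<bar>x\<bar> \<le> D + r" using norm_triangle_sub[of "of_real x" z] assms(2) by (simp add: D_def)
  then have "\<bar>Im z\<bar> * (1 + \<bar>x\<bar>) \<le> \<bar>Im z\<bar> * (1 + r) + \<bar>Im z\<bar> * D"
    using y by (simp add: distrib_left[symmetric] mult_left_mono)
  also have "\<dots> \<le> D * (1 + r) + r * D"
    using yD yr y r by (intro add_mono mult_right_mono) auto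
  also have "\<dots> = (1 + 2 * r) * D" by (simp add: algebra_simps)
  finally have "\<bar>Im z\<bar> * (1 + \<bar>x\<bar>) \<le> (1 + 2 * r) * D" .
  moreover have "D > 0" using yD y by linarith
  ultimately show ?thesis unfolding D_def[symmetric] using y
    by (simp add: divide_simps mult_ac)
qed

lemma cauchy_kernel_integrable:
  fixes f :: "real \<Rightarrow> complex"
  assumes fm: "f \<in> borel_measurable borel" and int: "integrable lborel (\<lambda>x. cmod (f x) / (1 + \<bar>x\<bar>))"
    and z: "Im z \<noteq> 0"
  shows "integrable lborel (\<lambda>x. f x / (of_real x - z))"
proof (rule Bochner_Integration.integrable_bound)
  show "integrable lborel (\<lambda>x. (1 + 2 * cmod z) / \<bar>Im z\<bar> * (cmod (f x) / (1 + \<bar>x\<bar>)))"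
    by (intro integrable_mult_right int)
  have "cmod (f x / (of_real x - z)) \<le> (1 + 2 * cmod z) / \<bar>Im z\<bar> * (cmod (f x) / (1 + \<bar>x\<bar>))" for x
  proof -
    have "cmod (f x) * (1 / cmod (of_real x - z)) \<le> cmod (f x) * ((1 + 2 * cmod z) / \<bar>Im z\<bar> / (1 + \<bar>x\<bar>))"
      by (intro mult_left_mono inverse_distance_bound z) auto
    then show ?thesis by (simp add: norm_divide mult_ac)
  qed
  then show "AE x in lborel. norm (f x / (of_real x - z)) \<le> norm ((1 + 2 * cmod z) / \<bar>Im z\<bar> * (cmod (f x) / (1 + \<bar>x\<bar>)))"
    by (auto intro!: AE_I2 order_trans[OF _ abs_ge_self])
  show "(\<lambda>x. f x / (of_real x - z)) \<in> borel_measurable lborel"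
    using fm by simp
qed

lemma integral_symmetric_tendsto:
  fixes f :: "real \<Rightarrow> complex"
  assumes "integrable lborel f"
  shows "(\<lambda>n. integral {- real n..real n} f) \<longlonglongrightarrow> (LINT x|lborel. f x)"
proof (rule LIMSEQ_I)
  fix e :: real assume e: "e > 0"
  have "(f has_integral (LINT x|lborel. f x)) UNIV" by (rule has_integral_integral_lborel[OF assms])
  then obtain B where B: "B > 0"
    "\<And>a b. ball 0 B \<subseteq> cbox a b \<Longrightarrow> norm (integral (cbox a b) (\<lambda>x. if x \<in> UNIV then f x else 0) - (LINT x|lborel. f x)) < e"
    unfolding has_integral_alt' using e by meson
  obtain N where N: "B \<le> real N" using real_arch_simple by blast
  show "\<exists>N. \<forall>n\<ge>N. norm (integral {- real n..real n} f - (LINT x|lborel. f x)) < e"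
  proof (intro exI allI impI)
    fix n assume n: "n \<ge> N"
    have "ball 0 B \<subseteq> cbox (- real n) (real n)" using n N by (auto simp: abs_less_iff)
    then show "norm (integral {- real n..real n} f - (LINT x|lborel. f x)) < e"
      using B(2)[of "- real n" "real n"] by simp
  qed
qed

lemma upper_arc:
  assumes "w \<in> path_image (part_circlepath 0 R 0 pi)" "R > 0"
  shows "cmod w = R" "0 \<le> Im w"
proof -
  obtain t where "w = of_real R * exp (\<i> * of_real t)" "0 \<le> t" "t \<le> pi"
    using assms path_image_part_circlepath[of 0 pi 0 R] by auto
  then show "cmod w = R" "0 \<le> Im w" using assms(2) sin_ge_zero[of t]
    by (simp_all add: norm_mult Im_exp)
qed

text \<open>Integration by parts: \<open>f / (w - z)\<close> differs from \<open>P / (w - z)\<^sup>2\<close> by the derivative of \<open>P / (w - z)\<close>. So a bound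
for the primitive \<open>P\<close> suffices, while \<open>f\<close> itself may be large where the arc meets the real line.\<close>

lemma upper_arc_integral_bound:
  assumes P: "\<And>w. 0 \<le> Im w \<Longrightarrow> (P has_field_derivative f w) (at w)"
    and R: "cmod z < R" and B: "\<And>w. cmod w = R \<Longrightarrow> 0 \<le> Im w \<Longrightarrow> cmod (P w) \<le> B"
  shows "cmod (contour_integral (part_circlepath 0 R 0 pi) (\<lambda>w. f w / (w - z)))
     \<le> 2 * B / (R - cmod z) + B / (R - cmod z)\<^sup>2 * R * pi"
proof -
  define A where "A = part_circlepath 0 R 0 pi"
  define S where "S = {w. cmod w = R \<and> 0 \<le> Im w}"
  have R0: "R > 0" using R norm_ge_zero[of z] by linarith
  have B0: "B \<ge> 0" using B[of "of_real R"] R0 norm_ge_zero[of "P (of_real R)"] by (simp del: norm_ge_zero)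
  have im: "path_image A \<subseteq> S" using upper_arc R0 by (auto simp: A_def S_def)
  have dist: "R - cmod z \<le> cmod (w - z)" if "w \<in> S" for w
    using that norm_triangle_ineq2[of w z] by (simp add: S_def)
  have ne: "w \<noteq> z" if "w \<in> S" for w using that R by (auto simp: S_def)
  define Q where "Q w = P w / (w - z)" for w
  define k where "k w = P w / (w - z)\<^sup>2" for w
  have "((\<lambda>w. f w / (w - z) - k w) has_contour_integral (Q (pathfinish A) - Q (pathstart A))) A"
  proof (rule contour_integral_primitive[OF _ _ im])
    fix w assume w: "w \<in> S"
    have "(Q has_field_derivative (f w * (w - z) - P w * 1) / ((w - z) * (w - z))) (at w)"
      unfolding Q_def using w ne[OF w]
      by (intro DERIV_divide P derivative_eq_intros) (auto simp: S_def)
    moreover have "(f w * (w - z) - P w * 1) / ((w - z) * (w - z)) = f w / (w - z) - k w"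
      using ne[OF w] by (simp add: k_def power2_eq_square diff_divide_distrib)
    ultimately show "(Q has_field_derivative f w / (w - z) - k w) (at w within S)"
      by (simp add: has_field_derivative_at_within)
  qed (simp add: A_def)
  moreover have kc: "continuous_on (path_image A) k"
    unfolding k_def using ne im P
    by (intro continuous_intros continuous_at_imp_continuous_on ballI DERIV_isCont[OF P]) (auto simp: S_def)
  then have "(k has_contour_integral contour_integral A k) A"
    unfolding A_def by (intro has_contour_integral_integral contour_integrable_continuous_part_circlepath)
  ultimately have "((\<lambda>w. (f w / (w - z) - k w) + k w) has_contour_integral
      (Q (pathfinish A) - Q (pathstart A)) + contour_integral A k) A"
    by (rule has_contour_integral_add)
  then have eq: "contour_integral A (\<lambda>w. f w / (w - z)) = (Q (pathfinish A) - Q (pathstart A)) + contour_integral A k"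
    by (simp add: contour_integral_unique)
  have Qb: "cmod (Q w) \<le> B / (R - cmod z)" if w: "w \<in> S" for w
    unfolding Q_def norm_divide using R dist[OF w] B w B0 by (intro frac_le) (auto simp: S_def)
  have "pathfinish A \<in> S" "pathstart A \<in> S" using R0 by (auto simp: A_def S_def)
  then have "cmod (Q (pathfinish A) - Q (pathstart A)) \<le> B / (R - cmod z) + B / (R - cmod z)"
    using norm_triangle_ineq4[of "Q (pathfinish A)" "Q (pathstart A)"] Qb by (meson add_mono order_trans)
  moreover have "cmod (contour_integral A k) \<le> B / (R - cmod z)\<^sup>2 * R * (pi - 0)"
  proof (rule has_contour_integral_bound_part_circlepath_strong)
    show "(k has_contour_integral contour_integral A k) (part_circlepath 0 R 0 pi)"
      using kc unfolding A_def by (intro has_contour_integral_integral contour_integrable_continuous_part_circlepath)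
    fix w assume "w \<in> path_image (part_circlepath 0 R 0 pi) - {}"
    then have w: "w \<in> S" using im by (auto simp: A_def)
    show "cmod (k w) \<le> B / (R - cmod z)\<^sup>2"
      unfolding k_def norm_divide norm_power
      using R dist[OF w] B w B0 by (intro frac_le power_mono) (auto simp: S_def)
  qed (use B0 R0 in auto)
  ultimately show ?thesis
    unfolding A_def[symmetric] eq using norm_triangle_ineq[of "Q (pathfinish A) - Q (pathstart A)" "contour_integral A k"]
    by simp
qed

lemma half_disc_integral_zero:
  assumes h: "h holomorphic_on {w. - d < Im w}" and d: "d > 0" and R: "R > 0"
  shows "integral {-R..R} (\<lambda>x. h (of_real x)) + contour_integral (part_circlepath 0 R 0 pi) h = 0"
proof -
  define A where "A = part_circlepath 0 R 0 pi"
  define L where "L = linepath (- of_real R) (of_real R :: complex)"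
  have hc: "continuous_on {w. - d < Im w} h" by (rule holomorphic_on_imp_continuous_on[OF h])
  have imL: "path_image L \<subseteq> {w. - d < Im w}"
  proof -
    have "closed_segment (- of_real R) (of_real R) \<subseteq> {w. - d < Im w}"
      using d by (intro closed_segment_subset convex_halfspace_Im_gt) auto
    then show ?thesis by (simp add: L_def)
  qed
  have imA: "path_image A \<subseteq> {w. - d < Im w}" using upper_arc(2)[OF _ R] d by (force simp: A_def)
  have iL: "h contour_integrable_on L" unfolding L_def
    by (intro contour_integrable_continuous_linepath continuous_on_subset[OF hc]) (use imL in \<open>simp add: L_def\<close>)
  have iA: "h contour_integrable_on A" unfolding A_def
    by (intro contour_integrable_continuous_part_circlepath continuous_on_subset[OF hc]) (use imA in \<open>simp add: A_def\<close>)
  have "(h has_contour_integral 0) (L +++ A)"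
  proof (rule Cauchy_theorem_convex_simple[OF h])
    show "convex {w. - d < Im w}" by (rule convex_halfspace_Im_gt)
    show "path_image (L +++ A) \<subseteq> {w. - d < Im w}"
      using imL imA by (intro subset_path_image_join) auto
    show "valid_path (L +++ A)" by (simp add: L_def A_def valid_path_join)
    show "pathfinish (L +++ A) = pathstart (L +++ A)" by (simp add: L_def A_def)
  qed
  then have "contour_integral (L +++ A) h = 0" by (rule contour_integral_unique)
  then have "contour_integral L h + contour_integral A h = 0"
    using iL iA by (simp add: L_def A_def)
  moreover have "contour_integral L h = integral {-R..R} (\<lambda>x. h (of_real x))"
    unfolding L_def using R contour_integral_linepath_Reals_eq[of "- of_real R" "of_real R" h] by simp
  ultimately show ?thesis by (simp add: A_def)
qed

text \<open>By the Phragmen-Lindelof principle \<open>P / (z + i)\<close> is bounded; on the real line it tends to zero. To carry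
the decay into the half-plane, multiply by \<open>z / (z + i N)\<close>: this factor has modulus at most one, and for
large \<open>N\<close> it is small on the bounded part of the real line where \<open>P / (z + i)\<close> is not yet small.\<close>

lemma primitive_little_o_UHP:
  assumes P: "\<And>w. 0 \<le> Im w \<Longrightarrow> (P has_field_derivative f w) (at w)"
    and Pan: "P analytic_on {z. 0 \<le> Im z}" and fc: "continuous_on UNIV (\<lambda>x::real. f (of_real x))"
    and gr: "pl_growth f"
    and int: "integrable lborel (\<lambda>x. cmod (f (of_real x)) / (1 + \<bar>x\<bar>))" and e: "e > 0"
  obtains r where "\<And>z. 0 \<le> Im z \<Longrightarrow> r \<le> cmod z \<Longrightarrow> cmod (P z) \<le> e * cmod z"
proof -
  have Pr: "(P has_field_derivative f (of_real x)) (at (of_real x))" for x :: real by (rule P) simp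
  have ge: "cmod z \<le> cmod (z + \<i>)" "1 \<le> cmod (z + \<i>)" if "0 \<le> Im z" for z
    using UHP_norm_ge[OF that, of 1] by auto
  have ge2: "1 + \<bar>x\<bar> \<le> 2 * cmod (of_real x + \<i>)" for x using ge[of "of_real x"] by simp
  define psi where "psi z = P z * (1 / (z + \<i>))" for z
  have npsi: "cmod (psi z) = cmod (P z) / cmod (z + \<i>)" for z by (simp add: psi_def norm_divide)
  have nz: "z + \<i> \<noteq> 0" if "0 \<le> Im z" for z using ge(2)[OF that] by auto
  have psi_an: "psi analytic_on {z. 0 \<le> Im z}"
    unfolding psi_def using nz by (intro analytic_intros Pan) auto
  have psi_gr: "pl_growth psi"
    unfolding psi_def
  proof (rule pl_growth_mult)
    show "pl_growth P" by (rule pl_growth_primitive[OF P gr])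
    show "pl_growth (\<lambda>z. 1 / (z + \<i>))"
    proof (rule pl_growth_poly[of _ 1 0])
      fix z assume "0 \<le> Im z"
      then show "cmod (1 / (z + \<i>)) \<le> 1 * (1 + cmod z) ^ 0"
        using ge(2)[of z] by (simp add: norm_divide divide_le_eq)
    qed
  qed
  have psi_small: "cmod (psi (of_real x)) \<le> 2 * c" if "cmod (P (of_real x)) \<le> c * (1 + \<bar>x\<bar>)" for c x
  proof -
    have "0 \<le> c * (1 + \<bar>x\<bar>)" using that norm_ge_zero order_trans by blast
    then have "c \<ge> 0" by (auto simp: zero_le_mult_iff)
    then have "cmod (P (of_real x)) \<le> c * (2 * cmod (of_real x + \<i>))"
      using that mult_left_mono[OF ge2[of x], of c] by linarith
    moreover have "cmod (of_real x + \<i>) > 0"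
      by (rule less_le_trans[OF zero_less_one ge(2)]) simp
    ultimately show ?thesis unfolding npsi by (simp add: pos_divide_le_eq mult_ac)
  qed
  obtain X1 where X1: "\<And>x. \<bar>x\<bar> \<ge> X1 \<Longrightarrow> cmod (P (of_real x)) \<le> 1 * (1 + \<bar>x\<bar>)"
    using primitive_little_o[OF Pr fc int, of 1] by auto
  have "compact ((\<lambda>x::real. psi (of_real x)) ` {-\<bar>X1\<bar>..\<bar>X1\<bar>})"
    by (intro compact_continuous_image continuous_on_compose2[OF analytic_UHP_continuous[OF psi_an order_refl]])
       (auto intro!: continuous_intros)
  then obtain B1 where B1: "\<And>x. x \<in> {-\<bar>X1\<bar>..\<bar>X1\<bar>} \<Longrightarrow> cmod (psi (of_real x)) \<le> B1"
    using compact_imp_bounded by (force simp: bounded_iff)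
  define M where "M = 2 + \<bar>B1\<bar>"
  have M: "M > 0" by (simp add: M_def)
  have real: "cmod (psi (of_real x)) \<le> M" for x
  proof (cases "\<bar>x\<bar> \<ge> X1")
    case True
    then show ?thesis using psi_small[OF X1] by (simp add: M_def add_increasing2)
  next
    case False
    then have "x \<in> {-\<bar>X1\<bar>..\<bar>X1\<bar>}" by (auto simp: abs_le_iff)
    then show ?thesis using B1[of x] by (simp add: M_def)
  qed
  have bdd: "cmod (psi z) \<le> M" if "0 \<le> Im z" for z
    by (rule phragmen_lindelof_half_plane[OF psi_an real psi_gr M that])
  obtain X where X: "\<And>x. \<bar>x\<bar> \<ge> X \<Longrightarrow> cmod (P (of_real x)) \<le> (e / 4) * (1 + \<bar>x\<bar>)"
    using primitive_little_o[OF Pr fc int, of "e / 4"] e by auto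
  \<comment> \<open>On \<open>\<bar>x\<bar> \<le> \<bar>X\<bar>\<close> the factor \<open>x / (x + i N)\<close> is at most \<open>\<bar>X\<bar> / N\<close>, which brings the bound \<open>M\<close> down to \<open>e / 2\<close>.\<close>
  define N where "N = M * \<bar>X\<bar> / (e / 2) + 1"
  have N: "N \<ge> 1" using M e by (simp add: N_def)
  define chi where "chi z = psi z * (z / (z + \<i> * of_real N))" for z
  have nzN: "z + \<i> * of_real N \<noteq> 0" if "0 \<le> Im z" for z
    using UHP_norm_ge(2)[OF that, of N] N by auto
  have frac1: "cmod (z / (z + \<i> * of_real N)) \<le> 1" if "0 \<le> Im z" for z
    using UHP_norm_ge(1)[OF that, of N] nzN[OF that] N by (simp add: norm_divide divide_le_eq)
  have chi: "cmod (chi z) \<le> e / 2" if z: "0 \<le> Im z" for z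
  proof (rule phragmen_lindelof_bounded[where f = chi and B = M])
    show "chi analytic_on {z. 0 \<le> Im z}"
      unfolding chi_def using nzN by (intro analytic_intros psi_an) auto
    show "cmod (chi w) \<le> M" if "0 \<le> Im w" for w
      using mult_mono[OF bdd[OF that] frac1[OF that]] M by (simp add: chi_def norm_mult del: times_divide_eq_right)
    show "cmod (chi (of_real x)) \<le> e / 2" for x
    proof (cases "\<bar>x\<bar> \<ge> X")
      case True
      have "cmod (psi (of_real x)) \<le> e / 2" using psi_small[OF X[OF True]] by simp
      then have "cmod (psi (of_real x)) * cmod (of_real x / (of_real x + \<i> * of_real N)) \<le> e / 2 * 1"
        using frac1[of "of_real x"] e by (intro mult_mono) auto
      then show ?thesis by (simp add: chi_def norm_mult del: times_divide_eq_right)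
    next
      case False
      have "cmod (of_real x / (of_real x + \<i> * of_real N)) \<le> \<bar>X\<bar> / N"
        unfolding norm_divide using UHP_norm_ge(2)[of "of_real x" N] N False by (intro frac_le) auto
      then have "cmod (psi (of_real x)) * cmod (of_real x / (of_real x + \<i> * of_real N)) \<le> M * (\<bar>X\<bar> / N)"
        using real M by (intro mult_mono) auto
      also have "\<dots> \<le> e / 2"
      proof -
        have "M * \<bar>X\<bar> \<le> e / 2 * N" using e by (simp add: N_def distrib_left)
        then show ?thesis using N by (simp add: pos_divide_le_eq)
      qed
      finally show ?thesis by (simp add: chi_def norm_mult del: times_divide_eq_right)
    qed
  qed (use e z in auto)
  show thesis
  proof (rule that[of "1 + 2 * N"])
    fix z assume z: "0 \<le> Im z" "1 + 2 * N \<le> cmod z"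
    define r where "r = cmod z"
    have r: "r \<ge> 1" "r \<ge> 1 + 2 * N" using z N by (auto simp: r_def)
    have "z \<noteq> 0" using r by (auto simp: r_def)
    have "P z * z = chi z * (z + \<i>) * (z + \<i> * of_real N)"
      using nz[OF z(1)] nzN[OF z(1)] by (simp add: chi_def psi_def)
    then have "cmod (P z) * r = cmod (chi z) * cmod (z + \<i>) * cmod (z + \<i> * of_real N)"
      by (metis norm_mult r_def)
    also have "\<dots> \<le> e / 2 * (r + 1) * (r + N)"
      using chi[OF z(1)] norm_triangle_ineq[of z \<i>] norm_triangle_ineq[of z "\<i> * of_real N"] e N
      by (intro mult_mono) (auto simp: r_def norm_mult)
    also have "\<dots> = e / 2 * (r * r + ((1 + N) * r + N))" by (simp add: algebra_simps)
    also have "\<dots> \<le> e / 2 * (r * r + r * r)"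
    proof (intro mult_left_mono add_mono)
      have "N * 1 \<le> N * r" using r N by (intro mult_left_mono) auto
      then have "(1 + N) * r + N \<le> (1 + 2 * N) * r" by (simp add: algebra_simps)
      also have "\<dots> \<le> r * r" using r by (intro mult_right_mono) auto
      finally show "(1 + N) * r + N \<le> r * r" .
    qed (use e r in auto)
    also have "\<dots> = e * r * r" by (simp add: algebra_simps)
    finally have "cmod (P z) \<le> e * r" using r by simp
    then show "cmod (P z) \<le> e * cmod z" by (simp add: r_def)
  qed
qed

text \<open>Cauchy's theorem on half-discs, whose arcs contribute nothing in the limit because the primitive of \<open>f\<close>
is \<open>o(\<bar>w\<bar>)\<close>. For \<open>z\<close> in the upper half-plane the pole at \<open>z\<close> is removed first, by subtracting
\<open>f(z) (z - cnj z) / (w - cnj z)\<close> from \<open>f\<close>; the subtracted term contributes an arctangent integral.\<close>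

lemma cauchy_half_plane:
  assumes f: "f holomorphic_on {w. - d < Im w}" and d: "d > 0" and gr: "pl_growth f"
    and int: "integrable lborel (\<lambda>x. cmod (f (of_real x)) / (1 + \<bar>x\<bar>))"
  shows cauchy_half_plane_below: "Im z < 0 \<Longrightarrow> (LINT x|lborel. f (of_real x) / (of_real x - z)) = 0"
    and cauchy_half_plane_above: "0 < Im z \<Longrightarrow> (LINT x|lborel. f (of_real x) / (of_real x - z)) = 2 * of_real pi * \<i> * f z"
proof -
  let ?A = "\<lambda>n. part_circlepath 0 (real n) 0 pi"
  let ?I = "\<lambda>n. integral {- real n..real n}"
  define U where "U = {w. - d < Im w}"
  have U: "convex U" "open U" unfolding U_def by (auto simp: convex_halfspace_Im_gt open_halfspace_Im_gt)
  have UHP: "{z. 0 \<le> Im z} \<subseteq> U" using d by (auto simp: U_def)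
  obtain P where "\<And>w. w \<in> U \<Longrightarrow> (P has_field_derivative f w) (at w within U)"
    using holomorphic_convex_primitive'[OF U, of f] f by (auto simp: U_def)
  then have PU: "(P has_field_derivative f w) (at w)" if "w \<in> U" for w
    using that U(2) at_within_open by metis
  then have P: "(P has_field_derivative f w) (at w)" if "0 \<le> Im w" for w
    using that UHP by blast
  have "P holomorphic_on U"
    using PU by (auto simp: holomorphic_on_def field_differentiable_def intro: has_field_derivative_at_within)
  then have Pan: "P analytic_on {z. 0 \<le> Im z}"
    using U(2) UHP analytic_on_open analytic_on_subset by metis
  have cU: "continuous_on U f" using f by (simp add: U_def holomorphic_on_imp_continuous_on)
  have fc: "continuous_on UNIV (\<lambda>x::real. f (of_real x))"
    by (rule continuous_on_compose2[OF cU]) (use d in \<open>auto simp: U_def intro!: continuous_intros\<close>)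
  have arc: "(\<lambda>n. contour_integral (?A n) (\<lambda>w. f w / (w - z))) \<longlonglongrightarrow> 0" for z
  proof (rule LIMSEQ_I)
    fix e :: real assume e: "e > 0"
    define e' where "e' = e / 40"
    have e': "e' > 0" using e by (simp add: e'_def)
    obtain r where r: "\<And>w. 0 \<le> Im w \<Longrightarrow> r \<le> cmod w \<Longrightarrow> cmod (P w) \<le> e' * cmod w"
      using primitive_little_o_UHP[OF P Pan fc gr int e'] by metis
    obtain N where N: "max r (2 * cmod z + 1) \<le> real N" using real_arch_simple by blast
    show "\<exists>N. \<forall>n\<ge>N. norm (contour_integral (?A n) (\<lambda>w. f w / (w - z)) - 0) < e"
    proof (intro exI allI impI)
      fix n assume "n \<ge> N"
      then have n: "r \<le> real n" "2 * cmod z + 1 \<le> real n" using N by auto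
      define R where "R = real n"
      have R: "R > 0" "R / 2 \<le> R - cmod z" "cmod z < R"
        using n norm_ge_zero[of z] by (auto simp: R_def simp del: norm_ge_zero)
      have "norm (contour_integral (part_circlepath 0 R 0 pi) (\<lambda>w. f w / (w - z)))
          \<le> 2 * (e' * R) / (R - cmod z) + (e' * R) / (R - cmod z)\<^sup>2 * R * pi"
      proof (rule upper_arc_integral_bound[OF P R(3)])
        fix w assume "cmod w = R" "0 \<le> Im w"
        then show "cmod (P w) \<le> e' * R" using r[of w] n by (simp add: R_def)
      qed
      also have "\<dots> \<le> 2 * (e' * R) / (R / 2) + (e' * R) / (R / 2)\<^sup>2 * R * pi"
        using R e' by (intro add_mono mult_right_mono frac_le power_mono) auto
      also have "\<dots> = 4 * e' + 4 * e' * pi" using R by (simp add: power2_eq_square field_simps)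
      also have "\<dots> \<le> 4 * e' + 4 * e' * 4" using e' pi_less_4 by (intro add_mono mult_left_mono) auto
      also have "\<dots> < e" using e by (simp add: e'_def)
      finally show "norm (contour_integral (?A n) (\<lambda>w. f w / (w - z)) - 0) < e"
        by (simp add: R_def)
    qed
  qed
  have ki: "integrable lborel (\<lambda>x. f (of_real x) / (of_real x - z))" if "Im z \<noteq> 0" for z
    by (rule cauchy_kernel_integrable[OF borel_measurable_continuous_onI[OF fc] int that])
  have lim: "(\<lambda>n. ?I n (\<lambda>x. f (of_real x) / (of_real x - z)))
      \<longlonglongrightarrow> (LINT x|lborel. f (of_real x) / (of_real x - z))" if "Im z \<noteq> 0" for z
    by (rule integral_symmetric_tendsto[OF ki[OF that]])
  {
    assume z: "Im z < 0"
    define d' where "d' = min d (- Im z)"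
    have d': "d' > 0" using d z by (simp add: d'_def)
    have "(\<lambda>w. f w / (w - z)) holomorphic_on {w. - d' < Im w}"
      by (intro holomorphic_intros holomorphic_on_subset[OF f]) (auto simp: d'_def)
    from half_disc_integral_zero[OF this d']
    have "eventually (\<lambda>n. ?I n (\<lambda>x. f (of_real x) / (of_real x - z))
        = - contour_integral (?A n) (\<lambda>w. f w / (w - z))) sequentially"
      by (intro eventually_sequentiallyI[of 1]) (simp add: add_eq_0_iff2)
    moreover have "(\<lambda>n. - contour_integral (?A n) (\<lambda>w. f w / (w - z))) \<longlonglongrightarrow> - 0"
      by (intro tendsto_intros arc)
    ultimately have "(\<lambda>n. ?I n (\<lambda>x. f (of_real x) / (of_real x - z))) \<longlonglongrightarrow> 0"
      by (simp add: tendsto_cong)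
    with lim[of z] z show "(LINT x|lborel. f (of_real x) / (of_real x - z)) = 0"
      using LIMSEQ_unique by force
  }
  {
    assume z: "0 < Im z"
    define a y where "a = Re z" "y = Im z"
    have y: "y > 0" using z by (simp add: a_y_def)
    define c where "c = z - cnj z"
    have c: "c = 2 * \<i> * of_real y" by (simp add: c_def a_y_def complex_eq_iff)
    define k where "k w = c / ((w - cnj z) * (w - z))" for w
    define F where "F w = f w - f z * (c / (w - cnj z))" for w
    define h where "h w = (if w = z then deriv F z else F w / (w - z))" for w
    define d' where "d' = min d y"
    have d': "d' > 0" using d y by (simp add: d'_def)
    have ncz: "w \<noteq> cnj z" if "- d' < Im w" for w using that by (auto simp: d'_def a_y_def)
    have Fz: "F z = 0" using z by (simp add: F_def c_def complex_eq_iff)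
    have "F holomorphic_on {w. - d' < Im w}"
      unfolding F_def using ncz
      by (intro holomorphic_intros holomorphic_on_subset[OF f]) (auto simp: d'_def)
    then have hh: "h holomorphic_on {w. - d' < Im w}"
      by (rule pole_theorem_open_0[where a = z]) (auto simp: h_def Fz open_halfspace_Im_gt)
    have heq: "h w = f w / (w - z) - f z * k w" if "w \<noteq> z" for w
      using that by (simp add: h_def F_def k_def diff_divide_distrib)
    have kreal: "k (of_real x) = 2 * \<i> * of_real (y / ((x - a)\<^sup>2 + y\<^sup>2))" for x
    proof -
      have "(of_real x - cnj z) * (of_real x - z) = of_real ((x - a)\<^sup>2 + y\<^sup>2)"
        by (simp add: complex_eq_iff a_y_def power2_eq_square algebra_simps)
      then show ?thesis by (simp add: k_def c)
    qed
    have kint: "((\<lambda>x. k (of_real x)) has_integral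
        (2 * \<i> * of_real (arctan ((R - a) / y)) - 2 * \<i> * of_real (arctan ((- R - a) / y)))) {-R..R}"
      if "R \<ge> 0" for R
    proof (rule fundamental_theorem_of_calculus)
      show "- R \<le> R" using that by simp
      fix x
      have "((\<lambda>x. arctan ((x - a) / y)) has_real_derivative y / ((x - a)\<^sup>2 + y\<^sup>2)) (at x within {-R..R})"
      proof -
        have pos: "y * y + (x - a) * (x - a) > 0" using y by (intro add_pos_nonneg) auto
        show ?thesis using y pos
          by (auto intro!: derivative_eq_intros simp: field_simps power2_eq_square)
      qed
      then have "((\<lambda>x. 2 * \<i> * of_real (arctan ((x - a) / y))) has_vector_derivative
          2 * \<i> * of_real (y / ((x - a)\<^sup>2 + y\<^sup>2))) (at x within {-R..R})"
        by (intro has_vector_derivative_mult_right has_vector_derivative_of_real)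
           (simp add: has_real_derivative_iff_has_vector_derivative)
      then show "((\<lambda>x. 2 * \<i> * of_real (arctan ((x - a) / y))) has_vector_derivative k (of_real x)) (at x within {-R..R})"
        by (simp only: kreal)
    qed
    have klim: "(\<lambda>n. ?I n (\<lambda>x. k (of_real x))) \<longlonglongrightarrow> 2 * of_real pi * \<i>"
    proof -
      have "(\<lambda>n. arctan ((real n - a) / y) - arctan ((- real n - a) / y)) \<longlonglongrightarrow> pi / 2 - (- pi / 2)"
        using y by real_asymp
      then have "(\<lambda>n. 2 * \<i> * of_real (arctan ((real n - a) / y) - arctan ((- real n - a) / y)))
           \<longlonglongrightarrow> 2 * \<i> * of_real (pi / 2 - (- pi / 2))"
        by (rule tendsto_mult[OF tendsto_const tendsto_of_real])
      moreover have "?I n (\<lambda>x. k (of_real x))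
        = 2 * \<i> * of_real (arctan ((real n - a) / y) - arctan ((- real n - a) / y))" for n
        using kint[of "real n"] by (simp add: integral_unique algebra_simps)
      ultimately show ?thesis by (simp add: mult_ac)
    qed
    have karc: "(\<lambda>n. contour_integral (?A n) k) \<longlonglongrightarrow> 0"
    proof (rule Lim_null_comparison)
      show "(\<lambda>n. cmod c / (real n - cmod z)\<^sup>2 * real n * pi) \<longlonglongrightarrow> 0" by real_asymp
      show "eventually (\<lambda>n. norm (contour_integral (?A n) k)
          \<le> cmod c / (real n - cmod z)\<^sup>2 * real n * pi) sequentially"
      proof (rule eventually_sequentiallyI)
        fix n assume "n \<ge> nat \<lceil>cmod z\<rceil> + 1"
        then have n: "cmod z < real n" by linarith
        then have n0: "0 < real n" using norm_ge_zero[of z] by linarith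
        have dist: "real n - cmod z \<le> cmod (w - z)" "real n - cmod z \<le> cmod (w - cnj z)" "w \<noteq> z" "w \<noteq> cnj z"
          if "w \<in> path_image (?A n)" for w
          using upper_arc[OF that n0] n norm_triangle_ineq2[of w z] norm_triangle_ineq2[of w "cnj z"] by auto
        have "norm (contour_integral (?A n) k)
           \<le> cmod c / (real n - cmod z)\<^sup>2 * real n * (pi - 0)"
        proof (rule has_contour_integral_bound_part_circlepath_strong)
          show "(k has_contour_integral contour_integral (?A n) k) (?A n)"
            unfolding k_def using dist
            by (intro has_contour_integral_integral contour_integrable_continuous_part_circlepath continuous_intros) auto
          fix w assume w: "w \<in> path_image (?A n) - {}"
          have "(real n - cmod z) * (real n - cmod z) \<le> cmod (w - cnj z) * cmod (w - z)"
            using dist[of w] w n by (intro mult_mono) auto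
          then show "cmod (k w) \<le> cmod c / (real n - cmod z)\<^sup>2"
            unfolding k_def norm_divide norm_mult power2_eq_square using n by (intro frac_le) auto
        qed (use n0 in auto)
        then show "norm (contour_integral (?A n) k)
            \<le> cmod c / (real n - cmod z)\<^sup>2 * real n * pi" by simp
      qed
    qed
    have ev: "eventually (\<lambda>n. ?I n (\<lambda>x. f (of_real x) / (of_real x - z))
        - f z * ?I n (\<lambda>x. k (of_real x))
        + (contour_integral (?A n) (\<lambda>w. f w / (w - z))
        - f z * contour_integral (?A n) k) = 0) sequentially"
    proof (rule eventually_sequentiallyI)
      fix n assume "n \<ge> nat \<lceil>cmod z\<rceil> + 1"
      then have n: "cmod z < real n" by linarith
      then have n0: "0 < real n" using norm_ge_zero[of z] by linarith
      define A where "A = ?A n"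
      have Ane: "w \<noteq> z" "w \<noteq> cnj z" "0 \<le> Im w" if "w \<in> path_image A" for w
        using upper_arc[OF that[unfolded A_def] n0] n by auto
      have "?I n (\<lambda>x. h (of_real x))
          = ?I n (\<lambda>x. f (of_real x) / (of_real x - z) - f z * k (of_real x))"
        using z by (intro integral_cong heq) auto
      also have "\<dots> = ?I n (\<lambda>x. f (of_real x) / (of_real x - z))
           - ?I n (\<lambda>x. f z * k (of_real x))"
      proof (rule integral_diff)
        show "(\<lambda>x. f (of_real x) / (of_real x - z)) integrable_on {- real n..real n}"
          using z by (intro integrable_continuous_real continuous_intros continuous_on_subset[OF fc]) auto
        show "(\<lambda>x. f z * k (of_real x)) integrable_on {- real n..real n}"
          using kint[of "real n"] by (intro integrable_on_mult_right) (auto simp: has_integral_integrable)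
      qed
      also have "?I n (\<lambda>x. f z * k (of_real x)) = f z * ?I n (\<lambda>x. k (of_real x))"
        by simp
      finally have 1: "?I n (\<lambda>x. h (of_real x))
         = ?I n (\<lambda>x. f (of_real x) / (of_real x - z))
           - f z * ?I n (\<lambda>x. k (of_real x))" .
      have fi: "(\<lambda>w. f w / (w - z)) contour_integrable_on A"
        unfolding A_def using Ane UHP
        by (intro contour_integrable_continuous_part_circlepath continuous_intros continuous_on_subset[OF cU]) (auto simp: A_def)
      have ki: "k contour_integrable_on A"
        unfolding A_def k_def using Ane
        by (intro contour_integrable_continuous_part_circlepath continuous_intros) (auto simp: A_def)
      have "contour_integral A h = contour_integral A (\<lambda>w. f w / (w - z) - f z * k w)"
        using Ane by (intro contour_integral_eq heq) auto
      also have "\<dots> = contour_integral A (\<lambda>w. f w / (w - z)) - f z * contour_integral A k"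
        using fi ki by (simp add: contour_integral_diff contour_integrable_lmul contour_integral_lmul)
      finally have 2: "contour_integral A h = contour_integral A (\<lambda>w. f w / (w - z)) - f z * contour_integral A k" .
      show "?I n (\<lambda>x. f (of_real x) / (of_real x - z))
        - f z * ?I n (\<lambda>x. k (of_real x))
        + (contour_integral (?A n) (\<lambda>w. f w / (w - z))
        - f z * contour_integral (?A n) k) = 0"
        using half_disc_integral_zero[OF hh d' n0] 1 2 by (simp add: A_def)
    qed
    have "(\<lambda>n. ?I n (\<lambda>x. f (of_real x) / (of_real x - z))
        - f z * ?I n (\<lambda>x. k (of_real x))
        + (contour_integral (?A n) (\<lambda>w. f w / (w - z))
        - f z * contour_integral (?A n) k))
       \<longlonglongrightarrow> (LINT x|lborel. f (of_real x) / (of_real x - z)) - f z * (2 * of_real pi * \<i>) + (0 - f z * 0)"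
      using z by (intro tendsto_intros lim arc klim karc) auto
    then have "(\<lambda>n::nat. 0) \<longlonglongrightarrow> (LINT x|lborel. f (of_real x) / (of_real x - z)) - f z * (2 * of_real pi * \<i>) + (0 - f z * 0)"
      by (rule Lim_transform_eventually) (use ev in simp)
    then show "(LINT x|lborel. f (of_real x) / (of_real x - z)) = 2 * of_real pi * \<i> * f z"
      by (simp add: LIMSEQ_const_iff mult_ac)
  }
qed

section \<open>Blaschke tails\<close>

lemma finite_zero_factor:
  assumes "finite A" "f holomorphic_on UNIV" "\<And>a. a \<in> A \<Longrightarrow> f a = 0"
  shows "\<exists>g. g holomorphic_on UNIV \<and> (\<forall>z. f z = (\<Prod>a\<in>A. z - a) * g z)"
  using assms
proof (induction A rule: finite_induct)
  case empty
  then show ?case by auto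
next
  case (insert a A)
  then obtain g where g: "g holomorphic_on UNIV" "\<And>z. f z = (\<Prod>a\<in>A. z - a) * g z" by auto
  have "(\<Prod>b\<in>A. a - b) \<noteq> 0" using insert.hyps by auto
  then have ga: "g a = 0" using g(2)[of a] insert.prems by auto
  define k where "k z = (if z = a then deriv g a else g z / (z - a))" for z
  have "k holomorphic_on UNIV"
    by (rule pole_theorem_open_0[OF g(1), of a]) (auto simp: k_def ga)
  moreover have "f z = (\<Prod>b\<in>insert a A. z - b) * k z" for z
    using g(2)[of z] insert.hyps by (auto simp: k_def ga)
  ultimately show ?case by blast
qed

text \<open>What the summation method uses about \<open>G\<close>. The assumption \<open>sharp\<close> says that the type in the upper
half-plane is not smaller than \<open>\<pi>\<close>, in the form in which it gets contradicted; \<open>recip\<close> carries the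
corresponding information from the lower half-plane.\<close>

locale zeros_in_upper_half_plane =
  fixes G :: "complex \<Rightarrow> complex" and d C :: real
  assumes d: "d > 0" and entire: "G holomorphic_on UNIV"
    and zeros: "\<And>z. G z = 0 \<Longrightarrow> d < Im z"
    and simple: "\<And>z. G z = 0 \<Longrightarrow> deriv G z \<noteq> 0"
    and bound: "\<And>z. cmod (G z) \<le> C * (1 + cmod z) ^ 3 * exp (pi * \<bar>Im z\<bar>)"
    and sharp: "\<And>a C'. 0 \<le> a \<Longrightarrow> a < pi \<Longrightarrow>
       \<exists>z. 0 < Im z \<and> C' * (1 + cmod z) ^ 3 * exp (a * Im z) < cmod (G z)"
    and recip: "pl_growth (\<lambda>z. 1 / (reflect G z * exp (\<i> * of_real pi * z)))"
    and recip_int: "integrable lborel (\<lambda>x::real. 1 / ((cmod (G (of_real x)))\<^sup>2 * (1 + \<bar>x\<bar>\<^sup>2)))"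
begin

definition Z :: "nat \<Rightarrow> complex set" where
  "Z n = {z. G z = 0 \<and> cmod z \<le> real n}"

lemma G_real: "G (of_real x) \<noteq> 0"
  using zeros[of "of_real x"] d by auto

lemma reflect_G_nz: "- d < Im z \<Longrightarrow> reflect G z \<noteq> 0"
  using zeros[of "cnj z"] by (auto simp: reflect_def)

lemma finite_zeros: "finite {z. G z = 0 \<and> cmod z \<le> r}"
proof -
  have "finite {z \<in> cball 0 r. G z = 0}"
  proof (rule holomorphic_compact_finite_zeros[OF entire])
    show "\<not> G constant_on UNIV"
    proof
      assume "G constant_on UNIV"
      then obtain c where c: "\<And>z. G z = c" by (auto simp: constant_on_def)
      have "c \<noteq> 0" using G_real[of 0] c by metis
      obtain z where z: "0 < Im z" "cmod c * (1 + cmod z) ^ 3 * exp (0 * Im z) < cmod (G z)"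
        using sharp[of 0 "cmod c"] by auto
      have "1 \<le> (1 + cmod z) ^ 3" by (rule one_le_power) simp
      then have "cmod c * 1 \<le> cmod c * (1 + cmod z) ^ 3" by (intro mult_left_mono) auto
      then show False using z(2) by (simp add: c)
    qed
  qed auto
  then show ?thesis by (rule rev_finite_subset) auto
qed

lemma finite_Z: "finite (Z n)"
  unfolding Z_def by (rule finite_zeros)

lemma Im_Z: "l \<in> Z n \<Longrightarrow> 0 < Im l"
  using zeros[of l] d by (auto simp: Z_def)

text \<open>The entire cofactor of the polynomial whose zeros are the zeros of \<open>G\<close> of modulus at most \<open>n\<close>.\<close>

definition g :: "nat \<Rightarrow> complex \<Rightarrow> complex" where
  "g n = (SOME g. g holomorphic_on UNIV \<and> (\<forall>z. G z = (\<Prod>a\<in>Z n. z - a) * g z))"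

lemma g_holomorphic: "g n holomorphic_on UNIV" and G_eq: "G z = (\<Prod>a\<in>Z n. z - a) * g n z"
proof -
  have "\<exists>g. g holomorphic_on UNIV \<and> (\<forall>z. G z = (\<Prod>a\<in>Z n. z - a) * g z)"
    by (rule finite_zero_factor[OF finite_Z entire]) (simp add: Z_def)
  from someI_ex[OF this] show "g n holomorphic_on UNIV" "G z = (\<Prod>a\<in>Z n. z - a) * g n z"
    unfolding g_def by blast+
qed

lemma reflect_G_eq: "reflect G z = (\<Prod>a\<in>Z n. z - cnj a) * reflect (g n) z"
  by (simp add: reflect_def G_eq[of _ n])

lemma deriv_G_zero:
  assumes l: "l \<in> Z n"
  shows "deriv G l = (\<Prod>a\<in>Z n - {l}. l - a) * g n l"
proof -
  have eq: "G = (\<lambda>z. (z - l) * ((\<Prod>a\<in>Z n - {l}. z - a) * g n z))"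
  proof
    fix z
    show "G z = (z - l) * ((\<Prod>a\<in>Z n - {l}. z - a) * g n z)"
      using G_eq[of z n] prod.remove[OF finite_Z l, of "\<lambda>a. z - a"] by simp
  qed
  define k where "k z = (\<Prod>a\<in>Z n - {l}. z - a) * g n z" for z
  have "k holomorphic_on UNIV" unfolding k_def by (intro holomorphic_intros g_holomorphic)
  then have "(k has_field_derivative deriv k l) (at l)" using holomorphic_derivI by blast
  then have "((\<lambda>z. (z - l) * k z) has_field_derivative (1 * k l + deriv k l * (l - l))) (at l)"
    by (intro DERIV_mult) (auto intro!: derivative_eq_intros)
  moreover have "G = (\<lambda>z. (z - l) * k z)" unfolding k_def by (rule eq)
  ultimately have "(G has_field_derivative k l) (at l)" by simp
  then show ?thesis by (simp add: DERIV_imp_deriv k_def)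
qed

lemma g_nz: "cmod z \<le> real n \<Longrightarrow> g n z \<noteq> 0"
proof
  assume z: "cmod z \<le> real n" and gz: "g n z = 0"
  then have "G z = 0" using G_eq[of z n] by simp
  then show False using deriv_G_zero[of z n] simple[of z] z gz by (simp add: Z_def)
qed

lemma reflect_g_nz: "- d < Im z \<or> cmod z \<le> real n \<Longrightarrow> reflect (g n) z \<noteq> 0"
  using reflect_G_nz[of z] reflect_G_eq[of z n] g_nz[of "cnj z" n] by (auto simp: reflect_def)

text \<open>Up to a constant of modulus one, this is the Blaschke product of the zeros of modulus larger than \<open>n\<close>.
Writing it as \<open>g / g\<^sup>*\<close> avoids infinite products, and their convergence comes out as
\<open>W\<^sub>n \<rightarrow> 1\<close>. The constant makes the value at the origin equal to one.\<close>

definition W :: "nat \<Rightarrow> complex \<Rightarrow> complex" where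
  "W n z = cnj (g n 0) / g n 0 * (g n z / reflect (g n) z)"

lemma g0: "g n 0 \<noteq> 0"
  by (rule g_nz) simp

lemma W_0: "W n 0 = 1"
  using g0[of n] by (simp add: W_def reflect_def)

lemma W_holomorphic: "W n holomorphic_on {z. - d < Im z \<or> cmod z \<le> real n}"
  unfolding W_def using reflect_g_nz g0
  by (intro holomorphic_intros holomorphic_on_subset[OF g_holomorphic]
        holomorphic_on_subset[OF reflect_holomorphic[OF g_holomorphic]]) auto

text \<open>Schwarz reflection: across the real line \<open>W\<^sub>n\<close> continues to its reciprocal, so it has neither zeros nor
poles in the disc of radius \<open>n\<close>.\<close>

lemma W_reflect: "cmod z \<le> real n \<Longrightarrow> cnj (W n z) * W n (cnj z) = 1"
  using g_nz[of z n] g_nz[of "cnj z" n] g0[of n] by (simp add: W_def reflect_def)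

lemma norm_W: "cmod (W n z) = cmod (g n z) / cmod (reflect (g n) z)"
  using g0[of n] by (simp add: W_def norm_mult norm_divide)

lemma norm_W_real: "cmod (W n (of_real x)) = 1"
proof -
  have "reflect (g n) (of_real x) \<noteq> 0" using d by (intro reflect_g_nz) simp
  then have "cmod (g n (of_real x)) \<noteq> 0" by (simp add: reflect_def)
  then show ?thesis unfolding norm_W by simp
qed

text \<open>For \<open>\<bar>z\<bar> > n + 1\<close> every factor \<open>z - a\<close> of the polynomial has modulus at least one, so there \<open>g\<close> is dominated
by \<open>G\<close>.\<close>

lemma g_growth: "pl_growth (\<lambda>z. g n z * exp (\<i> * of_real pi * z))"
proof -
  have "compact ((\<lambda>z. g n z * exp (\<i> * of_real pi * z)) ` cball 0 (real n + 1))"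
    by (intro compact_continuous_image continuous_intros
        continuous_on_subset[OF holomorphic_on_imp_continuous_on[OF g_holomorphic]]) auto
  then obtain B where B: "\<And>z. cmod z \<le> real n + 1 \<Longrightarrow> cmod (g n z * exp (\<i> * of_real pi * z)) \<le> B"
    using compact_imp_bounded by (force simp: bounded_iff)
  show ?thesis
  proof (rule pl_growth_poly[where k = 3 and C = "max C B"])
    fix z :: complex assume z: "0 \<le> Im z"
    have one: "1 \<le> (1 + cmod z) ^ 3" by (rule one_le_power) simp
    show "cmod (g n z * exp (\<i> * of_real pi * z)) \<le> max C B * (1 + cmod z) ^ 3"
    proof (cases "cmod z \<le> real n + 1")
      case True
      have "0 \<le> B" using B[OF True] norm_ge_zero order_trans by blast
      have "B * 1 \<le> max C B * (1 + cmod z) ^ 3"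
        using one \<open>0 \<le> B\<close> by (intro mult_mono) auto
      then show ?thesis using B[OF True] by linarith
    next
      case False
      have "1 \<le> (\<Prod>a\<in>Z n. cmod (z - a))"
      proof (rule prod_ge_1)
        fix a assume "a \<in> Z n"
        then have "cmod a \<le> real n" by (simp add: Z_def)
        then show "1 \<le> cmod (z - a)" using norm_triangle_ineq2[of z a] False by linarith
      qed
      then have "1 * cmod (g n z) \<le> (\<Prod>a\<in>Z n. cmod (z - a)) * cmod (g n z)"
        by (intro mult_right_mono) auto
      also have "\<dots> = cmod (G z)" using G_eq[of z n] by (simp add: norm_mult prod_norm)
      finally have "cmod (g n z) * exp (- pi * Im z) \<le> C * (1 + cmod z) ^ 3 * exp (pi * \<bar>Im z\<bar>) * exp (- pi * Im z)"
        using bound[of z] by (intro mult_right_mono) auto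
      also have "\<dots> = C * (1 + cmod z) ^ 3" using z by (simp add: mult.assoc exp_add[symmetric])
      also have "\<dots> \<le> max C B * (1 + cmod z) ^ 3" by (intro mult_right_mono) auto
      finally show ?thesis by (simp add: norm_mult)
    qed
  qed
qed

lemma norm_W_le_1:
  assumes z: "0 \<le> Im z"
  shows "cmod (W n z) \<le> 1"
proof (rule phragmen_lindelof_half_plane[where f = "W n"])
  have "W n holomorphic_on {z. - d < Im z}" by (rule holomorphic_on_subset[OF W_holomorphic]) auto
  then have "W n analytic_on {z. - d < Im z}" by (simp add: analytic_on_open open_halfspace_Im_gt)
  then show "W n analytic_on {z. 0 \<le> Im z}" by (rule analytic_on_subset) (use d in auto)
  show "cmod (W n (of_real x)) \<le> 1" for x by (simp add: norm_W_real)
  have "pl_growth (\<lambda>z. \<Prod>a\<in>Z n. z - cnj a)"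
  proof (rule pl_growth_poly)
    fix z assume "0 \<le> Im z"
    have "cmod (\<Prod>a\<in>Z n. z - cnj a) = (\<Prod>a\<in>Z n. cmod (z - cnj a))" by (simp add: prod_norm)
    also have "\<dots> \<le> (\<Prod>a\<in>Z n. (1 + real n) * (1 + cmod z))"
    proof (rule prod_mono, intro conjI)
      fix a assume "a \<in> Z n"
      then have "cmod a \<le> real n" by (simp add: Z_def)
      then have "cmod (z - cnj a) \<le> cmod z + real n" using norm_triangle_ineq4[of z "cnj a"] by simp
      also have "\<dots> \<le> (1 + real n) * (1 + cmod z)" by (simp add: algebra_simps)
      finally show "cmod (z - cnj a) \<le> (1 + real n) * (1 + cmod z)" .
    qed simp
    also have "\<dots> = (1 + real n) ^ card (Z n) * (1 + cmod z) ^ card (Z n)"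
      by (simp add: power_mult_distrib)
    finally show "cmod (\<Prod>a\<in>Z n. z - cnj a) \<le> (1 + real n) ^ card (Z n) * (1 + cmod z) ^ card (Z n)" .
  qed
  then have "pl_growth (\<lambda>z. (g n z * exp (\<i> * of_real pi * z)) * ((\<Prod>a\<in>Z n. z - cnj a) * (1 / (reflect G z * exp (\<i> * of_real pi * z)))))"
    by (intro pl_growth_mult g_growth recip)
  then show "pl_growth (W n)"
  proof (rule pl_growth_mono)
    fix z assume z: "0 \<le> Im z"
    have "(\<Prod>a\<in>Z n. z - cnj a) \<noteq> 0"
      using reflect_G_nz[of z] reflect_G_eq[of z n] z d by auto
    moreover have "reflect (g n) z \<noteq> 0" using z d by (intro reflect_g_nz) simp
    ultimately have "g n z / reflect (g n) z = (g n z * exp (\<i> * of_real pi * z)) * ((\<Prod>a\<in>Z n. z - cnj a) * (1 / (reflect G z * exp (\<i> * of_real pi * z))))"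
      unfolding reflect_G_eq[of z n] by simp
    then show "cmod (W n z) \<le> cmod ((g n z * exp (\<i> * of_real pi * z)) * ((\<Prod>a\<in>Z n. z - cnj a) * (1 / (reflect G z * exp (\<i> * of_real pi * z)))))"
      unfolding norm_W norm_divide[symmetric] by simp
  qed
qed (use z in auto)

text \<open>The ratio of the two sides is a finite Blaschke product.\<close>

lemma norm_G_le_W:
  assumes z: "0 \<le> Im z"
  shows "cmod (G z) \<le> cmod (reflect G z) * cmod (W n z)"
proof -
  have rg: "reflect (g n) z \<noteq> 0" using z d by (intro reflect_g_nz) simp
  have "cmod (G z) = (\<Prod>a\<in>Z n. cmod (z - a)) * cmod (g n z)"
    using G_eq[of z n] by (simp add: norm_mult prod_norm)
  also have "\<dots> \<le> (\<Prod>a\<in>Z n. cmod (z - cnj a)) * cmod (g n z)"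
  proof (intro mult_right_mono prod_mono conjI)
    fix a assume "a \<in> Z n"
    then have "Im a > 0" by (rule Im_Z)
    then have "(Im z - Im a)\<^sup>2 \<le> (Im z + Im a)\<^sup>2" using z by (simp add: power2_eq_square algebra_simps)
    then show "cmod (z - a) \<le> cmod (z - cnj a)" unfolding cmod_def by (intro real_sqrt_le_mono) simp
  qed auto
  also have "\<dots> = cmod (reflect G z) * cmod (W n z)"
    unfolding norm_W reflect_G_eq[of z n] using rg by (simp add: norm_mult prod_norm)
  finally show ?thesis .
qed

lemma W_near_exp_linear:
  assumes n: "n \<ge> 1"
  shows "\<exists>a\<ge>0. \<forall>z. cmod z \<le> real n / 4 \<longrightarrow>
     (\<exists>v. W n z = exp (\<i> * v) \<and> cmod (v - of_real a * z) \<le> 12 * a * (cmod z)\<^sup>2 / real n)"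
proof -
  have sub: "ball 0 (real n) \<subseteq> {z. - d < Im z \<or> cmod z \<le> real n}" by auto
  have Wnz: "W n z \<noteq> 0" if "z \<in> ball 0 (real n)" for z
    using W_reflect[of z n] that by auto
  obtain L where L: "L holomorphic_on ball 0 (real n)" "\<And>z. z \<in> ball 0 (real n) \<Longrightarrow> W n z = exp (L z)"
    using contractible_imp_holomorphic_log[OF holomorphic_on_subset[OF W_holomorphic sub]
        convex_imp_contractible[OF convex_ball] Wnz] by metis
  define h where "h z = - \<i> * (L z - L 0)" for z
  have Wh: "W n z = exp (\<i> * h z)" if "z \<in> ball 0 (real n)" for z
  proof -
    have "exp (L 0) = 1" using L(2)[of 0] W_0 n by simp
    then show ?thesis using L(2)[OF that] by (simp add: h_def algebra_simps exp_diff)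
  qed
  then have nW: "cmod (W n z) = exp (- Im (h z))" if "z \<in> ball 0 (real n)" for z
    using that by simp
  have pos: "0 \<le> Im (h z)" if "z \<in> ball 0 (real n)" "0 \<le> Im z" for z
    using norm_W_le_1[OF that(2), of n] nW[OF that(1)] by simp
  have neg: "Im (h z) \<le> 0" if "z \<in> ball 0 (real n)" "Im z \<le> 0" for z
  proof -
    have "cmod (W n z) * cmod (W n (cnj z)) = 1"
      using W_reflect[of z n] that by (metis complex_mod_cnj less_imp_le mem_ball_0 norm_mult norm_one)
    moreover have "cmod (W n z) * cmod (W n (cnj z)) \<le> cmod (W n z) * 1"
      using norm_W_le_1[of "cnj z" n] that by (intro mult_left_mono) auto
    ultimately show ?thesis using nW[OF that(1)] by simp
  qed
  obtain a where a: "a \<ge> 0" "\<And>z. cmod z \<le> (real n / 2) / 2 \<Longrightarrow> cmod (h z - of_real a * z) \<le> 6 * a * (cmod z)\<^sup>2 / (real n / 2)"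
  proof (rule reflection_symmetric_near_linear[of h "real n" "real n / 2"])
    show "h holomorphic_on ball 0 (real n)" unfolding h_def by (intro holomorphic_intros L)
    show "0 \<le> Im z * Im (h z)" if "z \<in> ball 0 (real n)" for z
      using pos[OF that] neg[OF that] by (cases "0 \<le> Im z") (auto intro: mult_nonpos_nonpos)
    show "Im (h (of_real x)) = 0" if "\<bar>x\<bar> < real n" for x
      using pos[of "of_real x"] neg[of "of_real x"] that by auto
  qed (use n in \<open>auto simp: h_def\<close>)
  show ?thesis
  proof (intro exI[of _ a] conjI allI impI)
    fix z assume z: "cmod z \<le> real n / 4"
    then have "z \<in> ball 0 (real n)" using n by simp
    then show "\<exists>v. W n z = exp (\<i> * v) \<and> cmod (v - of_real a * z) \<le> 12 * a * (cmod z)\<^sup>2 / real n"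
      using Wh a(2)[of z] z by (intro exI[of _ "h z"]) (simp add: field_simps)
  qed (rule a)
qed

text \<open>By the preceding lemma \<open>W\<^sub>n\<close> is close to \<open>exp(i a\<^sub>n z)\<close>. If \<open>a\<^sub>n \<ge> c > 0\<close> held for infinitely many \<open>n\<close>, then
\<open>\<bar>W\<^sub>n(z)\<bar> \<le> exp(- c Im z / 2)\<close> for a fixed \<open>z\<close> and one of these \<open>n\<close>, and \<open>\<bar>G\<bar> \<le> \<bar>G\<^sup>*\<bar> \<bar>W\<^sub>n\<bar>\<close> would contradict the
type of \<open>G\<close>.\<close>

lemma W_uniform_limit: "uniform_limit (cball 0 r) W (\<lambda>_. 1) sequentially"
proof -
  obtain a :: "nat \<Rightarrow> real" where a: "\<And>n. n \<ge> 1 \<Longrightarrow> a n \<ge> 0"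
    "\<And>n z. n \<ge> 1 \<Longrightarrow> cmod z \<le> real n / 4 \<Longrightarrow>
        \<exists>v. W n z = exp (\<i> * v) \<and> cmod (v - of_real (a n) * z) \<le> 12 * a n * (cmod z)\<^sup>2 / real n"
    using W_near_exp_linear by metis
  have small: "\<exists>N. \<forall>n\<ge>N. a n < c" if c: "c > 0" for c
  proof (rule ccontr)
    assume "\<not> ?thesis"
    then have freq: "\<And>N. \<exists>n\<ge>N. c \<le> a n" by (meson not_less)
    \<comment> \<open>Replacing \<open>c\<close> by \<open>min c pi\<close> keeps the exponent \<open>pi - b / 2\<close> non-negative.\<close>
    define b where "b = min c pi"
    have b: "0 < b" "b \<le> c" "b \<le> pi" using c by (auto simp: b_def)
    obtain z where z: "0 < Im z" "C * (1 + cmod z) ^ 3 * exp ((pi - b / 2) * Im z) < cmod (G z)"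
      using sharp[of "pi - b / 2" C] b by auto
    obtain N where N: "max (4 * cmod z + 1) (24 * (cmod z)\<^sup>2 / Im z) \<le> real N" using real_arch_simple by blast
    obtain n where n: "n \<ge> N" "c \<le> a n" using freq by blast
    have N1: "real n \<ge> 4 * cmod z + 1" "24 * (cmod z)\<^sup>2 / Im z \<le> real n" using n N by auto
    have n1: "n \<ge> 1" using N1(1) norm_ge_zero[of z] by linarith
    obtain v where v: "W n z = exp (\<i> * v)" "cmod (v - of_real (a n) * z) \<le> 12 * a n * (cmod z)\<^sup>2 / real n"
      using a(2)[OF n1, of z] N1(1) by auto
    have "12 * a n * (cmod z)\<^sup>2 / real n \<le> a n * (Im z / 2)"
    proof -
      have "24 * (cmod z)\<^sup>2 \<le> real n * Im z" using N1(2) z(1) by (simp add: pos_divide_le_eq)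
      then have "12 * (cmod z)\<^sup>2 / real n \<le> Im z / 2" using n1 by (simp add: field_simps)
      then have "a n * (12 * (cmod z)\<^sup>2 / real n) \<le> a n * (Im z / 2)" using a(1)[OF n1] by (intro mult_left_mono)
      then show ?thesis by (simp add: mult_ac)
    qed
    moreover have "a n * Im z - Im v \<le> cmod (v - of_real (a n) * z)"
      using abs_Im_le_cmod[of "v - of_real (a n) * z"] by (simp add: abs_le_iff)
    moreover have "a n * (Im z / 2) + a n * (Im z / 2) = a n * Im z" by simp
    ultimately have "a n * (Im z / 2) \<le> Im v" using v(2) by linarith
    moreover have "b * (Im z / 2) \<le> a n * (Im z / 2)" using b n z by (intro mult_right_mono) auto
    ultimately have "cmod (W n z) \<le> exp (- (b / 2) * Im z)" using v(1) by simp
    moreover have "0 \<le> C * (1 + cmod z) ^ 3 * exp (pi * Im z)"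
      using order_trans[OF norm_ge_zero bound[of "cnj z"]] z(1) by simp
    ultimately have "cmod (G z) \<le> (C * (1 + cmod z) ^ 3 * exp (pi * Im z)) * exp (- (b / 2) * Im z)"
      using bound[of "cnj z"] z(1)
      by (intro order_trans[OF norm_G_le_W[of z n] mult_mono]) (auto simp: norm_reflect)
    also have "\<dots> = C * (1 + cmod z) ^ 3 * exp ((pi - b / 2) * Im z)"
      by (simp add: mult.assoc exp_add[symmetric] algebra_simps)
    finally show False using z(2) by simp
  qed
  show ?thesis
  proof (rule uniform_limitI)
    fix e :: real assume e: "e > 0"
    have "isCont (\<lambda>v::complex. exp (\<i> * v)) 0" by (intro continuous_intros)
    then obtain s where s: "s > 0" "\<And>v. cmod v < s \<Longrightarrow> cmod (exp (\<i> * v) - 1) < e"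
      using e by (auto simp: continuous_at_eps_delta dist_norm)
    define r' where "r' = \<bar>r\<bar> + 12 * r\<^sup>2 + 1"
    have r': "r' > 0" by (simp add: r'_def add_nonneg_pos)
    obtain N where N: "\<And>n. n \<ge> N \<Longrightarrow> a n < s / r'" using small[of "s / r'"] s r' by auto
    obtain N' where N': "4 * \<bar>r\<bar> + 1 \<le> real N'" using real_arch_simple by blast
    have "dist (W n z) 1 < e" if n: "n \<ge> max N N'" and z: "z \<in> cball 0 r" for n z
    proof -
      have zr: "cmod z \<le> \<bar>r\<bar>" using z by simp
      have nr: "4 * \<bar>r\<bar> + 1 \<le> real n" using n N' by simp
      then have n1: "n \<ge> 1" by linarith
      obtain v where v: "W n z = exp (\<i> * v)" "cmod (v - of_real (a n) * z) \<le> 12 * a n * (cmod z)\<^sup>2 / real n"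
        using a(2)[OF n1, of z] zr nr by auto
      have an: "a n \<ge> 0" by (rule a(1)[OF n1])
      have "12 * a n * (cmod z)\<^sup>2 / real n \<le> 12 * a n * r\<^sup>2 / 1"
        using an n1 power_mono[OF zr norm_ge_zero, of 2] by (intro frac_le mult_left_mono) auto
      moreover have "cmod (of_real (a n) * z) \<le> a n * \<bar>r\<bar>" using an zr by (simp add: norm_mult mult_left_mono)
      ultimately have "cmod v \<le> a n * r'"
        using norm_triangle_sub[of v "of_real (a n) * z"] v(2) an by (simp add: r'_def algebra_simps)
      also have "\<dots> < s" using N[of n] n r' by (simp add: pos_less_divide_eq)
      finally show ?thesis using s(2) v(1) by (simp add: dist_norm)
    qed
    then show "\<forall>\<^sub>F n in sequentially. \<forall>z\<in>cball 0 r. dist (W n z) 1 < e"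
      unfolding eventually_sequentially by blast
  qed
qed

end

section \<open>Interpolation sums as integrals\<close>

lemma partial_fractions_blaschke:
  assumes A: "finite A"
  shows "\<exists>\<rho>. \<forall>z. z \<notin> A \<longrightarrow> (\<Prod>a\<in>A. z - cnj a) / (\<Prod>a\<in>A. z - a) = 1 + (\<Sum>a\<in>A. \<rho> a / (z - a))"
  using A
proof (induction A rule: finite_induct)
  case empty
  then show ?case by simp
next
  case (insert b A)
  then obtain \<rho> where \<rho>: "\<And>z. z \<notin> A \<Longrightarrow>
     (\<Prod>a\<in>A. z - cnj a) / (\<Prod>a\<in>A. z - a) = 1 + (\<Sum>a\<in>A. \<rho> a / (z - a))" by blast
  define s where "s = b - cnj b"
  define \<sigma> where "\<sigma> a = (if a = b then s * (1 + (\<Sum>a\<in>A. \<rho> a / (b - a))) else \<rho> a + s * \<rho> a / (a - b))" for a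
  have "(\<Prod>a\<in>insert b A. z - cnj a) / (\<Prod>a\<in>insert b A. z - a) = 1 + (\<Sum>a\<in>insert b A. \<sigma> a / (z - a))"
    if z: "z \<notin> insert b A" for z
  proof -
    have zb: "z - b \<noteq> 0" and zA: "\<And>a. a \<in> A \<Longrightarrow> z - a \<noteq> 0" using z by auto
    have ab: "\<And>a. a \<in> A \<Longrightarrow> a - b \<noteq> 0" using insert.hyps by auto
    have "(\<Prod>a\<in>insert b A. z - cnj a) / (\<Prod>a\<in>insert b A. z - a)
        = (1 + s / (z - b)) * (1 + (\<Sum>a\<in>A. \<rho> a / (z - a)))"
    proof -
      have "(z - cnj b) / (z - b) = 1 + s / (z - b)" using zb by (simp add: s_def field_simps)
      then show ?thesis using \<rho>[of z] z insert.hyps by (simp add: times_divide_times_eq[symmetric])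
    qed
    also have "\<dots> = 1 + s / (z - b) + (\<Sum>a\<in>A. \<rho> a / (z - a) + s / (z - b) * (\<rho> a / (z - a)))"
    proof -
      have "(1 + t) * (1 + X) = 1 + t + (X + t * X)" for t X :: complex by (simp add: algebra_simps)
      then show ?thesis by (simp only: sum.distrib sum_distrib_left)
    qed
    also have "(\<Sum>a\<in>A. \<rho> a / (z - a) + s / (z - b) * (\<rho> a / (z - a)))
       = (\<Sum>a\<in>A. \<sigma> a / (z - a) + s / (z - b) * (\<rho> a / (b - a)))"
    proof (rule sum.cong[OF refl])
      fix a assume a: "a \<in> A"
      have neq: "a \<noteq> b" using a insert.hyps by auto
      have e1: "1 / (z - b) * (1 / (z - a)) = (1 / (a - b)) * (1 / (z - a)) + (1 / (z - b)) * (1 / (b - a))"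
        using zA[OF a] zb neq by (simp add: divide_simps) (simp add: algebra_simps)
      have "s / (z - b) * (\<rho> a / (z - a)) = s * \<rho> a * (1 / (z - b) * (1 / (z - a)))" by simp
      also have "\<dots> = s * \<rho> a / (a - b) / (z - a) + s / (z - b) * (\<rho> a / (b - a))"
        unfolding e1 by (simp add: algebra_simps)
      finally show "\<rho> a / (z - a) + s / (z - b) * (\<rho> a / (z - a)) = \<sigma> a / (z - a) + s / (z - b) * (\<rho> a / (b - a))"
        using neq by (simp add: \<sigma>_def add_divide_distrib)
    qed
    also have "1 + s / (z - b) + (\<Sum>a\<in>A. \<sigma> a / (z - a) + s / (z - b) * (\<rho> a / (b - a)))
       = 1 + (\<Sum>a\<in>insert b A. \<sigma> a / (z - a))"
      using insert.hyps
      by (simp add: \<sigma>_def sum.distrib sum_distrib_left ring_distribs add_divide_distrib sum_divide_distrib mult_ac)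
    finally show ?thesis .
  qed
  then show ?case by blast
qed

text \<open>The coefficient at \<open>l\<close> is the limit of \<open>z - l\<close> times the function.\<close>

lemma partial_fractions_blaschke_coeff:
  assumes A: "finite A" and l: "l \<in> A"
    and pf: "\<And>z. z \<notin> A \<Longrightarrow> (\<Prod>a\<in>A. z - cnj a) / (\<Prod>a\<in>A. z - a) = 1 + (\<Sum>a\<in>A. \<rho> a / (z - a))"
  shows "\<rho> l = (\<Prod>a\<in>A. l - cnj a) / (\<Prod>a\<in>A - {l}. l - a)"
proof -
  have ev: "eventually (\<lambda>z. z \<notin> A) (at l)"
  proof -
    have "eventually (\<lambda>z. z \<in> - (A - {l})) (at l)"
      by (intro eventually_at_in_open' open_Compl finite_imp_closed finite_Diff A) simp
    moreover have "eventually (\<lambda>z. z \<noteq> l) (at l)" by (simp add: eventually_at_filter)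
    ultimately show ?thesis by eventually_elim auto
  qed
  have nz: "(\<Prod>a\<in>A - {l}. l - a) \<noteq> 0" using A by auto
  have L1: "((\<lambda>z. (\<Prod>a\<in>A. z - cnj a) / (\<Prod>a\<in>A - {l}. z - a)) \<longlongrightarrow> (\<Prod>a\<in>A. l - cnj a) / (\<Prod>a\<in>A - {l}. l - a)) (at l)"
    by (intro tendsto_intros nz)
  have L2: "((\<lambda>z. (z - l) * (1 + (\<Sum>a\<in>A - {l}. \<rho> a / (z - a))) + \<rho> l) \<longlongrightarrow>
       (l - l) * (1 + (\<Sum>a\<in>A - {l}. \<rho> a / (l - a))) + \<rho> l) (at l)"
    by (intro tendsto_intros) auto
  have EV: "eventually (\<lambda>z. (\<Prod>a\<in>A. z - cnj a) / (\<Prod>a\<in>A - {l}. z - a)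
       = (z - l) * (1 + (\<Sum>a\<in>A - {l}. \<rho> a / (z - a))) + \<rho> l) (at l)"
    using ev
  proof eventually_elim
    case (elim z)
    then have zl: "z - l \<noteq> 0" using l by auto
    have "(\<Prod>a\<in>A. z - cnj a) / (\<Prod>a\<in>A - {l}. z - a) = (z - l) * ((\<Prod>a\<in>A. z - cnj a) / (\<Prod>a\<in>A. z - a))"
      using zl by (simp add: prod.remove[OF A l, of "\<lambda>a. z - a"])
    also have "\<dots> = (z - l) * (1 + (\<rho> l / (z - l) + (\<Sum>a\<in>A - {l}. \<rho> a / (z - a))))"
      using pf[OF elim] sum.remove[OF A l, of "\<lambda>a. \<rho> a / (z - a)"] by simp
    also have "\<dots> = (z - l) * (1 + (\<Sum>a\<in>A - {l}. \<rho> a / (z - a))) + \<rho> l"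
      using zl by (simp add: field_simps)
    finally show ?case .
  qed
  have "\<rho> l = (l - l) * (1 + (\<Sum>a\<in>A - {l}. \<rho> a / (l - a))) + \<rho> l" by simp
  also have "\<dots> = (\<Prod>a\<in>A. l - cnj a) / (\<Prod>a\<in>A - {l}. l - a)"
    by (rule tendsto_unique[OF _ L2 Lim_transform_eventually[OF L1 EV]]) simp
  finally show ?thesis .
qed

locale interpolated_function = zeros_in_upper_half_plane +
  fixes F :: "complex \<Rightarrow> complex" and B :: real
  assumes F_entire: "F holomorphic_on UNIV"
    and F_bound: "\<And>z. cmod (F z) \<le> B * exp (pi * \<bar>Im z\<bar>)"
    and F_int: "integrable lborel (\<lambda>x::real. (cmod (F (of_real x)))\<^sup>2)"
begin

text \<open>The integrable majorant for the passage to the limit under the integral sign.\<close>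

definition u :: "real \<Rightarrow> real" where
  "u x = cmod (F (of_real x)) / cmod (G (of_real x)) / (1 + \<bar>x\<bar>)"

lemma F_cont: "continuous_on UNIV (\<lambda>x::real. F (of_real x))"
  using holomorphic_on_imp_continuous_on[OF F_entire]
  by (rule continuous_on_compose2) (auto intro!: continuous_intros)

lemma G_cont: "continuous_on UNIV (\<lambda>x::real. G (of_real x))"
  using holomorphic_on_imp_continuous_on[OF entire]
  by (rule continuous_on_compose2) (auto intro!: continuous_intros)

lemma u_cont: "continuous_on UNIV u"
  unfolding u_def using G_real by (intro continuous_intros F_cont G_cont) auto

lemma u_integrable: "integrable lborel u"
proof (rule Bochner_Integration.integrable_bound)
  show "integrable lborel (\<lambda>x::real. (cmod (F (of_real x)))\<^sup>2 + 1 / ((cmod (G (of_real x)))\<^sup>2 * (1 + \<bar>x\<bar>\<^sup>2)))"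
    by (rule Bochner_Integration.integrable_add[OF F_int recip_int])
  show "u \<in> borel_measurable lborel" using borel_measurable_continuous_onI[OF u_cont] by simp
  have "norm (u x) \<le> norm ((cmod (F (of_real x)))\<^sup>2 + 1 / ((cmod (G (of_real x)))\<^sup>2 * (1 + \<bar>x\<bar>\<^sup>2)))" for x
  proof -
    define p where "p = cmod (F (of_real x))"
    define q where "q = 1 / (cmod (G (of_real x)) * (1 + \<bar>x\<bar>))"
    have Gp: "cmod (G (of_real x)) > 0" using G_real[of x] by simp
    have ux: "u x = p * q" by (simp add: u_def p_def q_def)
    have pq: "p \<ge> 0" "q \<ge> 0" by (auto simp: p_def q_def)
    have "p * q \<le> p\<^sup>2 + q\<^sup>2" using sum_squares_bound[of p q] mult_nonneg_nonneg[OF pq] by linarith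
    also have "q\<^sup>2 \<le> 1 / ((cmod (G (of_real x)))\<^sup>2 * (1 + \<bar>x\<bar>\<^sup>2))"
    proof -
      have "1 + \<bar>x\<bar>\<^sup>2 \<le> (1 + \<bar>x\<bar>)\<^sup>2" by (simp add: power2_eq_square algebra_simps)
      then show ?thesis unfolding q_def power_divide power_mult_distrib using Gp
        by (intro frac_le mult_left_mono mult_pos_pos) (auto intro: add_pos_nonneg)
    qed
    finally have le: "u x \<le> p\<^sup>2 + 1 / ((cmod (G (of_real x)))\<^sup>2 * (1 + \<bar>x\<bar>\<^sup>2))" by (simp add: ux)
    have "0 \<le> u x" using pq by (simp add: ux)
    then show ?thesis using le by (simp add: p_def)
  qed
  then show "AE x in lborel. norm (u x) \<le> norm ((cmod (F (of_real x)))\<^sup>2 + 1 / ((cmod (G (of_real x)))\<^sup>2 * (1 + \<bar>x\<bar>\<^sup>2)))"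
    by auto
qed

lemma quotient_holomorphic: "(\<lambda>z. F z / reflect G z) holomorphic_on {z. - d < Im z}"
  using reflect_G_nz
  by (intro holomorphic_intros holomorphic_on_subset[OF F_entire]
        holomorphic_on_subset[OF reflect_holomorphic[OF entire]]) auto

lemma quotient_growth: "pl_growth (\<lambda>z. F z / reflect G z)"
proof -
  have "pl_growth (\<lambda>z. F z * exp (\<i> * of_real pi * z))"
  proof (rule pl_growth_poly[where k = 0 and C = B])
    fix z assume z: "0 \<le> Im z"
    have "cmod (F z) * exp (- pi * Im z) \<le> B * exp (pi * \<bar>Im z\<bar>) * exp (- pi * Im z)"
      using F_bound[of z] by (intro mult_right_mono) auto
    then show "cmod (F z * exp (\<i> * of_real pi * z)) \<le> B * (1 + cmod z) ^ 0"
      using z by (simp add: norm_mult mult.assoc exp_add[symmetric])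
  qed
  from pl_growth_mult[OF this recip] show ?thesis by (rule pl_growth_mono) simp
qed

lemma quotient_integrable: "integrable lborel (\<lambda>x. cmod (F (of_real x) / reflect G (of_real x)) / (1 + \<bar>x\<bar>))"
  using u_integrable by (simp add: u_def[abs_def] norm_divide)

lemma cauchy_quotient:
  "Im z < 0 \<Longrightarrow> (LINT x|lborel. F (of_real x) / reflect G (of_real x) / (of_real x - z)) = 0"
  "0 < Im z \<Longrightarrow> (LINT x|lborel. F (of_real x) / reflect G (of_real x) / (of_real x - z))
      = 2 * of_real pi * \<i> * (F z / reflect G z)"
  using cauchy_half_plane[OF quotient_holomorphic d quotient_growth quotient_integrable] by blast+

lemma quotient_kernel_integrable:
  assumes "Im z \<noteq> 0"
  shows "integrable lborel (\<lambda>x. F (of_real x) / reflect G (of_real x) / (of_real x - z))"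
proof (rule cauchy_kernel_integrable[OF _ quotient_integrable assms])
  have "continuous_on UNIV (\<lambda>x::real. reflect G (of_real x))"
    unfolding reflect_def using G_cont by (auto intro!: continuous_intros)
  then show "(\<lambda>x. F (of_real x) / reflect G (of_real x)) \<in> borel_measurable borel"
    using reflect_G_nz d by (intro borel_measurable_continuous_onI continuous_intros F_cont) auto
qed

definition S :: "nat \<Rightarrow> complex \<Rightarrow> complex" where
  "S n z = (\<Sum>l\<in>Z n. W n l * F l * lagrange_fun G l z)"

text \<open>On the real line \<open>W\<^sub>n F / G\<close> equals \<open>\<kappa> (F / G\<^sup>*) (p\<^sup>* / p)\<close>. Expanding \<open>p\<^sup>* / p\<close> in partial fractions reduces the
integral to Cauchy integrals of \<open>F / G\<^sup>*\<close> at \<open>z\<close> and at the zeros, and the residues turn out to be the terms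
of the interpolation sum.\<close>

lemma sum_as_integral:
  assumes z: "Im z \<noteq> 0" and Gz: "G z \<noteq> 0"
  shows "G z * (LINT x|lborel. W n (of_real x) * F (of_real x) / G (of_real x) / (of_real x - z))
      = 2 * of_real pi * \<i> * ((if 0 < Im z then W n z * F z else 0) - S n z)"
proof -
  define k where "k = cnj (g n 0) / g n 0"
  define q where "q w = F w / reflect G w" for w
  define K where "K w = (LINT x|lborel. q (of_real x) / (of_real x - w))" for w
  define r where "r w = (\<Prod>a\<in>Z n. w - cnj a) / (\<Prod>a\<in>Z n. w - a)" for w
  have zZ: "z \<notin> Z n" using Gz by (auto simp: Z_def)
  obtain \<rho> where \<rho>: "\<And>w. w \<notin> Z n \<Longrightarrow> r w = 1 + (\<Sum>a\<in>Z n. \<rho> a / (w - a))"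
    using partial_fractions_blaschke[OF finite_Z[of n]] unfolding r_def by blast
  have \<rho>_eq: "\<rho> l = (\<Prod>a\<in>Z n. l - cnj a) / (\<Prod>a\<in>Z n - {l}. l - a)" if "l \<in> Z n" for l
    by (rule partial_fractions_blaschke_coeff[OF finite_Z that]) (use \<rho> in \<open>simp add: r_def\<close>)
  have Wq: "W n w * F w / G w = k * (q w * r w)" if "- d < Im w" "G w \<noteq> 0" for w
  proof -
    have "g n w \<noteq> 0" "(\<Prod>a\<in>Z n. w - a) \<noteq> 0" using that(2) G_eq[of w n] by auto
    moreover have "(\<Prod>a\<in>Z n. w - cnj a) \<noteq> 0" "reflect (g n) w \<noteq> 0"
      using reflect_G_nz[OF that(1)] reflect_G_eq[of w n] by auto
    ultimately show ?thesis
      unfolding W_def k_def[symmetric] q_def r_def G_eq[of w n] reflect_G_eq[of w n] by simp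
  qed
  have res: "k * q l * \<rho> l = W n l * F l / deriv G l" if l: "l \<in> Z n" for l
  proof -
    have Iml: "0 < Im l" by (rule Im_Z[OF l])
    then have rG: "reflect G l \<noteq> 0" using reflect_G_nz[of l] d by simp
    have "(\<Prod>a\<in>Z n. l - cnj a) \<noteq> 0" "reflect (g n) l \<noteq> 0"
      using rG reflect_G_eq[of l n] by auto
    moreover have "g n l \<noteq> 0" using l by (intro g_nz) (simp add: Z_def)
    ultimately show ?thesis
      unfolding \<rho>_eq[OF l] deriv_G_zero[OF l] W_def k_def[symmetric] q_def reflect_G_eq[of l n] by simp
  qed
  \<comment> \<open>Partial fractions of \<open>r(x) / (x - z)\<close>, obtained from \<open>r(x) - r(z)\<close>.\<close>
  have kernel: "W n (of_real x) * F (of_real x) / G (of_real x) / (of_real x - z)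
     = k * (r z * (q (of_real x) / (of_real x - z)) + (\<Sum>l\<in>Z n. \<rho> l / (l - z) * (q (of_real x) / (of_real x - l))))" for x
  proof -
    define t where "t = (of_real x :: complex)"
    have tz: "t - z \<noteq> 0" using z by (auto simp: t_def)
    have tZ: "t - l \<noteq> 0" if "l \<in> Z n" for l using Im_Z[OF that] by (auto simp: t_def)
    have lz: "l - z \<noteq> 0" if "l \<in> Z n" for l using that zZ by auto
    have tn: "t \<notin> Z n" using G_real[of x] by (auto simp: t_def Z_def)
    have "r t / (t - z) = r z / (t - z) + (\<Sum>l\<in>Z n. \<rho> l / (l - z) * (1 / (t - l)))"
    proof -
      have "r t - r z = (\<Sum>l\<in>Z n. \<rho> l / (t - l) - \<rho> l / (z - l))"
        unfolding \<rho>[OF tn] \<rho>[OF zZ] by (simp add: sum_subtractf)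
      also have "\<dots> = (\<Sum>l\<in>Z n. (\<rho> l / (l - z) * (1 / (t - l))) * (t - z))"
      proof (rule sum.cong[OF refl])
        fix l assume l: "l \<in> Z n"
        have "z - l \<noteq> 0" using lz[OF l] by simp
        then show "\<rho> l / (t - l) - \<rho> l / (z - l) = (\<rho> l / (l - z) * (1 / (t - l))) * (t - z)"
          using tZ[OF l] lz[OF l] by (simp add: divide_simps) (simp add: algebra_simps)
      qed
      also have "\<dots> = (\<Sum>l\<in>Z n. \<rho> l / (l - z) * (1 / (t - l))) * (t - z)" by (simp add: sum_distrib_right)
      finally show ?thesis using tz by (simp add: field_simps)
    qed
    then have "k * (q t * (r t / (t - z))) = k * (q t * (r z / (t - z) + (\<Sum>l\<in>Z n. \<rho> l / (l - z) * (1 / (t - l)))))"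
      by simp
    moreover have "W n t * F t / G t / (t - z) = k * (q t * (r t / (t - z)))"
      using Wq[of t] d G_real[of x] by (simp add: t_def)
    ultimately show ?thesis
      by (simp add: t_def[symmetric] distrib_left sum_distrib_left mult_ac)
  qed
  have Ki: "integrable lborel (\<lambda>x. q (of_real x) / (of_real x - w))" if "Im w \<noteq> 0" for w
    unfolding q_def by (rule quotient_kernel_integrable[OF that])
  have Kl: "K l = 2 * of_real pi * \<i> * q l" if "l \<in> Z n" for l
    unfolding K_def q_def using Im_Z[OF that] by (rule cauchy_quotient(2))
  have Kz: "K z = (if 0 < Im z then 2 * of_real pi * \<i> * q z else 0)"
    unfolding K_def q_def using cauchy_quotient[of z] z by auto
  have Kli: "integrable lborel (\<lambda>x. q (of_real x) / (of_real x - l))" if "l \<in> Z n" for l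
    using Im_Z[OF that] by (intro Ki) simp
  have "(LINT x|lborel. W n (of_real x) * F (of_real x) / G (of_real x) / (of_real x - z))
     = k * (r z * K z + (\<Sum>l\<in>Z n. \<rho> l / (l - z) * K l))"
  proof -
    have i1: "integrable lborel (\<lambda>x. r z * (q (of_real x) / (of_real x - z)))"
      by (intro integrable_mult_right Ki z)
    have i2: "integrable lborel (\<lambda>x. \<Sum>l\<in>Z n. \<rho> l / (l - z) * (q (of_real x) / (of_real x - l)))"
      by (intro Bochner_Integration.integrable_sum integrable_mult_right Kli)
    have "(LINT x|lborel. (\<Sum>l\<in>Z n. \<rho> l / (l - z) * (q (of_real x) / (of_real x - l))))
        = (\<Sum>l\<in>Z n. (LINT x|lborel. \<rho> l / (l - z) * (q (of_real x) / (of_real x - l))))"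
      by (intro Bochner_Integration.integral_sum integrable_mult_right Kli)
    then show ?thesis
      unfolding kernel K_def
      by (simp only: integral_mult_right_zero Bochner_Integration.integral_add[OF i1 i2])
  qed
  also have "(\<Sum>l\<in>Z n. \<rho> l / (l - z) * K l) = (\<Sum>l\<in>Z n. \<rho> l / (l - z) * (2 * of_real pi * \<i> * q l))"
    by (rule sum.cong) (simp_all add: Kl)
  finally have I_eq: "(LINT x|lborel. W n (of_real x) * F (of_real x) / G (of_real x) / (of_real x - z))
     = k * (r z * K z + (\<Sum>l\<in>Z n. \<rho> l / (l - z) * (2 * of_real pi * \<i> * q l)))" .
  have "G z * (LINT x|lborel. W n (of_real x) * F (of_real x) / G (of_real x) / (of_real x - z))
     = G z * (k * (r z * K z)) + (\<Sum>l\<in>Z n. 2 * of_real pi * \<i> * (G z * (k * q l * \<rho> l) / (l - z)))"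
    unfolding I_eq by (simp add: distrib_left sum_distrib_left mult_ac)
  also have "(\<Sum>l\<in>Z n. 2 * of_real pi * \<i> * (G z * (k * q l * \<rho> l) / (l - z))) = - (2 * of_real pi * \<i> * S n z)"
  proof -
    have "2 * of_real pi * \<i> * (G z * (k * q l * \<rho> l) / (l - z)) = - (2 * of_real pi * \<i> * (W n l * F l * lagrange_fun G l z))"
      if l: "l \<in> Z n" for l
    proof -
      have neq: "z \<noteq> l" using l zZ by auto
      have "G z * (W n l * F l / deriv G l) / (l - z) = - (W n l * F l * (G z / (deriv G l * (z - l))))"
      proof -
        have "l - z = - (z - l)" by simp
        show ?thesis unfolding \<open>l - z = - (z - l)\<close> divide_minus_right by (simp add: mult_ac)
      qed
      then show ?thesis unfolding res[OF l] lagrange_fun_def using neq by simp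
    qed
    then show ?thesis by (simp add: S_def sum_distrib_left sum_negf)
  qed
  also have "G z * (k * (r z * K z)) = 2 * of_real pi * \<i> * (if 0 < Im z then W n z * F z else 0)"
  proof (cases "0 < Im z")
    case True
    then have "W n z * F z / G z = k * (q z * r z)" using Gz d by (intro Wq) auto
    then have "W n z * F z = G z * (k * (q z * r z))" using Gz by (simp add: field_simps)
    then show ?thesis using True by (simp add: Kz mult_ac)
  qed (simp add: Kz)
  finally show ?thesis by (simp add: right_diff_distrib)
qed

end

section \<open>Convergence of the interpolation sums\<close>

lemma lagrange_fun_holomorphic:
  assumes G: "G holomorphic_on UNIV" and l: "G l = 0" "deriv G l \<noteq> 0"
  shows "lagrange_fun G l holomorphic_on UNIV"
proof -
  have "(\<lambda>z. deriv G l * lagrange_fun G l z) holomorphic_on UNIV"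
    by (rule pole_theorem_open_0[OF G, of l]) (use l in \<open>auto simp: lagrange_fun_def\<close>)
  then have "(\<lambda>z. deriv G l * lagrange_fun G l z / deriv G l) holomorphic_on UNIV"
    by (rule holomorphic_on_divide[OF _ holomorphic_on_const]) (rule l)
  moreover have "(\<lambda>z. deriv G l * lagrange_fun G l z / deriv G l) = lagrange_fun G l"
    using l by (intro ext) simp
  ultimately show ?thesis by (simp only:)
qed

context interpolated_function
begin

lemma interpolated_function_reflect: "interpolated_function G d C (reflect F) B"
proof unfold_locales
  show "reflect F holomorphic_on UNIV" by (rule reflect_holomorphic[OF F_entire])
  show "cmod (reflect F z) \<le> B * exp (pi * \<bar>Im z\<bar>)" for z
    using F_bound[of "cnj z"] by (simp add: norm_reflect)
  show "integrable lborel (\<lambda>x::real. (cmod (reflect F (of_real x)))\<^sup>2)" using F_int by simp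
qed

text \<open>Cauchy's formula for \<open>F / G\<close> in the lower half-plane, obtained by conjugating the one for \<open>F\<^sup>* / G\<^sup>*\<close> in the
upper half-plane.\<close>

lemma F_as_integral:
  assumes z: "Im z \<noteq> 0" and Gz: "G z \<noteq> 0"
  shows "integrable lborel (\<lambda>x. F (of_real x) / G (of_real x) / (of_real x - z))"
    and "G z * (LINT x|lborel. F (of_real x) / G (of_real x) / (of_real x - z))
      = 2 * of_real pi * \<i> * ((if 0 < Im z then F z else 0) - F z)"
proof -
  interpret R: interpolated_function G d C "reflect F" B by (rule interpolated_function_reflect)
  have eq: "F (of_real x) / G (of_real x) / (of_real x - z)
     = cnj (reflect F (of_real x) / reflect G (of_real x) / (of_real x - cnj z))" for x
    by (simp add: reflect_def)
  have Rz: "Im (cnj z) \<noteq> 0" using z by simp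
  show "integrable lborel (\<lambda>x. F (of_real x) / G (of_real x) / (of_real x - z))"
    unfolding eq complex_integrable_cnj by (rule R.quotient_kernel_integrable[OF Rz])
  have "(LINT x|lborel. F (of_real x) / G (of_real x) / (of_real x - z))
     = cnj (LINT x|lborel. reflect F (of_real x) / reflect G (of_real x) / (of_real x - cnj z))"
    unfolding eq by (rule Bochner_Integration.integral_cnj)
  also have "\<dots> = cnj (if 0 < Im z then 0 else 2 * of_real pi * \<i> * (reflect F (cnj z) / reflect G (cnj z)))"
    using R.cauchy_quotient[of "cnj z"] z by auto
  also have "\<dots> = (if 0 < Im z then 0 else - (2 * of_real pi * \<i> * (F z / G z)))"
    by (simp add: reflect_def)
  finally show "G z * (LINT x|lborel. F (of_real x) / G (of_real x) / (of_real x - z))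
      = 2 * of_real pi * \<i> * ((if 0 < Im z then F z else 0) - F z)" using Gz by simp
qed

definition defect :: "nat \<Rightarrow> real" where
  "defect n = (LINT x|lborel. cmod (W n (of_real x) - 1) * u x)"

lemma u_nonneg: "0 \<le> u x"
  by (simp add: u_def)

lemma W_real_cont: "continuous_on UNIV (\<lambda>x::real. W n (of_real x))"
  using holomorphic_on_imp_continuous_on[OF W_holomorphic]
  by (rule continuous_on_compose2) (use d in \<open>auto intro!: continuous_intros\<close>)

lemma W_minus_1_u_le: "cmod (W n (of_real x) - 1) * u x \<le> 2 * u x"
proof -
  have "cmod (W n (of_real x) - 1) \<le> 2"
    using norm_triangle_ineq4[of "W n (of_real x)" 1] by (simp add: norm_W_real)
  then show ?thesis using u_nonneg by (intro mult_right_mono) auto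
qed

lemma defect_meas: "(\<lambda>x. cmod (W n (of_real x) - 1) * u x) \<in> borel_measurable lborel"
proof -
  have "continuous_on UNIV (\<lambda>x. cmod (W n (of_real x) - 1) * u x)"
    by (intro continuous_intros W_real_cont u_cont)
  then show ?thesis using borel_measurable_continuous_onI by auto
qed

lemma defect_integrable: "integrable lborel (\<lambda>x. cmod (W n (of_real x) - 1) * u x)"
proof (rule Bochner_Integration.integrable_bound)
  show "integrable lborel (\<lambda>x. 2 * u x)" by (intro integrable_mult_right u_integrable)
  show "AE x in lborel. norm (cmod (W n (of_real x) - 1) * u x) \<le> norm (2 * u x)"
    using W_minus_1_u_le u_nonneg by (auto simp: abs_mult)
qed (rule defect_meas)

lemma defect_tendsto_0: "defect \<longlonglongrightarrow> 0"
proof -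
  have "(\<lambda>n. LINT x|lborel. cmod (W n (of_real x) - 1) * u x) \<longlonglongrightarrow> integral\<^sup>L lborel (\<lambda>x::real. 0::real)"
  proof (rule integral_dominated_convergence[where w = "\<lambda>x. 2 * u x"])
    show "integrable lborel (\<lambda>x. 2 * u x)" by (intro integrable_mult_right u_integrable)
    show "AE x in lborel. (\<lambda>n. cmod (W n (of_real x) - 1) * u x) \<longlonglongrightarrow> 0"
    proof (rule AE_I2)
      fix x :: real
      have "(\<lambda>n. W n (of_real x)) \<longlonglongrightarrow> 1"
        by (rule tendsto_uniform_limitI[OF W_uniform_limit[of "\<bar>x\<bar>"]]) simp
      then have "(\<lambda>n. cmod (W n (of_real x) - 1) * u x) \<longlonglongrightarrow> cmod (1 - 1) * u x"
        by (intro tendsto_intros)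
      then show "(\<lambda>n. cmod (W n (of_real x) - 1) * u x) \<longlonglongrightarrow> 0" by simp
    qed
    show "AE x in lborel. norm (cmod (W n (of_real x) - 1) * u x) \<le> 2 * u x" for n
      using W_minus_1_u_le u_nonneg by (auto simp: abs_mult)
  qed (use defect_meas in auto)
  then show ?thesis by (simp add: defect_def[abs_def])
qed

text \<open>The difference of the two integral representations. Multiplying by \<open>\<bar>Im z\<bar>\<close> removes the singularity of
the Cauchy kernel at the real line.\<close>

lemma error_bound:
  assumes z: "Im z \<noteq> 0" and Gz: "G z \<noteq> 0" and r: "cmod z \<le> r"
  shows "\<bar>Im z\<bar> * cmod (S n z - F z)
     \<le> \<bar>Im z\<bar> * (cmod (W n z - 1) * cmod (F z)) + cmod (G z) * (1 + 2 * r) * defect n"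
proof -
  define I where "I = (LINT x|lborel. W n (of_real x) * F (of_real x) / G (of_real x) / (of_real x - z))"
  define J where "J = (LINT x|lborel. F (of_real x) / G (of_real x) / (of_real x - z))"
  define h where "h x = (W n (of_real x) - 1) * (F (of_real x) / G (of_real x) / (of_real x - z))" for x
  have r0: "r \<ge> 0" using r norm_ge_zero[of z] by linarith
  have y: "\<bar>Im z\<bar> > 0" using z by simp
  have Ji: "integrable lborel (\<lambda>x. F (of_real x) / G (of_real x) / (of_real x - z))"
    by (rule F_as_integral(1)[OF z Gz])
  have hb: "cmod (h x) \<le> (1 + 2 * r) / \<bar>Im z\<bar> * (cmod (W n (of_real x) - 1) * u x)" for x
  proof -
    have "cmod (h x) = cmod (W n (of_real x) - 1) * (cmod (F (of_real x)) / cmod (G (of_real x))) * (1 / cmod (of_real x - z))"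
      by (simp add: h_def norm_mult norm_divide)
    also have "\<dots> \<le> cmod (W n (of_real x) - 1) * (cmod (F (of_real x)) / cmod (G (of_real x))) * ((1 + 2 * r) / \<bar>Im z\<bar> / (1 + \<bar>x\<bar>))"
      by (intro mult_left_mono inverse_distance_bound z r) auto
    finally show ?thesis by (simp add: u_def mult_ac)
  qed
  have bi: "integrable lborel (\<lambda>x. (1 + 2 * r) / \<bar>Im z\<bar> * (cmod (W n (of_real x) - 1) * u x))"
    by (intro integrable_mult_right defect_integrable)
  have hc: "continuous_on UNIV h"
    unfolding h_def using G_real z by (intro continuous_intros F_cont G_cont W_real_cont) (auto simp: complex_eq_iff)
  have hi: "integrable lborel h"
  proof (rule Bochner_Integration.integrable_bound[OF bi])
    show "h \<in> borel_measurable lborel" using borel_measurable_continuous_onI[OF hc] by simp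
    show "AE x in lborel. norm (h x) \<le> norm ((1 + 2 * r) / \<bar>Im z\<bar> * (cmod (W n (of_real x) - 1) * u x))"
      unfolding real_norm_def by (intro AE_I2 order_trans[OF hb abs_ge_self])
  qed
  have "I = (LINT x|lborel. h x + F (of_real x) / G (of_real x) / (of_real x - z))"
    unfolding I_def by (rule Bochner_Integration.integral_cong) (simp_all add: h_def algebra_simps diff_divide_distrib)
  also have "\<dots> = (LINT x|lborel. h x) + J" unfolding J_def by (rule Bochner_Integration.integral_add[OF hi Ji])
  finally have IJ: "I - J = (LINT x|lborel. h x)" by simp
  have "cmod (I - J) \<le> (LINT x|lborel. cmod (h x))" unfolding IJ by (rule integral_norm_bound)
  also have "\<dots> \<le> (LINT x|lborel. (1 + 2 * r) / \<bar>Im z\<bar> * (cmod (W n (of_real x) - 1) * u x))"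
    by (intro integral_mono integrable_norm hi bi hb)
  also have "\<dots> = (1 + 2 * r) / \<bar>Im z\<bar> * defect n" by (simp add: defect_def)
  finally have dIJ: "\<bar>Im z\<bar> * cmod (I - J) \<le> (1 + 2 * r) * defect n" using y by (simp add: field_simps)
  have "2 * of_real pi * \<i> * (S n z - F z)
     = 2 * of_real pi * \<i> * (if 0 < Im z then (W n z - 1) * F z else 0) - G z * (I - J)"
    using sum_as_integral[OF z Gz, of n] F_as_integral(2)[OF z Gz] unfolding I_def J_def
    by (simp add: algebra_simps split: if_splits)
  then have "cmod (2 * of_real pi * \<i> * (S n z - F z))
     \<le> cmod (2 * of_real pi * \<i> * (if 0 < Im z then (W n z - 1) * F z else 0)) + cmod (G z * (I - J))"
    by (metis norm_triangle_ineq4)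
  then have "2 * pi * cmod (S n z - F z) \<le> 2 * pi * cmod (if 0 < Im z then (W n z - 1) * F z else 0) + cmod (G z) * cmod (I - J)"
    by (simp add: norm_mult)
  also have "\<dots> \<le> 2 * pi * (cmod (W n z - 1) * cmod (F z)) + 2 * pi * (cmod (G z) * cmod (I - J))"
  proof (intro add_mono mult_left_mono)
    show "cmod (if 0 < Im z then (W n z - 1) * F z else 0) \<le> cmod (W n z - 1) * cmod (F z)" by (simp add: norm_mult)
    have "1 * (cmod (G z) * cmod (I - J)) \<le> 2 * pi * (cmod (G z) * cmod (I - J))"
      using pi_ge_two by (intro mult_right_mono) auto
    then show "cmod (G z) * cmod (I - J) \<le> 2 * pi * (cmod (G z) * cmod (I - J))" by simp
  qed auto
  also have "\<dots> = 2 * pi * (cmod (W n z - 1) * cmod (F z) + cmod (G z) * cmod (I - J))" by (simp only: distrib_left)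
  finally have "cmod (S n z - F z) \<le> cmod (W n z - 1) * cmod (F z) + cmod (G z) * cmod (I - J)"
    using pi_gt_zero by (simp only: mult_le_cancel_left_pos mult_pos_pos zero_less_numeral)
  from mult_left_mono[OF this abs_ge_zero[of "Im z"]]
  have "\<bar>Im z\<bar> * cmod (S n z - F z) \<le> \<bar>Im z\<bar> * (cmod (W n z - 1) * cmod (F z)) + cmod (G z) * (\<bar>Im z\<bar> * cmod (I - J))"
    by (simp add: distrib_left mult.left_commute[of "cmod (G z)"])
  also have "cmod (G z) * (\<bar>Im z\<bar> * cmod (I - J)) \<le> cmod (G z) * ((1 + 2 * r) * defect n)"
    by (intro mult_left_mono dIJ) auto
  finally show ?thesis by (simp add: mult.assoc)
qed

lemma S_holomorphic: "S n holomorphic_on UNIV"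
  unfolding S_def[abs_def]
  by (intro holomorphic_intros lagrange_fun_holomorphic entire) (auto simp: Z_def simple)

lemma defect_nonneg: "0 \<le> defect n"
  unfolding defect_def by (intro integral_nonneg_AE) (simp add: u_nonneg)

text \<open>On \<open>\<bar>z\<bar> = r\<close> the factor \<open>z\<^sup>2 - r\<^sup>2 = z (z - cnj z)\<close> has modulus \<open>2 r \<bar>Im z\<bar>\<close>, which compensates the blow-up of
the error bound; the maximum principle then gives uniform convergence inside the disc.\<close>

lemma S_uniform_limit:
  assumes K: "compact K"
  shows "uniform_limit K S F sequentially"
proof -
  obtain r0 where r0: "r0 \<ge> 0" "\<And>z. z \<in> K \<Longrightarrow> cmod z \<le> r0"
  proof -
    obtain b where b: "\<And>z. z \<in> K \<Longrightarrow> cmod z \<le> b"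
      using compact_imp_bounded[OF K] by (auto simp: bounded_iff)
    show thesis by (rule that[of "max b 0"]) (use b in \<open>auto simp: le_max_iff_disj\<close>)
  qed
  \<comment> \<open>The radius avoids the moduli of the zeros, since the error bound is available only where \<open>G z\<close> is not zero.\<close>
  have "finite (cmod ` {z. G z = 0 \<and> cmod z \<le> r0 + 2})" by (intro finite_imageI finite_zeros)
  moreover have "infinite {r0 + 1<..<r0 + 2}" by (rule infinite_Ioo) simp
  ultimately have "\<not> {r0 + 1<..<r0 + 2} \<subseteq> cmod ` {z. G z = 0 \<and> cmod z \<le> r0 + 2}"
    by (meson finite_subset)
  then obtain r where "r \<in> {r0 + 1<..<r0 + 2}" "r \<notin> cmod ` {z. G z = 0 \<and> cmod z \<le> r0 + 2}"
    by blast
  then have r: "r0 + 1 < r" "r < r0 + 2" "r \<notin> cmod ` {z. G z = 0 \<and> cmod z \<le> r0 + 2}" by simp_all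
  have Gr: "G z \<noteq> 0" if "cmod z = r" for z using r that by auto
  have "bounded (F ` cball 0 r)" "bounded (G ` cball 0 r)"
    by (intro compact_imp_bounded compact_continuous_image compact_cball
        continuous_on_subset[OF holomorphic_on_imp_continuous_on[OF F_entire]]
        continuous_on_subset[OF holomorphic_on_imp_continuous_on[OF entire]] subset_UNIV)+
  then obtain BF BG where B: "\<And>z. cmod z \<le> r \<Longrightarrow> cmod (F z) \<le> BF" "\<And>z. cmod z \<le> r \<Longrightarrow> cmod (G z) \<le> BG"
    by (force simp: bounded_iff)
  have B0: "BF \<ge> 0" "BG \<ge> 0"
    using B[of 0] r r0 norm_ge_zero[of "F 0"] norm_ge_zero[of "G 0"] by (auto simp del: norm_ge_zero)
  show ?thesis
  proof (rule uniform_limitI)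
    fix e :: real assume e: "e > 0"
    \<comment> \<open>The summand one keeps \<open>c1\<close> and \<open>c2\<close> positive when \<open>BF\<close> or \<open>BG\<close> is zero.\<close>
    define c1 where "c1 = 2 * r * (r * BF) + 1"
    define c2 where "c2 = 2 * r * (BG * (1 + 2 * r)) + 1"
    have c: "c1 > 0" "c2 > 0" using r r0 B0 by (auto simp: c1_def c2_def intro!: add_nonneg_pos mult_nonneg_nonneg)
    have "eventually (\<lambda>n. \<forall>z\<in>cball 0 r. dist (W n z) 1 < e / (4 * c1)) sequentially"
      using W_uniform_limit[of r] e c by (intro uniform_limitD) auto
    moreover have "eventually (\<lambda>n. defect n < e / (4 * c2)) sequentially"
      using order_tendstoD(2)[OF defect_tendsto_0, of "e / (4 * c2)"] e c by simp
    ultimately show "eventually (\<lambda>n. \<forall>z\<in>K. dist (S n z) (F z) < e) sequentially"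
    proof eventually_elim
      case (elim n)
      define D where "D z = (S n z - F z) * (z\<^sup>2 - of_real (r\<^sup>2))" for z
      have Dh: "D holomorphic_on UNIV" unfolding D_def by (intro holomorphic_intros S_holomorphic F_entire)
      have bd: "cmod (D z) \<le> e / 2" if z: "cmod z = r" for z
      proof (cases "Im z = 0")
        case True
        then have "z = of_real (Re z)" "\<bar>Re z\<bar> = r" using z by (auto simp: complex_eq_iff cmod_eq_Re)
        then have "z\<^sup>2 = of_real (r\<^sup>2)" by (metis of_real_power power2_abs)
        then show ?thesis using e by (simp add: D_def)
      next
        case False
        have "z\<^sup>2 - of_real (r\<^sup>2) = z * (z - cnj z)"
          using complex_norm_square[of z] z by (simp add: power2_eq_square algebra_simps)
        then have "cmod (z\<^sup>2 - of_real (r\<^sup>2)) = 2 * r * \<bar>Im z\<bar>"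
          using z by (simp add: norm_mult complex_diff_cnj)
        then have "cmod (D z) = 2 * r * (\<bar>Im z\<bar> * cmod (S n z - F z))" by (simp add: D_def norm_mult)
        also have "\<dots> \<le> 2 * r * (\<bar>Im z\<bar> * (cmod (W n z - 1) * cmod (F z)) + cmod (G z) * (1 + 2 * r) * defect n)"
          using z r r0 by (intro mult_left_mono error_bound False Gr) auto
        also have "\<dots> \<le> 2 * r * (r * (e / (4 * c1) * BF) + BG * (1 + 2 * r) * (e / (4 * c2)))"
          using z r r0 B[of z] B0 elim abs_Im_le_cmod[of z] e c defect_nonneg[of n]
          by (intro mult_left_mono add_mono mult_mono mult_nonneg_nonneg) (auto simp: dist_norm less_imp_le)
        also have "\<dots> = (2 * r * (r * BF)) * (e / (4 * c1)) + (2 * r * (BG * (1 + 2 * r))) * (e / (4 * c2))"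
          by (simp add: algebra_simps)
        also have "\<dots> \<le> c1 * (e / (4 * c1)) + c2 * (e / (4 * c2))"
          using e c by (intro add_mono mult_right_mono) (auto simp: c1_def c2_def)
        also have "\<dots> = e / 2" using c by simp
        finally show ?thesis .
      qed
      show ?case
      proof
        fix z assume z: "z \<in> K"
        then have zr: "cmod z \<le> r0" by (rule r0)
        have "cmod (D z) \<le> e / 2"
        proof (rule maximum_modulus_frontier[of D "cball 0 r"])
          show "D holomorphic_on interior (cball 0 r)" "continuous_on (closure (cball 0 r)) D"
            using holomorphic_on_subset[OF Dh] holomorphic_on_imp_continuous_on by blast+
          show "cmod (D w) \<le> e / 2" if "w \<in> frontier (cball 0 r)" for w
            using that r r0 by (intro bd) auto
        qed (use zr r in auto)
        moreover have "1 \<le> cmod (z\<^sup>2 - of_real (r\<^sup>2))"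
        proof -
          have "(cmod z)\<^sup>2 \<le> r0\<^sup>2" using zr by (intro power_mono) auto
          moreover have "(r0 + 1)\<^sup>2 \<le> r\<^sup>2" using r r0 by (intro power_mono) auto
          moreover have "r0\<^sup>2 + 1 \<le> (r0 + 1)\<^sup>2" using r0 by (simp add: power2_eq_square algebra_simps)
          moreover have "cmod (of_real (r\<^sup>2)) - cmod (z\<^sup>2) \<le> cmod (of_real (r\<^sup>2) - z\<^sup>2)" by (rule norm_triangle_ineq2)
          ultimately show ?thesis by (simp add: norm_power norm_minus_commute)
        qed
        then have "cmod (S n z - F z) * 1 \<le> cmod (D z)"
          unfolding D_def norm_mult by (intro mult_left_mono) auto
        ultimately show "dist (S n z) (F z) < e" using e by (simp add: dist_norm)
      qed
    qed
  qed
qed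

end

section \<open>The summation method\<close>

lemma deriv_nonzero_if_zorder_1:
  assumes G: "G holomorphic_on UNIV" and l: "G l = 0" and nz: "G w \<noteq> 0" and z1: "zorder G l = 1"
  shows "deriv G l \<noteq> 0"
proof -
  define h where "h = zor_poly G l"
  obtain r where r: "r > 0" "h holomorphic_on cball l r" "\<And>w. w \<in> cball l r \<Longrightarrow> G w = h w * (w - l) \<and> h w \<noteq> 0"
  proof -
    have "\<exists>w\<in>UNIV. G w \<noteq> 0" using nz by blast
    from zorder_exist_zero[OF G open_UNIV connected_UNIV UNIV_I this, of l] show thesis
      using that z1 unfolding h_def by auto
  qed
  have "h holomorphic_on ball l r" using r(2) by (rule holomorphic_on_subset) auto
  then have "(h has_field_derivative deriv h l) (at l)"
    by (rule holomorphic_derivI) (use r in auto)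
  then have "((\<lambda>w. h w * (w - l)) has_field_derivative (deriv h l * (l - l) + 1 * h l)) (at l)"
    by (intro DERIV_mult) (auto intro!: derivative_eq_intros)
  then have "(G has_field_derivative (deriv h l * (l - l) + 1 * h l)) (at l)"
    by (rule has_field_derivative_transform_within_open[of _ _ _ "ball l r"]) (use r in auto)
  then have "deriv G l = h l" by (simp add: DERIV_imp_deriv)
  then show ?thesis using r(3)[of l] r(1) by simp
qed

context zeros_in_upper_half_plane
begin

lemma W_outside:
  assumes "G l = 0" "l \<notin> Z n"
  shows "W n l = 0"
proof -
  have "(\<Prod>a\<in>Z n. l - a) \<noteq> 0" using finite_Z[of n] assms(2) by auto
  then have "g n l = 0" using G_eq[of l n] assms(1) by simp
  then show ?thesis by (simp add: W_def)
qed

end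

theorem theorem1p3:
  fixes \<delta> :: real and G :: "complex \<Rightarrow> complex" and \<Lambda> :: "complex set"
  assumes "\<delta> > 0"
    and "G holomorphic_on UNIV"
    and "exp_type_on {z. Im z > 0} G = ereal pi"
    and "exp_type_on {z. Im z < 0} G = ereal pi"
    and "\<Lambda> = {z. G z = 0}"
    and "\<forall>l\<in>\<Lambda>. zorder G l = 1"
    and "\<Lambda> \<subseteq> {z. Im z > \<delta>}"
    and "integrable lborel (\<lambda>x::real. (cmod (G (of_real x)))\<^sup>2 / (1 + \<bar>x\<bar>\<^sup>2))"
    and "integrable lborel (\<lambda>x::real. 1 / ((cmod (G (of_real x)))\<^sup>2 * (1 + \<bar>x\<bar>\<^sup>2)))"
  shows "\<exists>w :: complex \<Rightarrow> nat \<Rightarrow> complex.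
      (\<forall>l\<in>\<Lambda>. (\<lambda>n. w l n) \<longlonglongrightarrow> 1) \<and>
      (\<forall>n. ((\<lambda>l. w l n) \<longlongrightarrow> 0) (inf at_infinity (principal \<Lambda>))) \<and>
      (\<forall>F\<in>paley_wiener. \<exists>S :: nat \<Rightarrow> complex \<Rightarrow> complex.
          (\<forall>n z. modulus_sums (\<lambda>l. w l n * F l * lagrange_fun G l z) \<Lambda> (S n z)) \<and>
          (\<forall>K. compact K \<longrightarrow> uniform_limit K S F sequentially))"
proof -
  note d = assms(1) and entire = assms(2) and up = assms(3) and low = assms(4)
    and \<Lambda> = assms(5) and simple = assms(6) and above = assms(7)
  have cont: "continuous_on UNIV G" by (rule holomorphic_on_imp_continuous_on[OF entire])
  have G0: "G 0 \<noteq> 0" using above d by (force simp: \<Lambda>)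
  have upper: "\<exists>C. \<forall>z. 0 < Im z \<longrightarrow> cmod (G z) \<le> C * exp ((pi + e) * cmod z)" if "e > 0" for e
    using exp_type_upper_bound[OF cont up pi_ge_zero that] by (metis mem_Collect_eq)
  have lower: "\<exists>C. \<forall>z. Im z < 0 \<longrightarrow> cmod (G z) \<le> C * exp ((pi + e) * cmod z)" if "e > 0" for e
    using exp_type_upper_bound[OF cont low pi_ge_zero that] by (metis mem_Collect_eq)
  obtain C where C: "C > 0" "\<And>z. cmod (G z) \<le> C * (1 + cmod z) ^ 3 * exp (pi * \<bar>Im z\<bar>)"
    using entire_growth[OF entire assms(8) upper lower] by blast
  have sharp: "\<exists>z. 0 < Im z \<and> C' * (1 + cmod z) ^ 3 * exp (a * Im z) < cmod (G z)"
    if a: "0 \<le> a" "a < pi" for a C'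
  proof (rule ccontr)
    assume neg: "\<not> ?thesis"
    have "cmod (G z) \<le> C' * (1 + cmod z) ^ 3 * exp (a * \<bar>Im z\<bar>)" if "z \<in> {z. Im z > 0}" for z
    proof -
      have "\<not> C' * (1 + cmod z) ^ 3 * exp (a * Im z) < cmod (G z)" using neg that by blast
      then show ?thesis using that by (simp add: not_less)
    qed
    from exp_type_le[of "{z. Im z > 0}", OF this a(1)] show False using up a(2) by simp
  qed
  have sharp': "\<exists>z. 0 < Im z \<and> C' * (1 + cmod z) ^ 3 * exp (a * Im z) < cmod (reflect G z)"
    if a: "0 \<le> a" "a < pi" for a C'
  proof (rule ccontr)
    assume neg: "\<not> ?thesis"
    have "cmod (G z) \<le> C' * (1 + cmod z) ^ 3 * exp (a * \<bar>Im z\<bar>)" if "z \<in> {z. Im z < 0}" for z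
    proof -
      have "\<not> C' * (1 + cmod (cnj z)) ^ 3 * exp (a * Im (cnj z)) < cmod (reflect G (cnj z))"
        using neg that by (auto dest: spec[of _ "cnj z"])
      then show ?thesis using that by (simp add: norm_reflect not_less)
    qed
    from exp_type_le[of "{z. Im z < 0}", OF this a(1)] show False using low a(2) by simp
  qed
  have simple': "deriv G l \<noteq> 0" if l: "G l = 0" for l
    by (rule deriv_nonzero_if_zorder_1[OF entire l G0]) (use simple l in \<open>simp add: \<Lambda>\<close>)
  interpret zeros_in_upper_half_plane G \<delta> C
  proof unfold_locales
    show "\<delta> > 0" "G holomorphic_on UNIV" by fact+
    show zeros: "\<delta> < Im z" if "G z = 0" for z using above that by (auto simp: \<Lambda>)
    show "deriv G z \<noteq> 0" if "G z = 0" for z by (rule simple'[OF that])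
    show "cmod (G z) \<le> C * (1 + cmod z) ^ 3 * exp (pi * \<bar>Im z\<bar>)" for z by (rule C)
    show "\<exists>z. 0 < Im z \<and> C' * (1 + cmod z) ^ 3 * exp (a * Im z) < cmod (G z)"
      if "0 \<le> a" "a < pi" for a C' by (rule sharp[OF that])
    show "pl_growth (\<lambda>z. 1 / (reflect G z * exp (\<i> * of_real pi * z)))"
    proof (rule reciprocal_growth[OF reflect_holomorphic[OF entire] d _ C(1) _ sharp'])
      show "reflect G z \<noteq> 0" if "- \<delta> < Im z" for z
        using zeros[of "cnj z"] that by (auto simp: reflect_def)
      show "cmod (reflect G z) \<le> C * (1 + cmod z) ^ 3 * exp (pi * \<bar>Im z\<bar>)" for z
        using C(2)[of "cnj z"] by (simp add: norm_reflect)
    qed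
    show "integrable lborel (\<lambda>x::real. 1 / ((cmod (G (of_real x)))\<^sup>2 * (1 + \<bar>x\<bar>\<^sup>2)))" by (rule assms(9))
  qed
  have fin: "finite {s \<in> \<Lambda>. cmod s \<le> r}" for r using finite_zeros[of r] by (simp add: \<Lambda>)
  show ?thesis
  proof (intro exI[of _ "\<lambda>l n. W n l"] conjI ballI allI)
    fix l
    show "(\<lambda>n. W n l) \<longlonglongrightarrow> 1"
      by (rule tendsto_uniform_limitI[OF W_uniform_limit[of "cmod l"]]) simp
  next
    fix n
    have "eventually (\<lambda>l. W n l = 0) (inf at_infinity (principal \<Lambda>))"
      unfolding eventually_inf_principal eventually_at_infinity
      by (rule exI[of _ "real n + 1"]) (auto simp: \<Lambda> Z_def intro!: W_outside)
    then show "((\<lambda>l. W n l) \<longlongrightarrow> 0) (inf at_infinity (principal \<Lambda>))"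
      by (rule tendsto_eventually)
  next
    fix F assume "F \<in> paley_wiener"
    then obtain g where "g \<in> borel_measurable (lebesgue_on {-pi<..<pi})"
      "integrable (lebesgue_on {-pi<..<pi}) (\<lambda>t. (cmod (g t))\<^sup>2)"
      "\<And>z. F z = 1 / (2 * of_real pi) * (LINT t|lebesgue_on {-pi<..<pi}. g t * exp (\<i> * of_real t * z))"
      by (auto simp: paley_wiener_def)
    then interpret pw: paley_wiener_repr F g by unfold_locales
    interpret interpolated_function G \<delta> C F "LINT t|lebesgue_on {-pi<..<pi}. cmod (g t)"
      by unfold_locales (rule pw.entire pw.norm_bound pw.square_integrable)+
    show "\<exists>S. (\<forall>n z. modulus_sums (\<lambda>l. W n l * F l * lagrange_fun G l z) \<Lambda> (S n z)) \<and>
          (\<forall>K. compact K \<longrightarrow> uniform_limit K S F sequentially)"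
    proof (intro exI[of _ S] conjI allI impI)
      fix n z
      show "modulus_sums (\<lambda>l. W n l * F l * lagrange_fun G l z) \<Lambda> (S n z)"
        unfolding S_def
        by (rule modulus_sums_finite_support[OF fin finite_Z])
           (auto simp: \<Lambda> Z_def W_outside)
    next
      fix K :: "complex set" assume "compact K"
      then show "uniform_limit K S F sequentially" by (rule S_uniform_limit)
    qed
  qed
qed

end
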